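(* Let $\bm\tau_h$ be any one of the three discrete viscous strain tensors $\bm\tau_h(\bm v)=\nabla_h\bm v$, $\nabla_h\bm v+(\nabla_h\bm v)^T$, or $\nabla_h\bm v+(\nabla_h\bm v)^T-\frac23(\nabla_h\cdot\bm v)\mathbb I$. Assume $\eta_F\ge\eta_0$ for all $F\in\mathcal F_h$, where $\eta_0$ is a sufficiently large constant independent of $h$; assume $\zeta_F\ge0.5$ for all $F\in\mathcal F_h^\partial$; and assume $$\|\bm f\|_{L^1(0,t;L^2(\Omega))}:=\int_0^t\|\bm f(s)\|_{L^2(\Omega)}\,ds<\infty\qquad\forall t\in[0,T].$$ Let $(\bm u_h(t),p_h(t))\in\bm V_h\times Q_h$ solve the semi-discrete scheme: for each $t\in(0,T]$, $$\begin{aligned}(\partial_t\bm u_h,\bm v_h)+c_h(\bm u_h;\bm u_h,\bm v_h)+\nu a_h(\bm u_h,\bm v_h)+d_h(\bm u_h,\bm v_h)-b_h(\bm v_h,p_h)&=(\bm f,\bm v_h)&&\forall\bm v_h\in\bm V_h,\\ b_h(\bm u_h,q_h)&=0&&\forall q_h\in Q_h,\end{aligned}$$ with $\bm u_h(0)=I_h\bm u_0$. Then for all $0\le t\le T$, $$\|\bm u_h(t)\|_{L^2(\Omega)}\le\|\bm u_h(0)\|_{L^2(\Omega)}+\|\bm f\|_{L^1(0,t;L^2(\Omega))}.$$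
   Context: Problem. The scheme discretizes the incompressible Navier–Stokes problem $\partial_t\bm u+\nabla\cdot(\bm u\otimes\bm u+p\mathbb I)-\nu\nabla\cdot\bm\tau(\bm u)=\bm f$, $\nabla\cdot\bm u=0$ in $(0,T]\times\Omega$, $\bm u=\bm0$ on $(0,T]\times\partial\Omega$, $\bm u(0,\cdot)=\bm u_0$, with constant $\nu>0$ and $\bm\tau$ the continuous counterpart of $\bm\tau_h$ (broken derivatives replaced by derivatives). $I_h$ is some interpolation operator onto $\bm V_h$. A semi-discrete solution is continuous in time on $[0,T]$ with $\bm u_h$ differentiable in time for $t\in(0,T]$. Mesh. $\Omega\subset\mathbb R^d$, $d\in\{2,3\}$, is a bounded Lipschitz domain and $\mathcal T_h$ is a conforming, shape-regular simplicial mesh of $\Omega$ (from a shape-regular family). $\mathcal F_h$ is the set of faces of $\mathcal T_h$, $\mathcal F_h^i$ the interior faces, $\mathcal F_h^\partial$ the boundary faces. $h_F$ is the diameter of $F$, and $h|_F=h_F$ is the face size function. "Independent of $h$" means not depending on the particular mesh in the family. "Sufficiently large" means: large enough that $a_h$ below is coercive, i.e. $a_h(\bm v_h,\bm v_h)\ge C\big(\|\bm\tau_h(\bm v_h)\|_{L^2(\Omega)}^2+\langle\eta h^{-1}[\![\bm v_h]\!],[\![\bm v_h]\!]\rangle_{\mathcal F_h}\big)$ for all $\bm v_h\in\bm V_h$ with some $C>0$ independent of $h$, whenever all $\eta_F\ge\eta_0$ (such an $\eta_0$ exists). Spaces. $\bm V_h$ is any linear subspace of $\{\bm v_h\in[L^2(\Omega)]^d:\bm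 v_h|_K\in[\mathcal P_r(K)]^d\ \forall K\in\mathcal T_h\}$ and $Q_h$ any linear subspace of $\{q_h\in L^2_0(\Omega):q_h|_K\in\mathcal P_k(K)\ \forall K\in\mathcal T_h\}$, where $\mathcal P_j(K)$ denotes polynomials of degree at most $j$ on $K$ and $L^2_0(\Omega)=\{q\in L^2(\Omega):\int_\Omega q=0\}$; no relation between $r$ and $k$ is required. Inner products and operators. $(\cdot,\cdot)$ is the $L^2(\Omega)$ inner product (scalar, vector, or matrix valued with Frobenius product); $\nabla_h$ is the broken (elementwise) gradient, $(\nabla\bm v)_{ij}=\partial_j v_i$, $\nabla_h\cdot$ the broken divergence, $\mathbb I$ the identity matrix, $(\bm a\otimes\bm b)_{ij}=a_ib_j$. $\langle\cdot,\cdot\rangle_\Sigma$ is the $L^2$ inner product on a $(d-1)$-dimensional set $\Sigma$, and $\langle\cdot,\cdot\rangle_{\partial\mathcal T_h}=\sum_{K}\langle\cdot,\cdot\rangle_{\partial K}$, $\langle\cdot,\cdot\rangle_{\partial\mathring{\mathcal T}_h}=\sum_K\langle\cdot,\cdot\rangle_{\partial K\setminus\partial\Omega}$, $\langle\cdot,\cdot\rangle_{\mathcal F_h}=\sum_{F\in\mathcal F_h}\langle\cdot,\cdot\rangle_F$. Jumps and averages. For $F\in\mathcal F_h^i$ a unit normal $\bm n_F$ is fixed, pointing from $K^+$ to $K^-$ (the two elements sharing $F$). On $F$: $[\![\bm v]\!]=\bm v|_{K^+}-\bm v|_{K^-}$, $[\![\bm v\otimes\bm n]\!]=\bm v|_{K^+}\otimes\bm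 n_F-\bm v|_{K^-}\otimes\bm n_F$, $\{\!\{\bm v\}\!\}=\frac12(\bm v|_{K^+}+\bm v|_{K^-})$, and similarly for scalars and matrices. For $F\in\mathcal F_h^\partial$ contained in $K$, $\bm n_F$ is the outward normal to $\partial\Omega$, $[\![\bm v]\!]=\{\!\{\bm v\}\!\}=\bm v|_K$, $[\![\bm v\otimes\bm n]\!]=\bm v|_K\otimes\bm n_F$. In face sums $\langle\cdot,\cdot\rangle_{\mathcal F_h}$, $\bm n|_F=\bm n_F$; in sums over $\partial K$ (i.e. $\langle\cdot,\cdot\rangle_{\partial\mathcal T_h}$, $\langle\cdot,\cdot\rangle_{\partial\mathring{\mathcal T}_h}$), a factor $\bm n$ appearing outside jump brackets is the outward unit normal of $K$. Forms. With piecewise constants $\eta=\{\eta_F\}$, $\zeta=\{\zeta_F\}$, $\eta_F,\zeta_F\ge0$, $$a_h(\bm v_h,\bm w_h)=(\bm\tau_h(\bm v_h),\nabla_h\bm w_h)-\langle(\{\!\{\bm\tau_h(\bm v_h)\}\!\}-\eta h^{-1}[\![\bm v_h\otimes\bm n]\!])\bm n,\bm w_h\rangle_{\partial\mathcal T_h}+\langle\{\!\{\bm v_h\}\!\}-\bm v_h,\bm\tau_h(\bm w_h)\bm n\rangle_{\partial\mathring{\mathcal T}_h}-\langle\bm v_h,\bm\tau_h(\bm w_h)\bm n\rangle_{\partial\Omega},$$ $$b_h(\bm v_h,q_h)=(\nabla_h\cdot\bm v_h,q_h)-\langle[\![\bm v_h]\!]\cdot\bm n,\{\!\{q_h\}\!\}\rangle_{\mathcal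 F_h},$$ $$\begin{aligned}c_h(\bm\beta_h;\bm v_h,\bm w_h)=&-(\bm v_h\otimes\bm\beta_h,\nabla_h\bm w_h)-\tfrac12((\nabla_h\cdot\bm\beta_h)\bm v_h,\bm w_h)+\langle(\zeta|\{\!\{\bm\beta_h\}\!\}\cdot\bm n|\,[\![\bm v_h\otimes\bm n]\!])\bm n,\bm w_h\rangle_{\partial\mathcal T_h}\\&+\langle(\{\!\{\bm v_h\}\!\}\otimes\{\!\{\bm\beta_h\}\!\})\bm n,\bm w_h\rangle_{\partial\mathcal T_h}+\tfrac12\langle\bm\beta_h,\bm n\{\!\{\bm v_h\cdot\bm w_h\}\!\}\rangle_{\partial\mathring{\mathcal T}_h}.\end{aligned}$$ The penalty $d_h(\cdot,\cdot)$ is a form, linear in its second argument, that is positive semi-definite, $d_h(\bm v_h,\bm v_h)\ge0$ for all $\bm v_h\in\bm V_h$, and consistent, $d_h(\bm u,\bm v_h)=0$ for all $\bm v_h\in\bm V_h$ where $\bm u$ is the exact solution. *)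

theory Defs
  imports "HOL-Analysis.Analysis"
begin

text \<open>Near every boundary point, and in a suitable direction \<open>e\<close>, the domain is the strict
  epigraph of a Lipschitz function on the hyperplane orthogonal to \<open>e\<close>.\<close>

definition bounded_lipschitz_domain :: "'a::euclidean_space set \<Rightarrow> bool" where
  "bounded_lipschitz_domain \<Omega> \<longleftrightarrow>
     open \<Omega> \<and> connected \<Omega> \<and> \<Omega> \<noteq> {} \<and> bounded \<Omega> \<and>
     (\<forall>x\<in>frontier \<Omega>. \<exists>U e L \<gamma>. open U \<and> x \<in> U \<and> norm e = 1 \<and>
        lipschitz_on L {y. y \<bullet> e = 0} \<gamma> \<and>
        \<Omega> \<inter> U = {y\<in>U. \<gamma> (y - (y \<bullet> e) *\<^sub>R e) < y \<bullet> e})"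

definition conforming_mesh :: "'a::euclidean_space set \<Rightarrow> 'a set set \<Rightarrow> bool" where
  "conforming_mesh \<Omega> \<T> \<longleftrightarrow>
     triangulation \<T> \<and> (\<forall>K\<in>\<T>. int DIM('a) simplex K) \<and> \<Union>\<T> = closure \<Omega>"

definition inradius :: "'a::euclidean_space set \<Rightarrow> real" where
  "inradius K = Sup {\<rho>. 0 \<le> \<rho> \<and> (\<exists>x. cball x \<rho> \<subseteq> K)}"

definition shape_regular_family :: "('h \<Rightarrow> 'a::euclidean_space set set) \<Rightarrow> bool" where
  "shape_regular_family mesh \<longleftrightarrow>
     (\<exists>\<sigma>. \<forall>h. \<forall>K\<in>mesh h. diameter K \<le> \<sigma> * inradius K)"

definition faces :: "'a::euclidean_space set set \<Rightarrow> 'a set set" where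
  "faces \<T> = {F. \<exists>K\<in>\<T>. F facet_of K}"

definition interior_faces :: "'a::euclidean_space set set \<Rightarrow> 'a set set" where
  "interior_faces \<T> = {F. \<exists>K\<in>\<T>. \<exists>K'\<in>\<T>. K \<noteq> K' \<and> F facet_of K \<and> F facet_of K'}"

text \<open>Since the mesh covers the closure of a Lipschitz domain, the faces belonging to one element
  only are those contained in \<open>frontier \<Omega>\<close>, and their union is \<open>frontier \<Omega>\<close>.\<close>

definition boundary_faces :: "'a::euclidean_space set set \<Rightarrow> 'a set set" where
  "boundary_faces \<T> = faces \<T> - interior_faces \<T>"

definition outward_normal :: "'a::euclidean_space set \<Rightarrow> 'a set \<Rightarrow> 'a" where
  "outward_normal K F = (THE n. norm n = 1 \<and> (\<forall>x\<in>K. \<forall>y\<in>F. n \<bullet> x \<le> n \<bullet> y))"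

text \<open>Fixing a unit normal \<open>n\<^sub>F\<close> on every face amounts to choosing the element \<open>P F\<close> that plays the
  role of \<open>K\<^sup>+\<close>; then \<open>n\<^sub>F\<close> is the normal on \<open>F\<close> pointing out of \<open>P F\<close>. On a boundary face there is
  only one choice, and \<open>n\<^sub>F\<close> is the outward normal of the domain.\<close>

definition orientation :: "'a::euclidean_space set set \<Rightarrow> ('a set \<Rightarrow> 'a set) \<Rightarrow> bool" where
  "orientation \<T> P \<longleftrightarrow> (\<forall>F\<in>faces \<T>. P F \<in> \<T> \<and> F facet_of P F)"

definition minus_element ::
    "'a::euclidean_space set set \<Rightarrow> ('a set \<Rightarrow> 'a set) \<Rightarrow> 'a set \<Rightarrow> 'a set" where
  "minus_element \<T> P F = (THE K. K \<in> \<T> \<and> F facet_of K \<and> K \<noteq> P F)"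

definition face_normal :: "('a::euclidean_space set \<Rightarrow> 'a set) \<Rightarrow> 'a set \<Rightarrow> 'a" where
  "face_normal P F = outward_normal (P F) F"

text \<open>Elements of \<open>L\<^sup>2(\<Omega>)\<close> are given by representatives; inner products, norms, traces
  and broken derivatives do not depend on the representative.\<close>

definition L2_space :: "'a::euclidean_space set \<Rightarrow> ('a \<Rightarrow> 'b::euclidean_space) set" where
  "L2_space \<Omega> = {v. v \<in> borel_measurable (lebesgue_on \<Omega>) \<and>
                     integrable (lebesgue_on \<Omega>) (\<lambda>x. (norm (v x))\<^sup>2)}"

definition L2_inner ::
    "'a::euclidean_space set \<Rightarrow> ('a \<Rightarrow> 'b::euclidean_space) \<Rightarrow> ('a \<Rightarrow> 'b) \<Rightarrow> real" where
  "L2_inner \<Omega> v w = (\<integral>x. v x \<bullet> w x \<partial>lebesgue_on \<Omega>)"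

definition L2_norm :: "'a::euclidean_space set \<Rightarrow> ('a \<Rightarrow> 'b::euclidean_space) \<Rightarrow> real" where
  "L2_norm \<Omega> v = sqrt (L2_inner \<Omega> v v)"

definition has_L2_derivative ::
    "(real \<Rightarrow> 'a::euclidean_space \<Rightarrow> 'b::euclidean_space) \<Rightarrow> ('a \<Rightarrow> 'b) \<Rightarrow>
     'a set \<Rightarrow> real set \<Rightarrow> real \<Rightarrow> bool" where
  "has_L2_derivative u u' \<Omega> I t \<longleftrightarrow> u' \<in> L2_space \<Omega> \<and>
     ((\<lambda>s. L2_norm \<Omega> (\<lambda>x. (u s x - u t x) /\<^sub>R (s - t) - u' x)) \<longlongrightarrow> 0) (at t within I)"

definition L2_continuous_on ::
    "(real \<Rightarrow> 'a::euclidean_space \<Rightarrow> 'b::euclidean_space) \<Rightarrow> 'a set \<Rightarrow> real set \<Rightarrow> bool" where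
  "L2_continuous_on u \<Omega> I \<longleftrightarrow>
     (\<forall>t\<in>I. ((\<lambda>s. L2_norm \<Omega> (\<lambda>x. u s x - u t x)) \<longlongrightarrow> 0) (at t within I))"

definition function_subspace :: "('a \<Rightarrow> 'b::real_vector) set \<Rightarrow> bool" where
  "function_subspace V \<longleftrightarrow> (\<lambda>x. 0) \<in> V \<and>
     (\<forall>v\<in>V. \<forall>w\<in>V. (\<lambda>x. v x + w x) \<in> V) \<and> (\<forall>c. \<forall>v\<in>V. (\<lambda>x. c *\<^sub>R v x) \<in> V)"

definition poly_space :: "nat \<Rightarrow> (real^'n \<Rightarrow> real) set" where
  "poly_space j = {p. \<exists>c. \<forall>x. p x =
     (\<Sum>\<alpha> | (\<Sum>i\<in>UNIV. \<alpha> i) \<le> j. c \<alpha> * (\<Prod>i\<in>UNIV. (x $ i) ^ \<alpha> i))}"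

definition broken_vector_space ::
    "(real^'n) set \<Rightarrow> (real^'n) set set \<Rightarrow> nat \<Rightarrow> (real^'n \<Rightarrow> real^'n) set" where
  "broken_vector_space \<Omega> \<T> r = {v \<in> L2_space \<Omega>. \<forall>K\<in>\<T>.
     \<exists>p. (\<forall>i. (\<lambda>x. p x $ i) \<in> poly_space r) \<and> (AE x\<in>K in lebesgue. v x = p x)}"

definition broken_pressure_space ::
    "(real^'n) set \<Rightarrow> (real^'n) set set \<Rightarrow> nat \<Rightarrow> (real^'n \<Rightarrow> real) set" where
  "broken_pressure_space \<Omega> \<T> k = {q \<in> L2_space \<Omega>. (\<integral>x. q x \<partial>lebesgue_on \<Omega>) = 0 \<and>
     (\<forall>K\<in>\<T>. \<exists>p\<in>poly_space k. AE x\<in>K in lebesgue. q x = p x)}"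

text \<open>\<open>piece v K\<close> is \<open>v\<close> restricted to \<open>K\<close>, as a polynomial; its values on the facets of \<open>K\<close> are the
  traces of \<open>v\<close> from \<open>K\<close>. Functions of an element and a point represent broken fields.\<close>

definition piece ::
    "('a::euclidean_space \<Rightarrow> 'b::euclidean_space) \<Rightarrow> 'a set \<Rightarrow> 'a \<Rightarrow> 'b" where
  "piece v K = (THE p. polynomial_function p \<and> (AE x\<in>K in lebesgue. v x = p x))"

definition broken_grad :: "(real^'n \<Rightarrow> real^'n) \<Rightarrow> (real^'n) set \<Rightarrow> real^'n \<Rightarrow> real^'n^'n" where
  "broken_grad v K x = jacobian (piece v K) (at x)"

definition broken_div :: "(real^'n \<Rightarrow> real^'n) \<Rightarrow> (real^'n) set \<Rightarrow> real^'n \<Rightarrow> real" where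
  "broken_div v K x = trace (broken_grad v K x)"

text \<open>The three viscous strain tensors as functions of the velocity gradient.\<close>

definition viscous_tensors :: "(real^'n^'n \<Rightarrow> real^'n^'n) set" where
  "viscous_tensors =
     {\<lambda>G. G, \<lambda>G. G + transpose G, \<lambda>G. G + transpose G - (2/3 * trace G) *\<^sub>R mat 1}"

definition tau_h :: "(real^'n^'n \<Rightarrow> real^'n^'n) \<Rightarrow> (real^'n \<Rightarrow> real^'n) \<Rightarrow>
    (real^'n) set \<Rightarrow> real^'n \<Rightarrow> real^'n^'n" where
  "tau_h \<tau> v K x = \<tau> (broken_grad v K x)"

definition outer :: "real^'n \<Rightarrow> real^'n \<Rightarrow> real^'n^'n" where
  "outer a b = (\<chi> i j. a $ i * b $ j)"

text \<open>Lebesgue measure on an affine subspace \<open>A\<close>, carried over from Cartesian coordinates with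
  respect to an orthonormal basis of the direction of \<open>A\<close>, just as \<^const>\<open>lborel\<close> is defined for the
  whole space. It does not depend on the origin and basis selected.\<close>

definition cartesian_frame :: "'a::euclidean_space set \<Rightarrow> 'a \<times> 'a set \<Rightarrow> bool" where
  "cartesian_frame A = (\<lambda>(p, B). p \<in> A \<and> pairwise orthogonal B \<and> (\<forall>b\<in>B. norm b = 1) \<and>
     span B = {x - p |x. x \<in> A})"

definition affine_lborel :: "'a::euclidean_space set \<Rightarrow> 'a measure" where
  "affine_lborel A = (let (p, B) = (SOME z. cartesian_frame A z) in
     distr (\<Pi>\<^sub>M b\<in>B. lborel) borel (\<lambda>f. p + (\<Sum>b\<in>B. f b *\<^sub>R b)))"

definition face_integral :: "'a::euclidean_space set \<Rightarrow> ('a \<Rightarrow> real) \<Rightarrow> real" where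
  "face_integral F g = (LINT x:F|affine_lborel (affine hull F). g x)"

definition inner_elements :: "'a::euclidean_space set set \<Rightarrow>
    ('a set \<Rightarrow> 'a \<Rightarrow> 'b::euclidean_space) \<Rightarrow> ('a set \<Rightarrow> 'a \<Rightarrow> 'b) \<Rightarrow> real" where
  "inner_elements \<T> f g = (\<Sum>K\<in>\<T>. \<integral>x. f K x \<bullet> g K x \<partial>lebesgue_on K)"

text \<open>\<open>inner_faces \<S>\<close> is the inner product over the union of the faces in \<open>\<S>\<close>; with the boundary
  faces for \<open>\<S>\<close> this is the inner product over \<open>frontier \<Omega>\<close>.\<close>

definition inner_faces :: "'a::euclidean_space set set \<Rightarrow>
    ('a set \<Rightarrow> 'a \<Rightarrow> 'b::euclidean_space) \<Rightarrow> ('a set \<Rightarrow> 'a \<Rightarrow> 'b) \<Rightarrow> real" where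
  "inner_faces \<S> f g = (\<Sum>F\<in>\<S>. face_integral F (\<lambda>x. f F x \<bullet> g F x))"

text \<open>The sums over element boundaries, with arguments depending on the element, the facet and the
  point; the second one leaves out the parts of the element boundaries on \<open>frontier \<Omega>\<close>.\<close>

definition inner_boundaries :: "'a::euclidean_space set set \<Rightarrow>
    ('a set \<Rightarrow> 'a set \<Rightarrow> 'a \<Rightarrow> 'b::euclidean_space) \<Rightarrow> ('a set \<Rightarrow> 'a set \<Rightarrow> 'a \<Rightarrow> 'b) \<Rightarrow> real" where
  "inner_boundaries \<T> f g =
     (\<Sum>K\<in>\<T>. \<Sum>F | F facet_of K. face_integral F (\<lambda>x. f K F x \<bullet> g K F x))"

definition inner_interior_boundaries :: "'a::euclidean_space set set \<Rightarrow>
    ('a set \<Rightarrow> 'a set \<Rightarrow> 'a \<Rightarrow> 'b::euclidean_space) \<Rightarrow> ('a set \<Rightarrow> 'a set \<Rightarrow> 'a \<Rightarrow> 'b) \<Rightarrow> real" where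
  "inner_interior_boundaries \<T> f g =
     (\<Sum>K\<in>\<T>. \<Sum>F | F facet_of K \<and> F \<in> interior_faces \<T>.
        face_integral F (\<lambda>x. f K F x \<bullet> g K F x))"

definition jump :: "'a::euclidean_space set set \<Rightarrow> ('a set \<Rightarrow> 'a set) \<Rightarrow>
    ('a set \<Rightarrow> 'a \<Rightarrow> 'b::real_vector) \<Rightarrow> 'a set \<Rightarrow> 'a \<Rightarrow> 'b" where
  "jump \<T> P g F x =
     (if F \<in> interior_faces \<T> then g (P F) x - g (minus_element \<T> P F) x else g (P F) x)"

definition avg :: "'a::euclidean_space set set \<Rightarrow> ('a set \<Rightarrow> 'a set) \<Rightarrow>
    ('a set \<Rightarrow> 'a \<Rightarrow> 'b::real_vector) \<Rightarrow> 'a set \<Rightarrow> 'a \<Rightarrow> 'b" where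
  "avg \<T> P g F x =
     (if F \<in> interior_faces \<T> then (1/2) *\<^sub>R (g (P F) x + g (minus_element \<T> P F) x)
      else g (P F) x)"

definition jump_n :: "(real^'n) set set \<Rightarrow> ((real^'n) set \<Rightarrow> (real^'n) set) \<Rightarrow>
    ((real^'n) set \<Rightarrow> real^'n \<Rightarrow> real^'n) \<Rightarrow> (real^'n) set \<Rightarrow> real^'n \<Rightarrow> real^'n^'n" where
  "jump_n \<T> P g F = jump \<T> P (\<lambda>K x. outer (g K x) (face_normal P F)) F"

definition a_form :: "(real^'n) set set \<Rightarrow> ((real^'n) set \<Rightarrow> (real^'n) set) \<Rightarrow>
    (real^'n^'n \<Rightarrow> real^'n^'n) \<Rightarrow> ((real^'n) set \<Rightarrow> real) \<Rightarrow>
    (real^'n \<Rightarrow> real^'n) \<Rightarrow> (real^'n \<Rightarrow> real^'n) \<Rightarrow> real" where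
  "a_form \<T> P \<tau> \<eta> v w =
     inner_elements \<T> (tau_h \<tau> v) (broken_grad w)
     - inner_boundaries \<T>
         (\<lambda>K F x. (avg \<T> P (tau_h \<tau> v) F x
                   - (\<eta> F / diameter F) *\<^sub>R jump_n \<T> P (piece v) F x) *v outward_normal K F)
         (\<lambda>K F x. piece w K x)
     + inner_interior_boundaries \<T>
         (\<lambda>K F x. avg \<T> P (piece v) F x - piece v K x)
         (\<lambda>K F x. tau_h \<tau> w K x *v outward_normal K F)
     - inner_faces (boundary_faces \<T>)
         (\<lambda>F x. piece v (P F) x)
         (\<lambda>F x. tau_h \<tau> w (P F) x *v face_normal P F)"

definition b_form :: "(real^'n) set set \<Rightarrow> ((real^'n) set \<Rightarrow> (real^'n) set) \<Rightarrow>
    (real^'n \<Rightarrow> real^'n) \<Rightarrow> (real^'n \<Rightarrow> real) \<Rightarrow> real" where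
  "b_form \<T> P v q =
     inner_elements \<T> (broken_div v) (piece q)
     - inner_faces (faces \<T>)
         (\<lambda>F x. jump \<T> P (piece v) F x \<bullet> face_normal P F) (avg \<T> P (piece q))"

definition c_form :: "(real^'n) set set \<Rightarrow> ((real^'n) set \<Rightarrow> (real^'n) set) \<Rightarrow>
    ((real^'n) set \<Rightarrow> real) \<Rightarrow> (real^'n \<Rightarrow> real^'n) \<Rightarrow>
    (real^'n \<Rightarrow> real^'n) \<Rightarrow> (real^'n \<Rightarrow> real^'n) \<Rightarrow> real" where
  "c_form \<T> P \<zeta> \<beta> v w =
     - inner_elements \<T> (\<lambda>K x. outer (piece v K x) (piece \<beta> K x)) (broken_grad w)
     - 1/2 * inner_elements \<T> (\<lambda>K x. broken_div \<beta> K x *\<^sub>R piece v K x) (piece w)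
     + inner_boundaries \<T>
         (\<lambda>K F x. ((\<zeta> F * \<bar>avg \<T> P (piece \<beta>) F x \<bullet> outward_normal K F\<bar>) *\<^sub>R
                     jump_n \<T> P (piece v) F x) *v outward_normal K F)
         (\<lambda>K F x. piece w K x)
     + inner_boundaries \<T>
         (\<lambda>K F x. outer (avg \<T> P (piece v) F x) (avg \<T> P (piece \<beta>) F x) *v outward_normal K F)
         (\<lambda>K F x. piece w K x)
     + 1/2 * inner_interior_boundaries \<T>
         (\<lambda>K F x. piece \<beta> K x)
         (\<lambda>K F x. avg \<T> P (\<lambda>K' y. piece v K' y \<bullet> piece w K' y) F x *\<^sub>R outward_normal K F)"

text \<open>\<open>\<eta>\<^sub>0\<close> is sufficiently large: on the whole mesh family, and for all penalty parameters bounded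
  below by \<open>\<eta>\<^sub>0\<close>, the viscous form is coercive with one and the same constant.\<close>

definition sufficiently_large :: "('h \<Rightarrow> (real^'n) set set) \<Rightarrow>
    ('h \<Rightarrow> (real^'n) set \<Rightarrow> (real^'n) set) \<Rightarrow> ('h \<Rightarrow> (real^'n \<Rightarrow> real^'n) set) \<Rightarrow>
    (real^'n^'n \<Rightarrow> real^'n^'n) \<Rightarrow> real \<Rightarrow> bool" where
  "sufficiently_large mesh P V \<tau> \<eta>\<^sub>0 \<longleftrightarrow>
     (\<exists>C>0. \<forall>h. \<forall>\<eta>. (\<forall>F\<in>faces (mesh h). 0 \<le> \<eta> F \<and> \<eta>\<^sub>0 \<le> \<eta> F) \<longrightarrow>
        (\<forall>v\<in>V h. a_form (mesh h) (P h) \<tau> \<eta> v v \<ge>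
           C * (inner_elements (mesh h) (tau_h \<tau> v) (tau_h \<tau> v) +
                inner_faces (faces (mesh h))
                  (\<lambda>F x. (\<eta> F / diameter F) *\<^sub>R jump (mesh h) (P h) (piece v) F x)
                  (jump (mesh h) (P h) (piece v)))))"

definition row_div :: "(real^'n \<Rightarrow> real^'n^'n) \<Rightarrow> real^'n \<Rightarrow> real^'n" where
  "row_div M x = (\<chi> i. trace (jacobian (\<lambda>y. M y $ i) (at x)))"

text \<open>Classical solutions of the incompressible Navier--Stokes problem.\<close>

definition navier_stokes_solution :: "(real^'n) set \<Rightarrow> real \<Rightarrow> real \<Rightarrow>
    (real^'n^'n \<Rightarrow> real^'n^'n) \<Rightarrow> (real \<Rightarrow> real^'n \<Rightarrow> real^'n) \<Rightarrow> (real^'n \<Rightarrow> real^'n) \<Rightarrow>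
    (real \<Rightarrow> real^'n \<Rightarrow> real^'n) \<Rightarrow> (real \<Rightarrow> real^'n \<Rightarrow> real) \<Rightarrow> bool" where
  "navier_stokes_solution \<Omega> T \<nu> \<tau> f u\<^sub>0 u p \<longleftrightarrow>
     (\<forall>t\<in>{0<..T}. continuous_on (closure \<Omega>) (u t)) \<and>
     (\<forall>x\<in>\<Omega>. continuous_on {0..T} (\<lambda>t. u t x)) \<and>
     (\<forall>t\<in>{0<..T}. \<forall>x\<in>\<Omega>.
        u t differentiable (at x) \<and>
        (\<lambda>y. outer (u t y) (u t y) + p t y *\<^sub>R mat 1) differentiable (at x) \<and>
        (\<lambda>y. \<tau> (jacobian (u t) (at y))) differentiable (at x) \<and>
        (\<exists>u'. ((\<lambda>s. u s x) has_vector_derivative u') (at t within {0..T}) \<and>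
           u' + row_div (\<lambda>y. outer (u t y) (u t y) + p t y *\<^sub>R mat 1) x
              - \<nu> *\<^sub>R row_div (\<lambda>y. \<tau> (jacobian (u t) (at y))) x = f t x) \<and>
        trace (jacobian (u t) (at x)) = 0) \<and>
     (\<forall>t\<in>{0<..T}. \<forall>x\<in>frontier \<Omega>. u t x = 0) \<and>
     (\<forall>x\<in>\<Omega>. u 0 x = u\<^sub>0 x)"

end

theory Submission
  imports Defs
begin

text \<open>The scheme is tested with its own solution. At time \<open>t\<close> the test function \<open>u t\<close> gives
  \<open>(u', u) + c(u; u, u) + \<nu> a(u, u) + d(u, u) - b(u, p) = (f, u)\<close>. The pressure term vanishes because
  \<open>p t\<close> is an admissible test function in the continuity equation, \<open>a\<close> is nonnegative by coercivity
  (\<open>viscous_form_nonneg\<close>) and \<open>d\<close> by assumption. Once \<open>c(u; u, u) \<ge> 0\<close> is known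
  (\<open>convection_nonneg\<close>), it follows that \<open>(u', u) \<le> (f, u)\<close>, and integration in time gives the claim
  (\<open>energy_estimate\<close>).

  \<^bold>\<open>Convection.\<close> On each simplex the volume terms of \<open>c(v; v, v)\<close> are minus the integral of the divergence
  of \<open>\<bar>v\<bar>\<^sup>2 v / 2\<close>, so they become minus the integrals of \<open>\<bar>v\<bar>\<^sup>2 (v \<bullet> n) / 2\<close> over the element boundaries
  (\<open>integral_divergence\<close>). All terms are then sums over faces. An interior face belongs to exactly
  two elements, with opposite normals (\<open>opposite_normals\<close>, \<open>neighbour_unique\<close>), and the terms from both
  sides cancel up to the upwind penalty, which is nonnegative (\<open>interior_face_contribution\<close>). On a
  boundary face the flux \<open>(v \<bullet> n) \<bar>v\<bar>\<^sup>2 / 2\<close> remains, which is absorbed by the penalty since there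
  \<open>\<zeta> \<ge> 1/2\<close> (\<open>boundary_face_contribution\<close>).

  \<^bold>\<open>Divergence theorem.\<close> The measure on a facet is defined through an orthonormal frame of its
  hyperplane \<open>H\<close>. It is tied to Lebesgue measure on the whole space by Fubini in oblique coordinates: the
  integral of \<open>g\<close> is \<open>\<bar>e \<bullet> n\<bar>\<close> times the integral over \<open>y\<close> in \<open>H\<close> of the integral of \<open>g (y + t e)\<close> over \<open>t\<close>
  (\<open>integral_slices_along\<close>). If \<open>e\<close> is the edge from a vertex \<open>w\<close> to a vertex \<open>v\<close>, then every line in the
  direction \<open>e\<close> that meets the simplex enters it through the facet opposite to \<open>v\<close> and leaves it
  through the facet opposite to \<open>w\<close>, and all other facets are parallel to \<open>e\<close>. The fundamental theorem
  of calculus on these lines therefore yields the theorem for derivatives along edges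
  (\<open>integral_edge_derivative\<close>), and the edges at a vertex span all directions
  (\<open>integral_derivative\<close>).

  \<^bold>\<open>Time.\<close> The function \<open>sqrt (\<parallel>u\<parallel>\<^sup>2 + \<epsilon>)\<close> is differentiable at every inner time, with a derivative that
  is at most \<open>\<parallel>f\<parallel>\<close> almost everywhere. Integrating in the sense of Henstock and Kurzweil and letting
  \<open>\<epsilon>\<close> tend to zero gives the estimate.\<close>

section \<open>The energy inequality\<close>

lemma L2_inner_integrable:
  assumes "v \<in> L2_space \<Omega>" "w \<in> L2_space \<Omega>"
  shows "integrable (lebesgue_on \<Omega>) (\<lambda>x. v x \<bullet> w x)"
proof (rule Bochner_Integration.integrable_bound)
  show "integrable (lebesgue_on \<Omega>) (\<lambda>x. (norm (v x))\<^sup>2 + (norm (w x))\<^sup>2)"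
    using assms by (simp add: L2_space_def)
  show "(\<lambda>x. v x \<bullet> w x) \<in> borel_measurable (lebesgue_on \<Omega>)"
    using assms by (auto simp: L2_space_def)
  have "\<bar>a \<bullet> b\<bar> \<le> (norm a)\<^sup>2 + (norm b)\<^sup>2" for a b :: 'b
  proof -
    have "\<bar>a \<bullet> b\<bar> \<le> norm a * norm b" by (rule Cauchy_Schwarz_ineq2)
    also have "\<dots> \<le> (norm a)\<^sup>2 + (norm b)\<^sup>2"
      using sum_squares_bound[of "norm a" "norm b"] zero_le_power2[of "norm a"] zero_le_power2[of "norm b"]
      by linarith
    finally show ?thesis .
  qed
  then show "AE x in lebesgue_on \<Omega>. norm (v x \<bullet> w x) \<le> norm ((norm (v x))\<^sup>2 + (norm (w x))\<^sup>2)"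
    by (simp add: abs_of_nonneg)
qed

lemma L2_space_add:
  assumes "v \<in> L2_space \<Omega>" "w \<in> L2_space \<Omega>"
  shows "(\<lambda>x. v x + w x) \<in> L2_space \<Omega>"
proof -
  have "integrable (lebesgue_on \<Omega>) (\<lambda>x. v x \<bullet> v x + 2 * (v x \<bullet> w x) + w x \<bullet> w x)"
    by (intro Bochner_Integration.integrable_add integrable_mult_right L2_inner_integrable assms)
  moreover have "(\<lambda>x. v x \<bullet> v x + 2 * (v x \<bullet> w x) + w x \<bullet> w x) = (\<lambda>x. (norm (v x + w x))\<^sup>2)"
    by (auto simp: power2_norm_eq_inner algebra_simps inner_commute)
  ultimately show ?thesis using assms by (auto simp: L2_space_def)
qed

lemma L2_space_scale: "v \<in> L2_space \<Omega> \<Longrightarrow> (\<lambda>x. c *\<^sub>R v x) \<in> L2_space \<Omega>"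
  by (auto simp: L2_space_def power_mult_distrib)

lemma L2_space_diff:
  assumes "v \<in> L2_space \<Omega>" "w \<in> L2_space \<Omega>"
  shows "(\<lambda>x. v x - w x) \<in> L2_space \<Omega>"
  using L2_space_add[OF assms(1) L2_space_scale[OF assms(2), of "-1"]] by simp

lemma L2_inner_add_left:
  assumes "v \<in> L2_space \<Omega>" "w \<in> L2_space \<Omega>" "z \<in> L2_space \<Omega>"
  shows "L2_inner \<Omega> (\<lambda>x. v x + w x) z = L2_inner \<Omega> v z + L2_inner \<Omega> w z"
  unfolding L2_inner_def inner_add_left
  by (intro Bochner_Integration.integral_add L2_inner_integrable assms)

lemma L2_inner_scale_left: "L2_inner \<Omega> (\<lambda>x. c *\<^sub>R v x) z = c * L2_inner \<Omega> v z"
  by (simp add: L2_inner_def)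

lemma L2_inner_commute: "L2_inner \<Omega> v w = L2_inner \<Omega> w v"
  by (simp add: L2_inner_def inner_commute)

lemma L2_inner_add_right:
  assumes "v \<in> L2_space \<Omega>" "w \<in> L2_space \<Omega>" "z \<in> L2_space \<Omega>"
  shows "L2_inner \<Omega> z (\<lambda>x. v x + w x) = L2_inner \<Omega> z v + L2_inner \<Omega> z w"
  using L2_inner_add_left[OF assms] by (simp add: L2_inner_def inner_commute)

lemma L2_inner_scale_right: "L2_inner \<Omega> z (\<lambda>x. c *\<^sub>R v x) = c * L2_inner \<Omega> z v"
  by (simp add: L2_inner_def)

lemma L2_inner_self_nonneg: "0 \<le> L2_inner \<Omega> v v"
  by (simp add: L2_inner_def)

lemma L2_norm_power2: "(L2_norm \<Omega> v)\<^sup>2 = L2_inner \<Omega> v v"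
  by (simp add: L2_norm_def L2_inner_self_nonneg)

lemma L2_norm_nonneg: "0 \<le> L2_norm \<Omega> v"
  by (simp add: L2_norm_def L2_inner_self_nonneg)

lemma L2_norm_scale: "L2_norm \<Omega> (\<lambda>x. c *\<^sub>R v x) = \<bar>c\<bar> * L2_norm \<Omega> v"
  by (simp add: L2_norm_def L2_inner_def real_sqrt_mult flip: power2_eq_square mult.assoc)

lemma L2_inner_add_self:
  assumes "v \<in> L2_space \<Omega>" "w \<in> L2_space \<Omega>"
  shows "L2_inner \<Omega> (\<lambda>x. v x + w x) (\<lambda>x. v x + w x) =
    L2_inner \<Omega> v v + 2 * L2_inner \<Omega> v w + L2_inner \<Omega> w w"
  using assms L2_space_add[OF assms]
  by (simp add: L2_inner_add_left L2_inner_add_right L2_inner_commute[of _ w v])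

text \<open>On representatives \<open>L2_inner\<close> is only positive semidefinite; hence the
  discriminant argument needs the case of a null second factor on its own.\<close>

lemma L2_Cauchy_Schwarz:
  assumes v: "v \<in> L2_space \<Omega>" and w: "w \<in> L2_space \<Omega>"
  shows "\<bar>L2_inner \<Omega> v w\<bar> \<le> L2_norm \<Omega> v * L2_norm \<Omega> w"
proof -
  have q: "0 \<le> L2_inner \<Omega> w w * c\<^sup>2 + 2 * L2_inner \<Omega> v w * c + L2_inner \<Omega> v v" for c
    using L2_inner_add_self[OF v L2_space_scale[OF w, of c]]
      L2_inner_self_nonneg[of \<Omega> "\<lambda>x. v x + c *\<^sub>R w x"]
    by (simp add: L2_inner_scale_left L2_inner_scale_right power2_eq_square algebra_simps)
  have "(L2_inner \<Omega> v w)\<^sup>2 \<le> L2_inner \<Omega> v v * L2_inner \<Omega> w w"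
  proof (cases "L2_inner \<Omega> w w = 0")
    case True
    have "L2_inner \<Omega> v w = 0"
    proof (rule ccontr)
      assume "L2_inner \<Omega> v w \<noteq> 0"
      then show False
        using q[of "- (L2_inner \<Omega> v v + 1) / (2 * L2_inner \<Omega> v w)"] True by simp
    qed
    then show ?thesis using True by simp
  next
    case False
    then have pos: "L2_inner \<Omega> w w > 0" using L2_inner_self_nonneg[of \<Omega> w] by simp
    have "0 \<le> L2_inner \<Omega> w w * (L2_inner \<Omega> w w * (- L2_inner \<Omega> v w / L2_inner \<Omega> w w)\<^sup>2
        + 2 * L2_inner \<Omega> v w * (- L2_inner \<Omega> v w / L2_inner \<Omega> w w) + L2_inner \<Omega> v v)"
      using q[of "- L2_inner \<Omega> v w / L2_inner \<Omega> w w"] pos by simp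
    also have "\<dots> = L2_inner \<Omega> v v * L2_inner \<Omega> w w - (L2_inner \<Omega> v w)\<^sup>2"
      using False by (simp add: field_simps power2_eq_square)
    finally show ?thesis by simp
  qed
  then have "sqrt ((L2_inner \<Omega> v w)\<^sup>2) \<le> sqrt (L2_inner \<Omega> v v * L2_inner \<Omega> w w)"
    by (rule real_sqrt_le_mono)
  then show ?thesis by (simp add: L2_norm_def real_sqrt_mult)
qed

lemma L2_norm_triangle:
  assumes v: "v \<in> L2_space \<Omega>" and w: "w \<in> L2_space \<Omega>"
  shows "L2_norm \<Omega> (\<lambda>x. v x + w x) \<le> L2_norm \<Omega> v + L2_norm \<Omega> w"
proof (rule power2_le_imp_le)
  show "(L2_norm \<Omega> (\<lambda>x. v x + w x))\<^sup>2 \<le> (L2_norm \<Omega> v + L2_norm \<Omega> w)\<^sup>2"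
    using L2_Cauchy_Schwarz[OF v w] L2_inner_add_self[OF v w]
    by (simp add: L2_norm_power2 power2_sum)
qed (simp add: L2_norm_nonneg)

lemma L2_norm_triangle_diff:
  assumes v: "v \<in> L2_space \<Omega>" and w: "w \<in> L2_space \<Omega>"
  shows "\<bar>L2_norm \<Omega> v - L2_norm \<Omega> w\<bar> \<le> L2_norm \<Omega> (\<lambda>x. v x - w x)"
proof -
  have "L2_norm \<Omega> v \<le> L2_norm \<Omega> (\<lambda>x. v x - w x) + L2_norm \<Omega> w"
    using L2_norm_triangle[OF L2_space_diff[OF v w] w] by simp
  moreover have "L2_norm \<Omega> w \<le> L2_norm \<Omega> (\<lambda>x. w x - v x) + L2_norm \<Omega> v"
    using L2_norm_triangle[OF L2_space_diff[OF w v] v] by simp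
  moreover have "L2_norm \<Omega> (\<lambda>x. w x - v x) = L2_norm \<Omega> (\<lambda>x. v x - w x)"
    using L2_norm_scale[of \<Omega> "-1" "\<lambda>x. v x - w x"] by simp
  ultimately show ?thesis by linarith
qed

lemma L2_continuous_on_norm:
  assumes u: "\<And>t. t \<in> S \<Longrightarrow> u t \<in> L2_space \<Omega>" and cont: "L2_continuous_on u \<Omega> S"
  shows "continuous_on S (\<lambda>t. L2_norm \<Omega> (u t))"
  unfolding continuous_on
proof
  fix t assume t: "t \<in> S"
  show "((\<lambda>t. L2_norm \<Omega> (u t)) \<longlongrightarrow> L2_norm \<Omega> (u t)) (at t within S)"
  proof (rule LIM_zero_cancel, rule Lim_null_comparison)
    show "\<forall>\<^sub>F s in at t within S. norm (L2_norm \<Omega> (u s) - L2_norm \<Omega> (u t)) \<le> L2_norm \<Omega> (\<lambda>x. u s x - u t x)"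
      unfolding eventually_at_topological using u t
      by (auto intro!: exI[of _ UNIV] L2_norm_triangle_diff)
    show "((\<lambda>s. L2_norm \<Omega> (\<lambda>x. u s x - u t x)) \<longlongrightarrow> 0) (at t within S)"
      using cont t by (auto simp: L2_continuous_on_def)
  qed
qed

text \<open>With the difference quotient \<open>\<delta> s\<close> one has \<open>u s = u t + (s - t) \<delta> s\<close>, and expanding the square gives
  the difference quotient of the energy as \<open>2 (\<delta> s, u t) + (s - t) \<parallel>\<delta> s\<parallel>\<^sup>2\<close>. Both terms converge because
  \<open>\<delta> s\<close> does.\<close>

lemma has_L2_derivative_energy:
  assumes u: "\<And>t. t \<in> S \<Longrightarrow> u t \<in> L2_space \<Omega>" and t: "t \<in> S"
    and der: "has_L2_derivative u u' \<Omega> S t"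
  shows "((\<lambda>s. L2_inner \<Omega> (u s) (u s)) has_real_derivative 2 * L2_inner \<Omega> u' (u t)) (at t within S)"
proof -
  define \<delta> where "\<delta> s = (\<lambda>x. (u s x - u t x) /\<^sub>R (s - t))" for s
  have u': "u' \<in> L2_space \<Omega>" and lim: "((\<lambda>s. L2_norm \<Omega> (\<lambda>x. \<delta> s x - u' x)) \<longlongrightarrow> 0) (at t within S)"
    using der by (auto simp: has_L2_derivative_def \<delta>_def)
  have \<delta>: "\<delta> s \<in> L2_space \<Omega>" if "s \<in> S" for s
    unfolding \<delta>_def by (intro L2_space_scale L2_space_diff u that t)
  have lim1: "((\<lambda>s. L2_inner \<Omega> (\<delta> s) (u t)) \<longlongrightarrow> L2_inner \<Omega> u' (u t)) (at t within S)"
  proof (rule LIM_zero_cancel, rule Lim_null_comparison)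
    show "((\<lambda>s. L2_norm \<Omega> (\<lambda>x. \<delta> s x - u' x) * L2_norm \<Omega> (u t)) \<longlongrightarrow> 0) (at t within S)"
      using tendsto_mult_right[OF lim, of "L2_norm \<Omega> (u t)"] by simp
    have "norm (L2_inner \<Omega> (\<delta> s) (u t) - L2_inner \<Omega> u' (u t)) \<le> L2_norm \<Omega> (\<lambda>x. \<delta> s x - u' x) * L2_norm \<Omega> (u t)"
      if s: "s \<in> S" for s
    proof -
      have "L2_inner \<Omega> (\<delta> s) (u t) - L2_inner \<Omega> u' (u t) = L2_inner \<Omega> (\<lambda>x. \<delta> s x - u' x) (u t)"
        using L2_inner_add_left[OF L2_space_diff[OF \<delta>[OF s] u'] u' u[OF t]] by simp
      then show ?thesis
        using L2_Cauchy_Schwarz[OF L2_space_diff[OF \<delta>[OF s] u'] u[OF t]] by simp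
    qed
    then show "\<forall>\<^sub>F s in at t within S. norm (L2_inner \<Omega> (\<delta> s) (u t) - L2_inner \<Omega> u' (u t))
        \<le> L2_norm \<Omega> (\<lambda>x. \<delta> s x - u' x) * L2_norm \<Omega> (u t)"
      unfolding eventually_at_topological by (auto intro!: exI[of _ UNIV])
  qed
  have lim2: "((\<lambda>s. L2_norm \<Omega> (\<delta> s)) \<longlongrightarrow> L2_norm \<Omega> u') (at t within S)"
  proof (rule LIM_zero_cancel, rule Lim_null_comparison[OF _ lim])
    show "\<forall>\<^sub>F s in at t within S. norm (L2_norm \<Omega> (\<delta> s) - L2_norm \<Omega> u') \<le> L2_norm \<Omega> (\<lambda>x. \<delta> s x - u' x)"
      unfolding eventually_at_topological using \<delta> u'
      by (auto intro!: exI[of _ UNIV] L2_norm_triangle_diff)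
  qed
  have quot: "(L2_inner \<Omega> (u s) (u s) - L2_inner \<Omega> (u t) (u t)) / (s - t) =
      2 * L2_inner \<Omega> (\<delta> s) (u t) + (s - t) * (L2_norm \<Omega> (\<delta> s))\<^sup>2" if s: "s \<in> S" "s \<noteq> t" for s
  proof -
    have us: "u s = (\<lambda>x. u t x + (s - t) *\<^sub>R \<delta> s x)"
      using s by (simp add: \<delta>_def)
    have "L2_inner \<Omega> (u s) (u s) = L2_inner \<Omega> (u t) (u t) + 2 * (s - t) * L2_inner \<Omega> (\<delta> s) (u t)
        + (s - t)\<^sup>2 * (L2_norm \<Omega> (\<delta> s))\<^sup>2"
      by (subst (1 2) us, subst L2_inner_add_self[OF u[OF t] L2_space_scale[OF \<delta>[OF s(1)]]])
        (simp add: L2_inner_scale_left L2_inner_scale_right L2_inner_commute[of _ "u t" "\<delta> s"]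
          L2_norm_power2, simp add: power2_eq_square algebra_simps)
    then show ?thesis using s(2) by (simp add: field_simps power2_eq_square)
  qed
  have "((\<lambda>s. 2 * L2_inner \<Omega> (\<delta> s) (u t) + (s - t) * (L2_norm \<Omega> (\<delta> s))\<^sup>2) \<longlongrightarrow>
      2 * L2_inner \<Omega> u' (u t) + (t - t) * (L2_norm \<Omega> u')\<^sup>2) (at t within S)"
    by (intro tendsto_intros lim1 lim2)
  then show ?thesis
    unfolding has_field_derivative_iff
    by (simp, elim Lim_transform_eventually)
      (use quot in \<open>auto simp: eventually_at_topological intro!: exI[of _ UNIV]\<close>)
qed

text \<open>Formally, \<open>\<parallel>u\<parallel> \<parallel>u\<parallel>' = (u', u) \<le> \<parallel>f\<parallel> \<parallel>u\<parallel>\<close>, so that \<open>\<parallel>u\<parallel>' \<le> \<parallel>f\<parallel>\<close>. The norm need not be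
  differentiable where \<open>u\<close> vanishes, so it is replaced by \<open>sqrt (\<parallel>u\<parallel>\<^sup>2 + \<epsilon>)\<close>. The derivative of that
  function exists at every inner time, but nothing is known about its integrability, and it is
  bounded by \<open>\<parallel>f\<parallel>\<close> only for almost every time. Both obstacles are absent for the Henstock--Kurzweil
  integral: it recovers a function from an everywhere existing derivative, and it does not see
  null sets.\<close>

lemma energy_estimate:
  assumes u: "\<And>t. t \<in> {0..T} \<Longrightarrow> u t \<in> L2_space \<Omega>"
    and cont: "L2_continuous_on u \<Omega> {0..T}"
    and der: "\<And>t. t \<in> {0<..T} \<Longrightarrow> has_L2_derivative u (u' t) \<Omega> {0..T} t"
    and f: "AE s in lebesgue_on {0..T}. f s \<in> L2_space \<Omega>"
    and int: "integrable (lebesgue_on {0..t}) (\<lambda>s. L2_norm \<Omega> (f s))"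
    and le: "\<And>t. t \<in> {0<..T} \<Longrightarrow> L2_inner \<Omega> (u' t) (u t) \<le> L2_inner \<Omega> (f t) (u t)"
    and t: "t \<in> {0..T}"
  shows "L2_norm \<Omega> (u t) \<le> L2_norm \<Omega> (u 0) + (\<integral>s. L2_norm \<Omega> (f s) \<partial>lebesgue_on {0..t})"
proof -
  define N where "N s = L2_inner \<Omega> (u s) (u s)" for s
  have Nnn: "0 \<le> N s" for s by (simp add: N_def L2_inner_self_nonneg)
  let ?g = "\<lambda>s. L2_norm \<Omega> (f s)"
  have gI: "(?g has_integral (\<integral>s. ?g s \<partial>lebesgue_on {0..t})) {0..t}"
    using has_integral_integral_lebesgue_on[OF int] by simp
  obtain Z where Z: "negligible Z" "\<And>s. s \<in> {0..T} - Z \<Longrightarrow> f s \<in> L2_space \<Omega>"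
  proof -
    from f have "AE s in lebesgue. s \<in> {0..T} \<longrightarrow> f s \<in> L2_space \<Omega>"
      by (subst (asm) AE_restrict_space_iff) auto
    then obtain Z where Z: "\<And>s. s \<in> space lebesgue - Z \<Longrightarrow> s \<in> {0..T} \<longrightarrow> f s \<in> L2_space \<Omega>"
        "Z \<in> null_sets lebesgue"
      by (rule AE_E3) blast
    then show thesis using that[of Z] by (simp add: negligible_iff_null_sets)
  qed
  have est: "sqrt (N t + \<epsilon>) \<le> sqrt (N 0 + \<epsilon>) + (\<integral>s. ?g s \<partial>lebesgue_on {0..t})" if \<epsilon>: "\<epsilon> > 0" for \<epsilon>
  proof -
    let ?d = "\<lambda>s. L2_inner \<Omega> (u' s) (u s) / sqrt (N s + \<epsilon>)"
    have pos: "N s + \<epsilon> > 0" for s using Nnn[of s] \<epsilon> by linarith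
    have cN: "continuous_on {0..t} N"
    proof -
      have "continuous_on {0..t} (\<lambda>s. (L2_norm \<Omega> (u s))\<^sup>2)"
        using continuous_on_subset[OF L2_continuous_on_norm[OF u cont], of "{0..t}"] t
        by (intro continuous_intros) auto
      then show ?thesis by (simp add: L2_norm_power2 N_def)
    qed
    have dI: "(?d has_integral sqrt (N t + \<epsilon>) - sqrt (N 0 + \<epsilon>)) {0..t}"
    proof (rule fundamental_theorem_of_calculus_interior)
      show "0 \<le> t" using t by simp
      show "continuous_on {0..t} (\<lambda>s. sqrt (N s + \<epsilon>))"
        by (intro continuous_intros cN)
      fix s assume s: "s \<in> {0<..<t}"
      then have sT: "s \<in> {0<..T}" "s \<in> interior {0..T}" using t by auto
      have "(N has_real_derivative 2 * L2_inner \<Omega> (u' s) (u s)) (at s within {0..T})"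
        unfolding N_def using has_L2_derivative_energy[OF u _ der[OF sT(1)]] sT by auto
      then have "(N has_real_derivative 2 * L2_inner \<Omega> (u' s) (u s)) (at s)"
        using at_within_interior[OF sT(2)] by simp
      then have "((\<lambda>s. sqrt (N s + \<epsilon>)) has_real_derivative ?d s) (at s)"
        using pos[of s] by (auto intro!: derivative_eq_intros simp: divide_simps)
      then show "((\<lambda>s. sqrt (N s + \<epsilon>)) has_vector_derivative ?d s) (at s)"
        by (simp add: has_real_derivative_iff_has_vector_derivative)
    qed
    \<comment> \<open>the bound by the force may fail on a null set only, where it may be replaced by the derivative itself\<close>
    define g' where "g' s = (if s \<in> insert 0 Z then ?d s else ?g s)" for s
    have "(g' has_integral (\<integral>s. ?g s \<partial>lebesgue_on {0..t})) {0..t}"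
      by (rule has_integral_spike[OF _ _ gI, of "insert 0 Z"]) (use Z(1) in \<open>auto simp: g'_def\<close>)
    then have "sqrt (N t + \<epsilon>) - sqrt (N 0 + \<epsilon>) \<le> (\<integral>s. ?g s \<partial>lebesgue_on {0..t})"
    proof (rule has_integral_le[OF dI])
      fix s assume s: "s \<in> {0..t}"
      show "?d s \<le> g' s"
      proof (cases "s \<in> insert 0 Z")
        case False
        then have sT: "s \<in> {0<..T}" "f s \<in> L2_space \<Omega>" "u s \<in> L2_space \<Omega>" using s t Z u by auto
        have "L2_inner \<Omega> (u' s) (u s) \<le> \<bar>L2_inner \<Omega> (f s) (u s)\<bar>" using le[OF sT(1)] by linarith
        also have "\<dots> \<le> ?g s * L2_norm \<Omega> (u s)" by (rule L2_Cauchy_Schwarz) (use sT in auto)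
        also have "\<dots> \<le> ?g s * sqrt (N s + \<epsilon>)"
          using \<epsilon> by (intro mult_left_mono) (auto simp: N_def L2_norm_def L2_inner_self_nonneg)
        finally have "?d s \<le> ?g s" using pos[of s] by (simp add: divide_simps)
        then show ?thesis using False by (simp add: g'_def)
      qed (simp add: g'_def)
    qed
    then show ?thesis by simp
  qed
  have lim: "((\<lambda>\<epsilon>. sqrt (N s + \<epsilon>)) \<longlongrightarrow> sqrt (N s + 0)) (at_right 0)" for s
    by (intro tendsto_intros)
  have "sqrt (N t + 0) \<le> sqrt (N 0 + 0) + (\<integral>s. ?g s \<partial>lebesgue_on {0..t})"
    by (rule tendsto_le[OF _ tendsto_add[OF lim tendsto_const] lim])
      (auto intro!: est eventually_at_right_less[THEN eventually_mono])
  then show ?thesis by (simp add: N_def L2_norm_def)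
qed

section \<open>Lebesgue measure under linear maps\<close>

lemma lborel_reflect: "distr lborel borel (\<lambda>x. t - x) = (lborel :: 'a::euclidean_space measure)"
proof -
  have "lborel = density (distr lborel borel (\<lambda>x. t + (-1) *\<^sub>R x)) (\<lambda>_. \<bar>-1::real\<bar>^DIM('a))"
    by (rule lborel_affine) simp
  then show ?thesis by (simp add: density_1)
qed

text \<open>Uniqueness of a translation invariant measure up to a factor, for the image measure \<open>\<mu>\<close> of Lebesgue
  measure under \<open>M\<close>. Both measures are invariant under all point reflections \<open>x \<mapsto> y - x\<close>, so in the
  double integral of \<open>1\<^sub>A(x) 1\<^sub>B(y - x)\<close> the two sets can be exchanged, which yields
  \<open>\<mu>(A) \<lambda>(B) = \<mu>(B) \<lambda>(A)\<close>. The integrals over \<open>\<mu>\<close> are written as Lebesgue integrals composed with \<open>M\<close>;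
  this avoids having to know that \<open>\<mu>\<close> is \<open>\<sigma>\<close>-finite.\<close>

lemma emeasure_linear_vimage_proportional:
  fixes M :: "'a::euclidean_space \<Rightarrow> 'a"
  assumes M: "linear M" "surj M" and A: "A \<in> sets borel" and B: "B \<in> sets borel"
  shows "emeasure lborel (M -` A) * emeasure lborel B = emeasure lborel (M -` B) * emeasure lborel A"
proof -
  have [measurable]: "M \<in> borel_measurable borel"
    using M(1) by (simp add: borel_measurable_continuous_onI linear_continuous_on linear_conv_bounded_linear)
  note [measurable] = A B
  have key: "emeasure lborel (M -` A) * emeasure lborel B =
      (\<integral>\<^sup>+y. \<integral>\<^sup>+x. indicator A (M x) * indicator B (y - M x) \<partial>lborel \<partial>lborel)"
    if [measurable]: "A \<in> sets borel" "B \<in> sets borel" for A B :: "'a set"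
  proof -
    have B: "emeasure lborel B = (\<integral>\<^sup>+y. indicator B (y - z) \<partial>lborel)" for z
    proof -
      have "emeasure lborel B = (\<integral>\<^sup>+y. indicator B y \<partial>distr lborel borel ((+) (-z)))"
        by (simp add: lborel_distr_plus)
      also have "\<dots> = (\<integral>\<^sup>+y. indicator B (y - z) \<partial>lborel)"
        by (subst nn_integral_distr) simp_all
      finally show ?thesis .
    qed
    have "emeasure lborel (M -` A) * emeasure lborel B =
        (\<integral>\<^sup>+x. indicator A (M x) * emeasure lborel B \<partial>lborel)"
    proof -
      have "M -` A \<in> sets borel" using measurable_sets[of M borel borel A] by simp
      moreover have "indicator A (M x) = (indicator (M -` A) x :: ennreal)" for x
        by (auto simp: indicator_def)
      ultimately show ?thesis by (simp add: nn_integral_multc)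
    qed
    also have "\<dots> = (\<integral>\<^sup>+x. \<integral>\<^sup>+y. indicator A (M x) * indicator B (y - M x) \<partial>lborel \<partial>lborel)"
    proof (rule nn_integral_cong)
      fix x show "indicator A (M x) * emeasure lborel B =
          (\<integral>\<^sup>+y. indicator A (M x) * indicator B (y - M x) \<partial>lborel)"
        by (subst nn_integral_cmult) (simp_all add: B[of "M x"])
    qed
    also have "\<dots> = (\<integral>\<^sup>+y. \<integral>\<^sup>+x. indicator A (M x) * indicator B (y - M x) \<partial>lborel \<partial>lborel)"
      by (rule lborel_pair.Fubini') measurable
    finally show ?thesis .
  qed
  have "(\<integral>\<^sup>+x. indicator A (M x) * indicator B (y - M x) \<partial>lborel) =
        (\<integral>\<^sup>+x. indicator B (M x) * indicator A (y - M x) \<partial>lborel)" for y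
  proof -
    obtain s where s: "y = M s" using M(2) by (metis surjD)
    have "(\<integral>\<^sup>+x. indicator A (M x) * indicator B (y - M x) \<partial>lborel) =
       (\<integral>\<^sup>+x. indicator A (M x) * indicator B (y - M x) \<partial>distr lborel borel (\<lambda>x. s - x))"
      by (simp add: lborel_reflect)
    also have "\<dots> = (\<integral>\<^sup>+x. indicator A (M (s - x)) * indicator B (y - M (s - x)) \<partial>lborel)"
      by (subst nn_integral_distr) simp_all
    also have "\<dots> = (\<integral>\<^sup>+x. indicator B (M x) * indicator A (y - M x) \<partial>lborel)"
      by (simp add: s linear_diff[OF M(1)] mult.commute)
    finally show ?thesis .
  qed
  then show ?thesis
    by (simp add: key A B)
qed

lemma lborel_unit_ball: "0 < emeasure lborel (ball (0::'a::euclidean_space) 1)"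
    "emeasure lborel (ball (0::'a) 1) < \<infinity>"
proof -
  show "emeasure lborel (ball (0::'a) 1) < \<infinity>" by (rule emeasure_bounded_finite) simp
  have "0 < measure lborel (ball (0::'a) 1)" using content_ball_pos[of 1 "0::'a"] by (simp add: measure_completion)
  then show "0 < emeasure lborel (ball (0::'a) 1)"
    by (metis emeasure_eq_measure2 ennreal_eq_0_iff less_le_not_le measure_def not_gr_zero enn2real_0)
qed

definition scales_lborel :: "('a::euclidean_space \<Rightarrow> 'a) \<Rightarrow> ennreal \<Rightarrow> bool" where
  "scales_lborel M \<kappa> \<longleftrightarrow> (\<forall>A\<in>sets borel. emeasure lborel (M -` A) = \<kappa> * emeasure lborel A)"

lemma scales_lborel_exists:
  fixes M :: "'a::euclidean_space \<Rightarrow> 'a"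
  assumes "linear M" "surj M"
  shows "scales_lborel M (emeasure lborel (M -` ball 0 1) / emeasure lborel (ball (0::'a) 1))"
  unfolding scales_lborel_def
proof
  fix A :: "'a set" assume A: "A \<in> sets borel"
  let ?b = "emeasure lborel (ball (0::'a) 1)"
  have "emeasure lborel (M -` A) * ?b = emeasure lborel (M -` ball 0 1) * emeasure lborel A"
    by (rule emeasure_linear_vimage_proportional) (use assms A in auto)
  then have "emeasure lborel (M -` A) * ?b / ?b = emeasure lborel (M -` ball 0 1) * emeasure lborel A / ?b"
    by simp
  moreover have "emeasure lborel (M -` A) * ?b / ?b = emeasure lborel (M -` A)"
    using lborel_unit_ball[where 'a='a]
    by (metis ennreal_mult_divide_eq infinity_ennreal_def less_irrefl)
  ultimately show "emeasure lborel (M -` A) =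
      emeasure lborel (M -` ball 0 1) / ?b * emeasure lborel A"
    by (simp add: ennreal_times_divide mult.commute)
qed

text \<open>The unit ball is invariant, which determines the factor.\<close>

lemma scales_lborel_orthogonal:
  fixes Q :: "'a::euclidean_space \<Rightarrow> 'a"
  assumes "orthogonal_transformation Q"
  shows "scales_lborel Q 1"
proof -
  have "Q -` ball 0 1 = ball 0 1"
    using orthogonal_transformation_norm[OF assms] by (auto simp: dist_norm)
  moreover have "emeasure lborel (ball (0::'a) 1) / emeasure lborel (ball (0::'a) 1) = 1"
    using lborel_unit_ball[where 'a='a] by (simp add: ennreal_divide_self)
  ultimately show ?thesis
    using scales_lborel_exists[of Q] assms orthogonal_transformation_surj[OF assms]
    by (simp add: orthogonal_transformation_linear)
qed

lemma scales_lborel_compose: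
  assumes "scales_lborel M \<kappa>" "scales_lborel N \<kappa>'" "N \<in> borel_measurable borel"
  shows "scales_lborel (N \<circ> M) (\<kappa> * \<kappa>')"
  unfolding scales_lborel_def
proof
  fix A :: "'a set" assume "A \<in> sets borel"
  moreover from this have "N -` A \<in> sets borel"
    using measurable_sets[OF assms(3)] by simp
  ultimately show "emeasure lborel ((N \<circ> M) -` A) = \<kappa> * \<kappa>' * emeasure lborel A"
    using assms(1,2) by (simp add: scales_lborel_def vimage_comp[symmetric] mult.assoc)
qed

text \<open>The reflection \<open>R\<close> in the hyperplane orthogonal to \<open>k\<close> conjugates the shear to its inverse. As \<open>R\<close> does
  not change volumes, the factor of the shear equals its own inverse.\<close>

lemma scales_lborel_shear:
  fixes k w :: "'a::euclidean_space"
  assumes k: "norm k = 1" and w: "w \<bullet> k = 0"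
  shows "scales_lborel (\<lambda>x. x + (x \<bullet> k) *\<^sub>R w) 1"
proof -
  define N where "N = (\<lambda>x. x + (x \<bullet> k) *\<^sub>R w)"
  define R where "R = (\<lambda>x. x - (2 * (x \<bullet> k)) *\<^sub>R k)"
  have kk: "k \<bullet> k = 1" using k by (simp add: norm_eq_1)
  have w': "k \<bullet> w = 0" using w by (simp add: inner_commute)
  have lin: "linear N" "linear R"
    unfolding N_def R_def by (auto intro!: linearI simp: algebra_simps)
  have R: "orthogonal_transformation R"
    unfolding orthogonal_transformation_def using lin(2)
    by (auto simp: R_def algebra_simps kk inner_commute)
  have meas: "N \<in> borel_measurable borel" "R \<in> borel_measurable borel"
    using lin by (auto simp: borel_measurable_continuous_onI linear_continuous_on linear_conv_bounded_linear)
  \<comment> \<open>this says that conjugating the shear by the reflection inverts it\<close>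
  have NRNR: "N \<circ> R \<circ> N \<circ> R = id"
    by (auto simp: fun_eq_iff N_def R_def w w' kk algebra_simps)
  have "surj N" using NRNR by (metis comp_assoc surj_id fun.set_map surj_def comp_apply id_apply)
  then obtain \<kappa> where \<kappa>: "scales_lborel N \<kappa>" using scales_lborel_exists lin by blast
  have "scales_lborel (N \<circ> R \<circ> N \<circ> R) (1 * (\<kappa> * (1 * \<kappa>)))"
    using \<kappa> scales_lborel_orthogonal[OF R] meas
    by (intro scales_lborel_compose measurable_comp[where N=borel]) (auto simp: comp_def)
  then have "emeasure lborel (ball (0::'a) 1) = \<kappa> * \<kappa> * emeasure lborel (ball (0::'a) 1)"
    unfolding NRNR scales_lborel_def by simp
  then have "\<kappa> * \<kappa> = 1"
    using lborel_unit_ball[where 'a='a]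
    by (metis ennreal_divide_self ennreal_mult_divide_eq infinity_ennreal_def less_irrefl ennreal_times_divide mult.commute)
  then have "\<kappa> = 1"
    by (metis ennreal_one_less_top le_less_linear less_imp_le mult.right_neutral mult_left_mono mult_right_mono mult.left_neutral antisym linear zero_le)
  with \<kappa> show ?thesis by (simp add: N_def)
qed

lemma scales_lborel_diagonal:
  fixes k :: "'a::euclidean_space"
  assumes k: "k \<in> Basis" and c: "c \<noteq> 0"
  shows "scales_lborel (\<lambda>x. x + ((c - 1) * (x \<bullet> k)) *\<^sub>R k) (ennreal (1 / \<bar>c\<bar>))"
proof -
  define D where "D = (\<lambda>x::'a. x + ((c - 1) * (x \<bullet> k)) *\<^sub>R k)"
  define s where "s j = (if j = k then c else 1)" for j :: 'a
  have [measurable]: "D \<in> borel_measurable borel" unfolding D_def by measurable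
  have D: "D x = 0 + (\<Sum>j\<in>Basis. (s j * (x \<bullet> j)) *\<^sub>R j)" for x
  proof -
    have "(\<Sum>j\<in>Basis. (s j * (x \<bullet> j)) *\<^sub>R j) =
      (\<Sum>j\<in>Basis. (x \<bullet> j) *\<^sub>R j + (if j = k then ((c - 1) * (x \<bullet> k)) *\<^sub>R k else 0))"
      by (intro sum.cong) (auto simp: s_def algebra_simps)
    also have "\<dots> = D x"
      using k by (simp add: sum.distrib euclidean_representation D_def)
    finally show ?thesis by simp
  qed
  have "(\<Prod>j\<in>Basis. \<bar>s j\<bar>) = \<bar>c\<bar>"
    using k by (simp add: s_def if_distrib prod.If_cases Int_absorb1 cong: if_cong)
  then have "lborel = density (distr lborel borel D) (\<lambda>_. ennreal \<bar>c\<bar>)"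
    using lborel_affine_euclidean[of s 0] c by (simp add: D[abs_def] s_def)
  then have *: "emeasure lborel A = ennreal \<bar>c\<bar> * emeasure lborel (D -` A)" if "A \<in> sets borel" for A
  proof -
    have "emeasure lborel A = emeasure (density (distr lborel borel D) (\<lambda>_. ennreal \<bar>c\<bar>)) A"
      using \<open>lborel = _\<close> by simp
    also have "\<dots> = ennreal \<bar>c\<bar> * emeasure lborel (D -` A)"
      using that by (simp add: emeasure_density emeasure_distr nn_integral_cmult)
    finally show ?thesis .
  qed
  show ?thesis
    unfolding scales_lborel_def D_def[symmetric] using c
    by (auto simp: * mult.assoc[symmetric] ennreal_mult[symmetric])
qed

text \<open>The map takes the hyperplane orthogonal to \<open>k\<close> isometrically to the one orthogonal to \<open>Q k\<close>, and \<open>k\<close> to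
  the oblique vector \<open>e\<close>. It is a stretching along \<open>k\<close> by \<open>e \<bullet> Q k\<close>, followed by a shear and by \<open>Q\<close>.\<close>

lemma scales_lborel_frame:
  fixes Q :: "'a::euclidean_space \<Rightarrow> 'a" and e :: 'a
  assumes Q: "orthogonal_transformation Q" and k: "k \<in> Basis" and c: "e \<bullet> Q k \<noteq> 0"
  shows "scales_lborel (\<lambda>x. Q (x - (x \<bullet> k) *\<^sub>R k) + (x \<bullet> k) *\<^sub>R e) (ennreal (1 / \<bar>e \<bullet> Q k\<bar>))"
proof -
  define c where "c = e \<bullet> Q k"
  have c0: "c \<noteq> 0" using c by (simp add: c_def)
  have lin: "linear Q" using Q by (rule orthogonal_transformation_linear)
  have nk: "norm k = 1" and kk: "k \<bullet> k = 1" using k by (auto simp: inner_Basis)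
  have QQ: "Q x \<bullet> Q y = x \<bullet> y" for x y
    using Q by (simp add: orthogonal_transformation_def)
  \<comment> \<open>the shear vector: the part of \<open>e\<close> tangential to the image hyperplane, pulled back by \<open>Q\<close>\<close>
  obtain w where w: "Q w = (1 / c) *\<^sub>R (e - c *\<^sub>R Q k)"
    using orthogonal_transformation_surj[OF Q] by (metis surjD)
  have wk: "w \<bullet> k = 0"
    using QQ[of w k] c0 by (simp add: w c_def inner_diff_left QQ kk)
  let ?D = "\<lambda>x. x + ((c - 1) * (x \<bullet> k)) *\<^sub>R k" and ?N = "\<lambda>x. x + (x \<bullet> k) *\<^sub>R w"
  have "scales_lborel (Q \<circ> (?N \<circ> ?D)) (ennreal (1 / \<bar>c\<bar>) * 1 * 1)"
    using lin
    by (intro scales_lborel_compose scales_lborel_diagonal scales_lborel_orthogonal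
        scales_lborel_shear Q k c0 nk wk)
      (auto simp: borel_measurable_continuous_onI linear_continuous_on linear_conv_bounded_linear)
  also have "Q \<circ> (?N \<circ> ?D) = (\<lambda>x. Q (x - (x \<bullet> k) *\<^sub>R k) + (x \<bullet> k) *\<^sub>R e)"
    using c0 lin
    by (auto simp: fun_eq_iff inner_add_left kk w linear_add linear_diff linear_cmul algebra_simps)
  finally show ?thesis by (simp add: c_def)
qed

lemma integral_scales_lborel:
  fixes g :: "'a::euclidean_space \<Rightarrow> real"
  assumes M: "scales_lborel M (ennreal r)" and r: "0 \<le> r"
    and [measurable]: "M \<in> borel_measurable borel" and g: "integrable lborel g"
  shows "integrable lborel (\<lambda>x. g (M x))" "(\<integral>x. g (M x) \<partial>lborel) = r * (\<integral>x. g x \<partial>lborel)"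
proof -
  have [measurable]: "g \<in> borel_measurable borel" using g by auto
  have eq: "distr lborel borel M = density lborel (\<lambda>_. ennreal r)"
  proof (rule measure_eqI)
    fix A assume "A \<in> sets (distr lborel borel M)"
    then have A: "A \<in> sets borel" by simp
    show "emeasure (distr lborel borel M) A = emeasure (density lborel (\<lambda>_. ennreal r)) A"
      using M A by (simp add: emeasure_distr emeasure_density nn_integral_cmult scales_lborel_def)
  qed simp
  have "integrable (density lborel (\<lambda>_. ennreal r)) g"
    using g r by (subst integrable_density) auto
  then have "integrable (distr lborel borel M) g" by (simp add: eq)
  then show "integrable lborel (\<lambda>x. g (M x))"
    by (subst (asm) integrable_distr_eq) auto
  have "(\<integral>x. g (M x) \<partial>lborel) = integral\<^sup>L (distr lborel borel M) g"
    by (subst integral_distr) auto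
  also have "\<dots> = r * (\<integral>x. g x \<partial>lborel)"
    using r by (simp add: eq integral_density)
  finally show "(\<integral>x. g (M x) \<partial>lborel) = r * (\<integral>x. g x \<partial>lborel)" .
qed

section \<open>Slicing along parallel lines\<close>

text \<open>The coordinates of a hyperplane are indexed by an orthonormal basis of its direction, those of the
  whole space by all standard basis vectors but one. This lemma passes from one to the other.\<close>

lemma distr_PiM_lborel_reindex:
  assumes I: "finite I" and J: "finite J" and \<pi>: "bij_betw \<pi> I J"
  shows "distr (\<Pi>\<^sub>M j\<in>J. lborel) (\<Pi>\<^sub>M i\<in>I. lborel) (\<lambda>f. \<lambda>i\<in>I. f (\<pi> i)) = (\<Pi>\<^sub>M i\<in>I. lborel :: real measure)"
proof -
  interpret product_sigma_finite "\<lambda>_. lborel :: real measure" ..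
  have \<pi>J: "\<pi> i \<in> J" if "i \<in> I" for i using \<pi> that by (auto simp: bij_betw_def)
  have meas: "(\<lambda>f. \<lambda>i\<in>I. f (\<pi> i)) \<in> measurable (\<Pi>\<^sub>M j\<in>J. lborel) (\<Pi>\<^sub>M i\<in>I. lborel :: real measure)"
    by (rule measurable_restrict) (simp add: measurable_component_singleton[OF \<pi>J, of _ "\<lambda>_. lborel", simplified])
  show ?thesis
  proof (rule PiM_eqI[OF I])
    fix A :: "'a \<Rightarrow> real set" assume A: "\<And>i. i \<in> I \<Longrightarrow> A i \<in> sets lborel"
    define A' where "A' j = A (inv_into I \<pi> j)" for j
    have A'\<pi>: "A' (\<pi> i) = A i" if "i \<in> I" for i
      using \<pi> that by (simp add: A'_def bij_betw_def)
    have A': "A' j \<in> sets lborel" if "j \<in> J" for j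
      using \<pi> that A by (simp add: A'_def bij_betw_def inv_into_into)
    have pre: "(\<lambda>f. \<lambda>i\<in>I. f (\<pi> i)) -` Pi\<^sub>E I A \<inter> space (\<Pi>\<^sub>M j\<in>J. lborel) = Pi\<^sub>E J A'"
      using \<pi> by (auto simp: space_PiM PiE_iff A'\<pi> bij_betw_def extensional_def)
    have "emeasure (distr (\<Pi>\<^sub>M j\<in>J. lborel) (\<Pi>\<^sub>M i\<in>I. lborel) (\<lambda>f. \<lambda>i\<in>I. f (\<pi> i))) (Pi\<^sub>E I A) =
        emeasure (\<Pi>\<^sub>M j\<in>J. lborel) (Pi\<^sub>E J A')"
      by (subst emeasure_distr[OF meas]) (use A I in \<open>auto simp: pre intro!: sets_PiM_I_finite\<close>)
    also have "\<dots> = (\<Prod>j\<in>J. emeasure lborel (A' j))"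
      by (rule emeasure_PiM) (use J A' in auto)
    also have "\<dots> = (\<Prod>i\<in>I. emeasure lborel (A i))"
      using prod.reindex_bij_betw[OF \<pi>, of "\<lambda>j. emeasure lborel (A' j)"] by (simp add: A'\<pi>)
    finally show "emeasure (distr (\<Pi>\<^sub>M j\<in>J. lborel) (\<Pi>\<^sub>M i\<in>I. lborel) (\<lambda>f. \<lambda>i\<in>I. f (\<pi> i))) (Pi\<^sub>E I A) =
        (\<Prod>i\<in>I. emeasure lborel (A i))" .
  qed simp
qed

lemma cartesian_frame_exists:
  fixes A :: "'a::euclidean_space set"
  assumes "affine A" "A \<noteq> {}"
  obtains p B where "cartesian_frame A (p, B)"
proof -
  obtain p where p: "p \<in> A" using assms by auto
  have "subspace ((\<lambda>x. -p + x) ` A)" using assms(1) p affine_diffs_subspace by blast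
  then obtain B where "pairwise orthogonal B" "\<And>x. x \<in> B \<Longrightarrow> norm x = 1" "span B = (\<lambda>x. -p + x) ` A"
    using orthonormal_basis_subspace by metis
  then show thesis using p that[of p B] by (auto simp: cartesian_frame_def)
qed

lemma affine_lborel_frame:
  fixes A :: "'a::euclidean_space set"
  assumes "affine A" "A \<noteq> {}"
  obtains p B where "cartesian_frame A (p, B)" "finite B"
    "affine_lborel A = distr (\<Pi>\<^sub>M b\<in>B. lborel) borel (\<lambda>f. p + (\<Sum>b\<in>B. f b *\<^sub>R b))"
proof -
  obtain p B where pB: "(SOME z. cartesian_frame A z) = (p, B)" by fastforce
  have "cartesian_frame A (p, B)"
    using cartesian_frame_exists[OF assms] someI[of "cartesian_frame A"] pB by metis
  moreover from this have "finite B"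
    by (auto simp: cartesian_frame_def intro!: pairwise_orthogonal_imp_finite)
  ultimately show thesis
    using that by (auto simp: affine_lborel_def pB)
qed

lemma sets_affine_lborel [measurable_cong, simp]: "sets (affine_lborel A) = sets borel"
  by (auto simp: affine_lborel_def Let_def split: prod.splits)

lemma space_affine_lborel [simp]: "space (affine_lborel A) = UNIV"
  by (auto simp: affine_lborel_def Let_def split: prod.splits)

text \<open>Fubini in oblique coordinates: every point is \<open>y + t e\<close> for exactly one \<open>y\<close> in \<open>H\<close> and one \<open>t\<close>. The
  orthonormal frame defining \<open>affine_lborel H\<close>, completed by the unit normal, is the image of the
  standard basis under an orthogonal map \<open>Q\<close>; replacing the normal by \<open>e\<close> costs the factor \<open>\<bar>e \<bullet> n\<bar>\<close>.\<close>

lemma integral_slices_along: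
  fixes n e :: "'a::euclidean_space" and g :: "'a \<Rightarrow> real"
  assumes n: "norm n = 1" and e: "e \<bullet> n \<noteq> 0" and g: "integrable lborel g"
    and H: "H = {x. n \<bullet> x = c}"
  shows "(\<integral>x. g x \<partial>lborel) = \<bar>e \<bullet> n\<bar> * (\<integral>y. (\<integral>t. g (y + t *\<^sub>R e) \<partial>lborel) \<partial>affine_lborel H)"
proof -
  have nn: "n \<bullet> n = 1" using n by (simp add: norm_eq_1)
  have "affine H" unfolding H by (rule affine_hyperplane)
  moreover have "H \<noteq> {}" using nn by (auto simp: H intro!: exI[of _ "c *\<^sub>R n"])
  ultimately obtain p B where frame: "cartesian_frame H (p, B)" and fin: "finite B"
    and aff: "affine_lborel H = distr (\<Pi>\<^sub>M b\<in>B. lborel) borel (\<lambda>f. p + (\<Sum>b\<in>B. f b *\<^sub>R b))"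
    by (rule affine_lborel_frame)
  have p: "n \<bullet> p = c" using frame by (auto simp: cartesian_frame_def H)
  have orth: "pairwise orthogonal B" and unit: "\<And>b. b \<in> B \<Longrightarrow> norm b = 1"
    using frame by (auto simp: cartesian_frame_def)
  have spanB: "span B = {x. n \<bullet> x = 0}"
  proof -
    have "span B = {x - p |x. x \<in> H}" using frame by (auto simp: cartesian_frame_def)
    also have "\<dots> = {x. n \<bullet> x = 0}"
      using p by (auto simp: H inner_diff_right inner_add_right intro!: exI[of _ "_ + p"])
    finally show ?thesis .
  qed
  have nB: "b \<bullet> n = 0" if "b \<in> B" for b
    using span_base[OF that] spanB by (auto simp: inner_commute)
  obtain k :: 'a where k: "k \<in> Basis" using nonempty_Basis by blast
  have indep: "independent B"
    using orth unit by (intro pairwise_orthogonal_independent) force+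
  have cardB: "card B = DIM('a) - 1"
  proof -
    have "card B = dim {x. n \<bullet> x = 0}" using indep spanB by (metis dim_span dim_eq_card_independent)
    also have "\<dots> = DIM('a) - 1" using nn by (intro dim_hyperplane) auto
    finally show ?thesis .
  qed
  obtain \<pi> where \<pi>: "bij_betw \<pi> (Basis - {k}) B"
  proof -
    have "card (Basis - {k}) = card B" using cardB k by simp
    then show thesis using finite_same_card_bij[of "Basis - {k}" B] fin that by auto
  qed
  define q where "q b = (if b = k then n else \<pi> b)" for b
  have qB: "q b \<in> B" if "b \<in> Basis" "b \<noteq> k" for b
    using \<pi> that by (auto simp: q_def bij_betw_def)
  have qq: "q b \<bullet> q b' = (if b = b' then 1 else 0)" if "b \<in> Basis" "b' \<in> Basis" for b b'
  proof (cases "b = k \<or> b' = k")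
    case True
    moreover have "q b' \<bullet> n = 0" if "b' \<noteq> k" using nB qB \<open>b' \<in> Basis\<close> that by blast
    moreover have "q b \<bullet> n = 0" if "b \<noteq> k" using nB qB \<open>b \<in> Basis\<close> that by blast
    moreover have "q k = n" by (simp add: q_def)
    ultimately show ?thesis using nn by (metis inner_commute)
  next
    case False
    then have "q b = q b' \<longleftrightarrow> b = b'"
      using \<pi> that by (auto simp: q_def bij_betw_def inj_on_def)
    moreover have "q b \<in> B" "q b' \<in> B" using False that qB by auto
    ultimately show ?thesis
      using orth unit by (auto simp: pairwise_def orthogonal_def norm_eq_1)
  qed
  define Q where "Q x = (\<Sum>b\<in>Basis. (x \<bullet> b) *\<^sub>R q b)" for x
  have linQ: "linear Q"
    unfolding Q_def by (intro linear_compose_sum ballI) (auto intro!: linearI simp: algebra_simps)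
  have Q: "orthogonal_transformation Q"
    unfolding orthogonal_transformation_def
  proof (intro conjI linQ allI)
    fix x y
    have "Q x \<bullet> Q y = (\<Sum>b'\<in>Basis. (y \<bullet> b') * (\<Sum>b\<in>Basis. (x \<bullet> b) * (q b \<bullet> q b')))"
      by (simp add: Q_def inner_sum_left inner_sum_right)
    also have "\<dots> = (\<Sum>b\<in>Basis. (y \<bullet> b) * (x \<bullet> b))"
      by (intro sum.cong refl) (simp add: qq if_distrib cong: if_cong)
    also have "\<dots> = x \<bullet> y" by (simp add: euclidean_inner[of x y] mult.commute)
    finally show "Q x \<bullet> Q y = x \<bullet> y" .
  qed
  have Qbasis: "Q b = q b" if "b \<in> Basis" for b
    using that by (simp add: Q_def inner_Basis if_distrib[of "\<lambda>c. c *\<^sub>R _"] cong: if_cong)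
  have Qk: "Q k = n" using Qbasis[OF k] by (simp add: q_def)
  define M where "M x = Q (x - (x \<bullet> k) *\<^sub>R k) + (x \<bullet> k) *\<^sub>R e" for x
  have [measurable]: "Q \<in> borel_measurable borel"
    using linQ by (simp add: borel_measurable_continuous_onI linear_continuous_on linear_conv_bounded_linear)
  have [measurable]: "M \<in> borel_measurable borel"
    unfolding M_def by measurable
  have scale: "scales_lborel M (ennreal (1 / \<bar>e \<bullet> n\<bar>))"
    using scales_lborel_frame[OF Q k, of e] e by (simp add: Qk M_def[abs_def])
  have g': "integrable lborel (\<lambda>x. g (p + x))"
    using lborel_integrable_real_affine[of "\<lambda>x. 0"] g
    using lborel_distr_plus[of p] integrable_distr_eq[of "(+) p" lborel borel g] by auto
  have [measurable]: "g \<in> borel_measurable borel" using g by auto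
  note I = integral_scales_lborel[OF scale _ _ g']
  have "(\<integral>x. g x \<partial>lborel) = (\<integral>x. g (p + x) \<partial>lborel)"
    using integral_distr[of "(+) p" lborel borel g] by (simp add: lborel_distr_plus)
  also have "\<dots> = \<bar>e \<bullet> n\<bar> * (\<integral>x. g (p + M x) \<partial>lborel)"
    using I(2) e by simp
  also have "(\<integral>x. g (p + M x) \<partial>lborel) = (\<integral>y. (\<integral>t. g (y + t *\<^sub>R e) \<partial>lborel) \<partial>affine_lborel H)"
  proof -
    interpret product_sigma_finite "\<lambda>_. lborel :: real measure" ..
    let ?E = "\<lambda>f. \<Sum>b\<in>Basis. f b *\<^sub>R (b::'a)"
    have intM: "integrable lborel (\<lambda>x. g (p + M x))" using I(1) by simp
    have ins: "insert k (Basis - {k}) = (Basis :: 'a set)" using k by auto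
    have eq: "M (?E (f(k := t))) = (\<Sum>b\<in>Basis-{k}. f b *\<^sub>R \<pi> b) + t *\<^sub>R e" for f t
    proof -
      let ?x = "?E (f(k := t))"
      have 1: "?x \<bullet> k = t"
        using inner_sum_left_Basis[OF k, of "f(k := t)"] by simp
      have "?x = t *\<^sub>R k + (\<Sum>b\<in>Basis-{k}. f b *\<^sub>R b)"
        by (subst sum.remove[OF _ k]) auto
      then have "?x - (?x \<bullet> k) *\<^sub>R k = (\<Sum>b\<in>Basis-{k}. f b *\<^sub>R b)" unfolding 1 by simp
      then have "M ?x = (\<Sum>b\<in>Basis-{k}. f b *\<^sub>R Q b) + t *\<^sub>R e"
        by (simp only: M_def 1) (simp add: linear_sum[OF linQ] linear_cmul[OF linQ])
      then show ?thesis by (simp add: Qbasis q_def)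
    qed
    define G where "G y = (\<integral>t. g (y + t *\<^sub>R e) \<partial>lborel)" for y
    have [measurable]: "G \<in> borel_measurable borel"
      unfolding G_def by measurable
    have EM: "?E \<in> measurable (Pi\<^sub>M Basis (\<lambda>_. lborel)) borel" by measurable
    have "(\<integral>x. g (p + M x) \<partial>lborel) = (\<integral>f. g (p + M (?E f)) \<partial>Pi\<^sub>M Basis (\<lambda>_. lborel))"
      by (subst lborel_eq, subst integral_distr) auto
    also have "\<dots> = (\<integral>f. (\<integral>t. g (p + M (?E (f(k := t)))) \<partial>lborel) \<partial>Pi\<^sub>M (Basis - {k}) (\<lambda>_. lborel))"
    proof -
      have "integrable (Pi\<^sub>M Basis (\<lambda>_. lborel)) (\<lambda>f. g (p + M (?E f)))"
        using intM by (subst (asm) lborel_eq, subst (asm) integrable_distr_eq) auto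
      then show ?thesis
        using product_integral_insert[of "Basis - {k}" k "\<lambda>f. g (p + M (?E f))", unfolded ins] by simp
    qed
    also have "\<dots> = (\<integral>f. G (p + (\<Sum>b\<in>Basis-{k}. f b *\<^sub>R \<pi> b)) \<partial>Pi\<^sub>M (Basis - {k}) (\<lambda>_. lborel))"
      by (simp only: eq G_def add.assoc)
    also have "\<dots> = (\<integral>f. G (p + (\<Sum>b\<in>Basis-{k}. f (\<pi> b) *\<^sub>R \<pi> b)) \<partial>Pi\<^sub>M B (\<lambda>_. lborel))"
    proof -
      have [measurable]: "\<pi> b \<in> B" if "b \<in> Basis - {k}" for b using \<pi> that by (auto simp: bij_betw_def)
      have "(\<lambda>f. \<lambda>i\<in>Basis - {k}. f (\<pi> i)) \<in> measurable (Pi\<^sub>M B (\<lambda>_. lborel)) (Pi\<^sub>M (Basis - {k}) (\<lambda>_. lborel :: real measure))"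
        by (rule measurable_restrict) (auto intro!: measurable_component_singleton)
      then show ?thesis
        by (subst distr_PiM_lborel_reindex[OF _ fin \<pi>, symmetric], simp, subst integral_distr) auto
    qed
    also have "\<dots> = (\<integral>f. G (p + (\<Sum>b\<in>B. f b *\<^sub>R b)) \<partial>Pi\<^sub>M B (\<lambda>_. lborel))"
      using sum.reindex_bij_betw[OF \<pi>, of "\<lambda>b. f b *\<^sub>R b" for f] by simp
    also have "\<dots> = (\<integral>y. G y \<partial>affine_lborel H)"
      unfolding aff by (subst integral_distr) auto
    finally show ?thesis by (simp add: G_def)
  qed
  finally show ?thesis .
qed

lemma AE_affine_lborel:
  fixes A :: "'a::euclidean_space set"
  assumes A: "affine A" "A \<noteq> {}"
  shows "AE y in affine_lborel A. y \<in> A"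
proof -
  obtain p B where frame: "cartesian_frame A (p, B)" "finite B"
    and aff: "affine_lborel A = distr (\<Pi>\<^sub>M b\<in>B. lborel) borel (\<lambda>f. p + (\<Sum>b\<in>B. f b *\<^sub>R b))"
    by (rule affine_lborel_frame[OF A])
  have "p + (\<Sum>b\<in>B. f b *\<^sub>R b) \<in> A" for f
  proof -
    have "(\<Sum>b\<in>B. f b *\<^sub>R b) \<in> span B" by (intro span_sum span_scale span_base)
    then show ?thesis using frame(1) by (auto simp: cartesian_frame_def)
  qed
  moreover have "{y \<in> space borel. y \<in> A} \<in> sets borel"
    using affine_closed[OF A(1)] by simp
  ultimately show ?thesis
    unfolding aff by (subst AE_distr_iff) auto
qed

text \<open>The coordinates of the points of a bounded set with respect to an orthonormal frame lie in a cube.\<close>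

lemma emeasure_affine_lborel_bounded:
  fixes A :: "'a::euclidean_space set"
  assumes A: "affine A" "A \<noteq> {}" and S: "bounded S" "S \<in> sets borel"
  shows "emeasure (affine_lborel A) S < \<infinity>"
proof -
  obtain p B where frame: "cartesian_frame A (p, B)" and fin: "finite B"
    and aff: "affine_lborel A = distr (\<Pi>\<^sub>M b\<in>B. lborel) borel (\<lambda>f. p + (\<Sum>b\<in>B. f b *\<^sub>R b))"
    by (rule affine_lborel_frame[OF A])
  interpret product_sigma_finite "\<lambda>_. lborel :: real measure" ..
  obtain R where "\<forall>y\<in>S. dist p y \<le> R"
    using S(1) bounded_any_center[where a = p] by blast
  then have R: "norm (y - p) \<le> R" if "y \<in> S" for y
    using that by (simp add: dist_norm norm_minus_commute[of y])
  have ip: "(\<Sum>b\<in>B. f b *\<^sub>R b) \<bullet> b' = f b'" if "b' \<in> B" for f b'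
  proof -
    have "(\<Sum>b\<in>B. f b *\<^sub>R b) \<bullet> b' = (\<Sum>b\<in>B. if b = b' then f b else 0)"
      unfolding inner_sum_left
      by (intro sum.cong) (use frame that in \<open>auto simp: cartesian_frame_def pairwise_def orthogonal_def norm_eq_1\<close>)
    then show ?thesis using that fin by simp
  qed
  let ?E = "\<lambda>f. p + (\<Sum>b\<in>B. f b *\<^sub>R b)"
  have "emeasure (affine_lborel A) S = emeasure (\<Pi>\<^sub>M b\<in>B. lborel) (?E -` S \<inter> space (\<Pi>\<^sub>M b\<in>B. lborel))"
    unfolding aff by (rule emeasure_distr) (use S in auto)
  also have "\<dots> \<le> emeasure (\<Pi>\<^sub>M b\<in>B. lborel) (Pi\<^sub>E B (\<lambda>_. {-R..R}))"
  proof (rule emeasure_mono)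
    show "?E -` S \<inter> space (\<Pi>\<^sub>M b\<in>B. lborel) \<subseteq> Pi\<^sub>E B (\<lambda>_. {-R..R})"
    proof
      fix f assume f: "f \<in> ?E -` S \<inter> space (\<Pi>\<^sub>M b\<in>B. lborel)"
      have "\<bar>f b\<bar> \<le> R" if b: "b \<in> B" for b
      proof -
        have "\<bar>f b\<bar> \<le> norm (\<Sum>b\<in>B. f b *\<^sub>R b) * norm b"
          using Cauchy_Schwarz_ineq2[of "\<Sum>b\<in>B. f b *\<^sub>R b" b] ip[OF b] by simp
        also have "\<dots> \<le> R" using frame b f R[of "?E f"] by (simp add: cartesian_frame_def)
        finally show ?thesis .
      qed
      then show "f \<in> Pi\<^sub>E B (\<lambda>_. {-R..R})"
        using f by (auto simp: space_PiM PiE_iff abs_le_iff) (smt (verit))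
    qed
    show "Pi\<^sub>E B (\<lambda>_. {-R..R}) \<in> sets (\<Pi>\<^sub>M b\<in>B. lborel)"
      by (intro sets_PiM_I_finite fin) auto
  qed
  also have "\<dots> = (\<Prod>b\<in>B. emeasure lborel {-R..R})"
    by (rule emeasure_PiM) (use fin in auto)
  also have "\<dots> < \<infinity>"
    by (simp add: emeasure_lborel_Icc_eq ennreal_power)
  finally show ?thesis .
qed

lemma integrable_affine_lborel_compact:
  fixes f :: "'a::euclidean_space \<Rightarrow> real"
  assumes A: "affine A" "A \<noteq> {}" and S: "compact S" and f: "continuous_on S f"
  shows "integrable (affine_lborel A) (\<lambda>x. indicator S x * f x)"
proof -
  have "compact (f ` S)" using S f by (rule compact_continuous_image[rotated])
  then obtain b where b: "\<And>x. x \<in> S \<Longrightarrow> norm (f x) \<le> b"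
    using compact_imp_bounded bounded_iff by (metis imageI)
  show ?thesis
  proof (rule integrableI_bounded_set[of S])
    show "S \<in> sets (affine_lborel A)" using S by (simp add: borel_compact)
    have "(\<lambda>x. indicator S x *\<^sub>R f x) \<in> borel_measurable borel"
      using S f by (intro borel_measurable_continuous_on_indicator borel_compact) auto
    then show "(\<lambda>x. indicator S x * f x) \<in> borel_measurable (affine_lborel A)"
      by simp
    show "emeasure (affine_lborel A) S < \<infinity>"
      using S by (intro emeasure_affine_lborel_bounded A compact_imp_bounded borel_compact)
    show "AE x\<in>S in affine_lborel A. norm (indicator S x * f x) \<le> b"
      using b by auto
  qed auto
qed

section \<open>The divergence theorem on a simplex\<close>

text \<open>\<open>a v \<bullet> x + c v\<close> is the barycentric coordinate of \<open>x\<close> that belongs to the vertex \<open>v\<close>. All that is needed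
  about a simplex is read off from these affine functions: the simplex, its facets and their
  hyperplanes are given by their signs, and their gradients \<open>a v\<close> are normal to the facets.\<close>

locale barycentric =
  fixes C :: "'a::euclidean_space set" and a :: "'a \<Rightarrow> 'a" and c :: "'a \<Rightarrow> real"
  assumes independent: "\<not> affine_dependent C" and card: "card C = DIM('a) + 1"
    and vertex: "v \<in> C \<Longrightarrow> w \<in> C \<Longrightarrow> a v \<bullet> w + c v = (if v = w then 1 else 0)"
begin

definition coord :: "'a \<Rightarrow> 'a \<Rightarrow> real" where "coord v x = a v \<bullet> x + c v"

abbreviation facet :: "'a \<Rightarrow> 'a set" where "facet v \<equiv> convex hull (C - {v})"

lemma fin: "finite C"
  using independent aff_independent_finite by blast

lemma coord_add: "coord v (x + t *\<^sub>R e) = coord v x + t * (a v \<bullet> e)"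
  by (simp add: coord_def inner_add_right)

lemma coord_vertex: "v \<in> C \<Longrightarrow> w \<in> C \<Longrightarrow> coord v w = (if v = w then 1 else 0)"
  using vertex by (simp add: coord_def)

lemma gradient_edge:
  assumes "u \<in> C" "v \<in> C" "w \<in> C" "v \<noteq> w"
  shows "a u \<bullet> (v - w) = (if u = v then 1 else if u = w then -1 else 0)"
proof -
  have "a u \<bullet> (v - w) = coord u v - coord u w" by (simp add: coord_def inner_diff_right)
  then show ?thesis using assms by (simp add: coord_vertex)
qed

lemma other_vertex: obtains w where "w \<in> C" "w \<noteq> v"
proof -
  have "card C \<ge> 2" using card DIM_positive[where 'a='a] by linarith
  then have "\<not> C \<subseteq> {v}" using card_mono[of "{v}" C] by fastforce
  then show thesis using that by blast
qed

lemma facet_nonempty: "facet v \<noteq> {}"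
  by (metis other_vertex Diff_iff convex_hull_eq_empty empty_iff singletonD)

lemma coord_combination:
  assumes "sum u C = 1" "w \<in> C"
  shows "coord w (\<Sum>v\<in>C. u v *\<^sub>R v) = u w"
proof -
  have "coord w (\<Sum>v\<in>C. u v *\<^sub>R v) = (\<Sum>v\<in>C. u v * (a w \<bullet> v)) + c w * sum u C"
    using assms(1) by (simp add: coord_def inner_sum_right)
  also have "\<dots> = (\<Sum>v\<in>C. u v * coord w v)"
    by (simp add: sum_distrib_left sum.distrib[symmetric] coord_def algebra_simps)
  also have "\<dots> = (\<Sum>v\<in>C. if v = w then u v else 0)"
    by (intro sum.cong) (auto simp: coord_vertex assms)
  also have "\<dots> = u w" using assms fin by simp
  finally show ?thesis .
qed

lemma coord_representation: "(\<Sum>v\<in>C. coord v x) = 1" "(\<Sum>v\<in>C. coord v x *\<^sub>R v) = x"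
proof -
  have "affine hull C = UNIV"
    using independent card by (intro affine_independent_span_eq) auto
  then have "x \<in> {y. \<exists>u. sum u C = 1 \<and> (\<Sum>v\<in>C. u v *\<^sub>R v) = y}"
    using affine_hull_finite[OF fin] by auto
  then obtain u where u: "sum u C = 1" "(\<Sum>v\<in>C. u v *\<^sub>R v) = x" by auto
  then have "coord v x = u v" if "v \<in> C" for v using coord_combination that by blast
  then show "(\<Sum>v\<in>C. coord v x) = 1" "(\<Sum>v\<in>C. coord v x *\<^sub>R v) = x"
    using u by (auto cong: sum.cong)
qed

lemma convex_hull_coord: "convex hull C = {x. \<forall>v\<in>C. 0 \<le> coord v x}"
proof (intro equalityI subsetI CollectI)
  fix x assume "x \<in> convex hull C"
  then obtain u where "\<forall>v\<in>C. 0 \<le> u v" "sum u C = 1" "(\<Sum>v\<in>C. u v *\<^sub>R v) = x"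
    using convex_hull_finite[OF fin] by auto
  then show "\<forall>v\<in>C. 0 \<le> coord v x" using coord_combination by auto
next
  fix x assume "x \<in> {x. \<forall>v\<in>C. 0 \<le> coord v x}"
  then show "x \<in> convex hull C"
    using convex_hull_finite[OF fin] coord_representation by auto
qed

lemma facet_coord:
  assumes v: "v \<in> C"
  shows "facet v = {x. coord v x = 0 \<and> (\<forall>w\<in>C. 0 \<le> coord w x)}"
proof (intro equalityI subsetI CollectI)
  fix x assume x: "x \<in> facet v"
  then obtain u where u: "\<forall>w\<in>C-{v}. 0 \<le> u w" "sum u (C-{v}) = 1" "(\<Sum>w\<in>C-{v}. u w *\<^sub>R w) = x"
    using convex_hull_finite[of "C - {v}"] fin by auto
  define u' where "u' = u(v := 0)"
  have "sum u' C = 1" "(\<Sum>w\<in>C. u' w *\<^sub>R w) = x"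
    using u sum.cong[of "C - {v}" "C - {v}" u' u] sum.cong[of "C - {v}" "C - {v}" "\<lambda>w. u' w *\<^sub>R w" "\<lambda>w. u w *\<^sub>R w"]
    by (auto simp: sum.remove[OF fin v] u'_def simp del: fun_upd_apply) auto
  from coord_combination[OF this(1), unfolded this(2)] have "coord v x = 0" using v by (simp add: u'_def)
  moreover have "x \<in> convex hull C" using x hull_mono[of "C - {v}" C convex] by blast
  ultimately show "coord v x = 0 \<and> (\<forall>w\<in>C. 0 \<le> coord w x)" using convex_hull_coord by auto
next
  fix x assume x: "x \<in> {x. coord v x = 0 \<and> (\<forall>w\<in>C. 0 \<le> coord w x)}"
  then have "(\<Sum>w\<in>C-{v}. coord w x) = 1" "(\<Sum>w\<in>C-{v}. coord w x *\<^sub>R w) = x"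
    using coord_representation[of x] by (auto simp: sum.remove[OF fin v])
  then show "x \<in> facet v" using convex_hull_finite[of "C - {v}"] fin x by auto
qed

lemma affine_hull_facet:
  assumes v: "v \<in> C"
  shows "affine hull (facet v) = {x. coord v x = 0}"
  unfolding affine_hull_convex_hull
proof (intro equalityI subsetI CollectI)
  have "affine {x. coord v x = 0}"
    using affine_hyperplane[of "a v" "- c v"] by (simp add: coord_def eq_neg_iff_add_eq_0)
  moreover have "C - {v} \<subseteq> {x. coord v x = 0}" using v by (auto simp: coord_vertex)
  ultimately have "affine hull (C - {v}) \<subseteq> {x. coord v x = 0}" by (rule hull_minimal[rotated])
  then show "coord v x = 0" if "x \<in> affine hull (C - {v})" for x using that by auto
next
  fix x assume x: "x \<in> {x. coord v x = 0}"
  then have "(\<Sum>w\<in>C-{v}. coord w x) = 1" "(\<Sum>w\<in>C-{v}. coord w x *\<^sub>R w) = x"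
    using coord_representation[of x] by (auto simp: sum.remove[OF fin v])
  then show "x \<in> affine hull (C - {v})" using affine_hull_finite[of "C - {v}"] fin by auto
qed

lemma facet_of_iff: "F facet_of convex hull C \<longleftrightarrow> (\<exists>v\<in>C. F = facet v)"
proof -
  have "2 \<le> card C" using card DIM_positive[where 'a='a] by linarith
  then show ?thesis
    using facet_of_convex_hull_affine_independent_alt[OF independent] by blast
qed

lemma vertex_in_facet_iff:
  assumes "v \<in> C" "w \<in> C"
  shows "v \<in> facet w \<longleftrightarrow> v \<noteq> w"
  using assms by (auto simp: facet_coord coord_vertex)

lemma bij_betw_facet: "bij_betw facet C {F. F facet_of convex hull C}"
  by (auto simp: bij_betw_def inj_on_def facet_of_iff) (metis vertex_in_facet_iff)

lemma gradient_nonzero: "v \<in> C \<Longrightarrow> a v \<noteq> 0"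
proof
  assume v: "v \<in> C" "a v = 0"
  obtain w where "w \<in> C" "w \<noteq> v" by (rule other_vertex)
  then show False using vertex[of v v] vertex[of v w] v by auto
qed

text \<open>A linear functional whose values on the simplex are largest on a whole facet is constant on
  that facet, so it is determined by its value at the opposite vertex and hence is a multiple of the
  gradient of the coordinate of that vertex.\<close>

lemma outward_normal_unique:
  assumes v: "v \<in> C" and n: "norm n = 1" "\<forall>x\<in>convex hull C. \<forall>y\<in>facet v. n \<bullet> x \<le> n \<bullet> y"
  shows "n = - (1 / norm (a v)) *\<^sub>R a v"
proof -
  obtain w0 where w0: "w0 \<in> C" "w0 \<noteq> v" by (rule other_vertex)
  have C: "w \<in> convex hull C" if "w \<in> C" for w using that by (rule hull_inc)
  have F: "w \<in> facet v" if "w \<in> C" "w \<noteq> v" for w using that by (intro hull_inc) auto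
  have const: "n \<bullet> w = n \<bullet> w0" if "w \<in> C" "w \<noteq> v" for w
    using n(2) C F that w0 by (meson antisym)
  define s where "s = n \<bullet> w0 - n \<bullet> v"
  have s: "0 \<le> s" using n(2) C[OF v] F[OF w0] by (simp add: s_def)
  have "n \<bullet> z = (- s *\<^sub>R a v) \<bullet> z" for z
  proof -
    define x where "x = w0 + z"
    have "n \<bullet> x = (\<Sum>w\<in>C. coord w x * (n \<bullet> w))"
      by (subst coord_representation(2)[of x, symmetric]) (simp add: inner_sum_right)
    also have "\<dots> = (\<Sum>w\<in>C. coord w x * (n \<bullet> w0)) - coord v x * s"
      using const by (simp add: sum.remove[OF fin v] s_def algebra_simps)
    also have "\<dots> = n \<bullet> w0 - coord v x * s"
      by (simp add: sum_distrib_right[symmetric] coord_representation)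
    finally have "n \<bullet> z = - (coord v x * s)" by (simp add: x_def inner_add_right)
    moreover have "coord v x = a v \<bullet> z"
      using coord_vertex[OF v w0(1)] w0 by (simp add: x_def coord_def inner_add_right)
    ultimately show ?thesis by simp
  qed
  then have eq: "n = - s *\<^sub>R a v" by (metis vector_eq_rdot)
  then have "s * norm (a v) = 1" using n(1) s by simp
  then have "s = 1 / norm (a v)" using gradient_nonzero[OF v] by (simp add: field_simps)
  with eq show ?thesis by simp
qed

lemma outward_normal_facet:
  assumes v: "v \<in> C"
  shows "outward_normal (convex hull C) (facet v) = - (1 / norm (a v)) *\<^sub>R a v"
  unfolding outward_normal_def
proof (rule the_equality)
  have "a v \<bullet> y \<le> a v \<bullet> x" if "x \<in> convex hull C" "y \<in> facet v" for x y
    using that v by (auto simp: facet_coord convex_hull_coord coord_def)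
  then show "norm (- (1 / norm (a v)) *\<^sub>R a v) = 1 \<and>
      (\<forall>x\<in>convex hull C. \<forall>y\<in>facet v. - (1 / norm (a v)) *\<^sub>R a v \<bullet> x \<le> - (1 / norm (a v)) *\<^sub>R a v \<bullet> y)"
    using gradient_nonzero[OF v] by (auto intro: divide_right_mono)
qed (use outward_normal_unique[OF v] in blast)

lemma interior_coord:
  assumes "\<And>v. v \<in> C \<Longrightarrow> 0 < coord v x"
  shows "x \<in> interior (convex hull C)"
proof (rule interiorI)
  have "{x. \<forall>v\<in>C. 0 < coord v x} = (\<Inter>v\<in>C. {x. 0 < coord v x})" by auto
  also have "open \<dots>"
    using fin unfolding coord_def by (intro open_INT ballI open_Collect_less continuous_intros) auto
  finally show "open {x. \<forall>v\<in>C. 0 < coord v x}" .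
qed (use assms in \<open>auto simp: convex_hull_coord less_imp_le\<close>)

lemma hyperplane_facet:
  assumes v: "v \<in> C"
  shows "affine hull (facet v) = {x. outward_normal (convex hull C) (facet v) \<bullet> x = c v / norm (a v)}"
proof -
  have eq: "r + b = 0 \<longleftrightarrow> - (1 / N) * r = b / N" if "N \<noteq> 0" for r b N :: real
  proof -
    have "- (1 / N) * r = (- r) / N" by simp
    then show ?thesis using that by (simp only: divide_cancel_right neg_eq_iff_add_eq_0) simp
  qed
  show ?thesis
    unfolding affine_hull_facet[OF v] outward_normal_facet[OF v]
    using eq[of "norm (a v)" "a v \<bullet> x" "c v" for x] gradient_nonzero[OF v] by (simp add: coord_def)
qed

text \<open>The slicing formula for the hyperplane of the facet opposite to \<open>v\<close>. The inner integrals along the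
  lines only have to be known for lines starting on that hyperplane, where its measure lives.\<close>

lemma integral_slices_facet:
  fixes g :: "'a \<Rightarrow> real"
  assumes v: "v \<in> C" and e: "a v \<bullet> e \<noteq> 0" and g: "integrable lborel g"
    and G: "\<And>y. coord v y = 0 \<Longrightarrow> (\<integral>t. g (y + t *\<^sub>R e) \<partial>lborel) = G y"
    and Gm: "G \<in> borel_measurable borel"
  shows "(\<integral>x. g x \<partial>lborel) = \<bar>a v \<bullet> e\<bar> / norm (a v) * (\<integral>y. G y \<partial>affine_lborel (affine hull (facet v)))"
proof -
  let ?n = "- (1 / norm (a v)) *\<^sub>R a v" and ?H = "affine hull (facet v)"
  have n: "norm ?n = 1" "e \<bullet> ?n \<noteq> 0" "\<bar>e \<bullet> ?n\<bar> = \<bar>a v \<bullet> e\<bar> / norm (a v)"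
    using gradient_nonzero[OF v] e by (simp_all add: inner_commute[of e])
  have "?H \<noteq> {}" using facet_nonempty by simp
  have "(\<integral>x. g x \<partial>lborel) = \<bar>a v \<bullet> e\<bar> / norm (a v) *
      (\<integral>y. (\<integral>t. g (y + t *\<^sub>R e) \<partial>lborel) \<partial>affine_lborel ?H)"
    using integral_slices_along[OF n(1,2) g hyperplane_facet[OF v, unfolded outward_normal_facet[OF v]]]
    unfolding n(3) .
  also have "(\<integral>y. (\<integral>t. g (y + t *\<^sub>R e) \<partial>lborel) \<partial>affine_lborel ?H) = (\<integral>y. G y \<partial>affine_lborel ?H)"
  proof (rule integral_cong_AE)
    have [measurable]: "g \<in> borel_measurable borel" using g by auto
    show "(\<lambda>y. \<integral>t. g (y + t *\<^sub>R e) \<partial>lborel) \<in> borel_measurable (affine_lborel ?H)" by measurable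
    show "G \<in> borel_measurable (affine_lborel ?H)" using Gm by simp
    show "AE y in affine_lborel ?H. (\<integral>t. g (y + t *\<^sub>R e) \<partial>lborel) = G y"
      using AE_affine_lborel[OF affine_affine_hull \<open>?H \<noteq> {}\<close>]
      by eventually_elim (use G affine_hull_facet[OF v] in auto)
  qed
  finally show ?thesis .
qed

lemma compact_facet: "compact (facet v)"
  using fin by (intro compact_convex_hull finite_imp_compact) auto

lemma continuous_coord [continuous_intros]:
  "continuous_on S f \<Longrightarrow> continuous_on S (\<lambda>x. coord v (f x))"
  unfolding coord_def by (intro continuous_intros)

text \<open>Moving along the edge \<open>e = v - w\<close> maps the facet opposite to \<open>v\<close> onto the facet opposite to \<open>w\<close>. The
  two weighted integrals agree because both equal one volume integral: the integral, over the strip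
  of all \<open>z + t e\<close> with \<open>z\<close> in the second facet and \<open>0 \<le> t \<le> 1\<close>, of the function that is constant along
  \<open>e\<close>. Each line parallel to \<open>e\<close> meets the strip in a segment of parameter length one, whichever of
  the two hyperplanes it is counted from.\<close>

lemma face_integral_transport:
  assumes v: "v \<in> C" and w: "w \<in> C" and vw: "v \<noteq> w" and \<phi>: "continuous_on UNIV \<phi>"
  shows "face_integral (facet w) \<phi> / norm (a w) =
    face_integral (facet v) (\<lambda>y. \<phi> (y + coord w y *\<^sub>R (v - w))) / norm (a v)"
proof -
  define e where "e = v - w"
  have ae: "a u \<bullet> e = (if u = v then 1 else if u = w then -1 else 0)" if "u \<in> C" for u
    using gradient_edge[OF that v w vw] by (simp add: e_def)
  \<comment> \<open>projection along \<open>e\<close> to the hyperplane of the facet opposite to \<open>w\<close>\<close>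
  define z where "z x = x + coord w x *\<^sub>R e" for x
  define S where "S = (\<lambda>(y, t). y + t *\<^sub>R e) ` (facet w \<times> {0..1})"
  have z: "z (y + t *\<^sub>R e) = z y" for y t
    using ae[OF w] vw by (simp add: z_def coord_add algebra_simps)
  have S: "x \<in> S \<longleftrightarrow> z x \<in> facet w \<and> coord w x \<in> {-1..0}" for x
  proof
    assume "x \<in> S"
    then obtain y t where yt: "x = y + t *\<^sub>R e" "y \<in> facet w" "t \<in> {0..1}" by (auto simp: S_def)
    moreover from this have "coord w y = 0" using facet_coord[OF w] by auto
    ultimately show "z x \<in> facet w \<and> coord w x \<in> {-1..0}"
      using ae[OF w] vw by (simp add: z coord_add) (simp add: z_def)
  next
    assume "z x \<in> facet w \<and> coord w x \<in> {-1..0}"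
    then show "x \<in> S" unfolding S_def
      by (intro image_eqI[of _ _ "(z x, - coord w x)"]) (auto simp: z_def)
  qed
  have "compact S"
    unfolding S_def case_prod_beta
    by (intro compact_continuous_image compact_Times compact_facet continuous_intros) auto
  have contz: "continuous_on UNIV z" unfolding z_def by (intro continuous_intros)
  have cont: "continuous_on T (\<lambda>x. \<phi> (z x))" for T
    using continuous_on_compose2[OF \<phi> contz] continuous_on_subset by blast
  define g where "g x = indicator S x * \<phi> (z x)" for x
  have g: "integrable lborel g"
    using borel_integrable_compact[OF \<open>compact S\<close> cont] by (simp add: g_def[abs_def])
  have meas: "(\<lambda>y. indicator (facet u) y * \<psi> y) \<in> borel_measurable borel"
    if "continuous_on UNIV \<psi>" for u and \<psi> :: "'a \<Rightarrow> real"
    using borel_measurable_continuous_on_indicator[OF borel_compact[OF compact_facet]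
        continuous_on_subset[OF that]] by auto
  have "(\<integral>x. g x \<partial>lborel) = \<bar>a w \<bullet> e\<bar> / norm (a w) *
      (\<integral>y. indicator (facet w) y * \<phi> y \<partial>affine_lborel (affine hull (facet w)))"
  proof (rule integral_slices_facet[OF w _ g _ meas[OF \<phi>]])
    show "a w \<bullet> e \<noteq> 0" using ae[OF w] vw by simp
    fix y assume y: "coord w y = 0"
    then have zy: "z y = y" by (simp add: z_def)
    \<comment> \<open>on its own hyperplane the strip starts at parameter 0\<close>
    have "(\<lambda>t. g (y + t *\<^sub>R e)) = (\<lambda>t. indicator (facet w) y * \<phi> y * indicator {0..1} t)"
      using y ae[OF w] vw by (auto simp: g_def S z zy coord_add indicator_def)
    then show "(\<integral>t. g (y + t *\<^sub>R e) \<partial>lborel) = indicator (facet w) y * \<phi> y" by simp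
  qed
  moreover have "(\<integral>x. g x \<partial>lborel) = \<bar>a v \<bullet> e\<bar> / norm (a v) *
      (\<integral>y. indicator (facet v) y * \<phi> (z y) \<partial>affine_lborel (affine hull (facet v)))"
  proof (rule integral_slices_facet[OF v _ g _ meas[OF cont]])
    show "a v \<bullet> e \<noteq> 0" using ae[OF v] by simp
    fix y assume y: "coord v y = 0"
    have "z y \<in> facet w \<longleftrightarrow> y \<in> facet v"
    proof -
      have coz: "coord u (z y) = (if u = v then coord w y else if u = w then 0 else coord u y)" if "u \<in> C" for u
        using ae[OF that] y by (simp add: z_def coord_add)
      have "z y \<in> facet w \<longleftrightarrow> (\<forall>u\<in>C. 0 \<le> coord u (z y))"
        using coz[OF w] vw by (simp add: facet_coord[OF w])
      also have "\<dots> \<longleftrightarrow> (\<forall>u\<in>C. 0 \<le> coord u y)"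
      proof (intro iffI ballI)
        fix u assume "\<forall>u\<in>C. 0 \<le> coord u (z y)" "u \<in> C"
        then show "0 \<le> coord u y" using coz[of u] coz[OF v] v y by (metis order_refl)
      next
        fix u assume "\<forall>u\<in>C. 0 \<le> coord u y" "u \<in> C"
        then show "0 \<le> coord u (z y)" using coz[of u] w by simp
      qed
      also have "\<dots> \<longleftrightarrow> y \<in> facet v" using y by (simp add: facet_coord[OF v])
      finally show ?thesis .
    qed
    \<comment> \<open>counted from the other hyperplane the strip starts when \<open>coord w\<close> is used up\<close>
    then have "y + t *\<^sub>R e \<in> S \<longleftrightarrow> y \<in> facet v \<and> t \<in> {coord w y..coord w y + 1}" for t
      using ae[OF w] vw by (auto simp: S z coord_add)
    then have "(\<lambda>t. g (y + t *\<^sub>R e)) =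
        (\<lambda>t. indicator (facet v) y * \<phi> (z y) * indicator {coord w y..coord w y + 1} t)"
      by (intro ext) (simp add: g_def z indicator_def)
    then show "(\<integral>t. g (y + t *\<^sub>R e) \<partial>lborel) = indicator (facet v) y * \<phi> (z y)" by simp
  qed
  ultimately show ?thesis
    using ae[OF v] ae[OF w] vw
    by (simp add: face_integral_def set_lebesgue_integral_def z_def e_def)
qed

lemma face_integrable:
  assumes v: "v \<in> C" and f: "continuous_on (facet v) f"
  shows "set_integrable (affine_lborel (affine hull (facet v))) (facet v) (f :: 'a \<Rightarrow> real)"
proof -
  have "affine hull (facet v) \<noteq> {}" using facet_nonempty by simp
  then show ?thesis
    using integrable_affine_lborel_compact[OF affine_affine_hull _ compact_facet f]
    by (simp add: set_integrable_def)
qed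

text \<open>A line in the direction \<open>e = v - w\<close> meets the simplex in a segment that starts on the facet opposite
  to \<open>v\<close> and, after the parameter length \<open>coord w\<close>, ends on the facet opposite to \<open>w\<close>; the remaining
  barycentric coordinates do not change on it. The fundamental theorem of calculus on these
  segments gives the integral as a difference of two integrals over the first facet, one of which
  is transported to the second.\<close>

lemma integral_edge_derivative:
  assumes v: "v \<in> C" and w: "w \<in> C" and vw: "v \<noteq> w"
    and \<phi>: "\<And>x. (\<phi> has_derivative \<phi>' x) (at x)"
    and \<phi>': "continuous_on UNIV (\<lambda>x. \<phi>' x (v - w))"
  shows "(\<integral>x. indicator (convex hull C) x * \<phi>' x (v - w) \<partial>lborel) =
    face_integral (facet w) \<phi> / norm (a w) - face_integral (facet v) \<phi> / norm (a v)"
proof -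
  define e where "e = v - w"
  have ae: "a u \<bullet> e = (if u = v then 1 else if u = w then -1 else 0)" if "u \<in> C" for u
    using gradient_edge[OF that v w vw] by (simp add: e_def)
  have cont\<phi>: "continuous_on UNIV \<phi>"
    by (intro continuous_at_imp_continuous_on ballI has_derivative_continuous[OF \<phi>])
  define z where "z x = x + coord w x *\<^sub>R e" for x
  have "continuous_on UNIV z" unfolding z_def by (intro continuous_intros)
  then have contz: "continuous_on T (\<lambda>x. \<phi> (z x))" for T
    using continuous_on_compose2[OF cont\<phi>] continuous_on_subset by blast
  define g where "g x = indicator (convex hull C) x * \<phi>' x e" for x
  have "compact (convex hull C)"
    using fin by (intro compact_convex_hull finite_imp_compact) auto
  then have g: "integrable lborel g"
    using borel_integrable_compact[OF _ continuous_on_subset[OF \<phi>']] by (simp add: g_def[abs_def] e_def)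
  have meas: "(\<lambda>y. indicator (facet v) y * \<psi> y) \<in> borel_measurable borel"
    if "continuous_on UNIV \<psi>" for \<psi> :: "'a \<Rightarrow> real"
    using borel_measurable_continuous_on_indicator[OF borel_compact[OF compact_facet]
        continuous_on_subset[OF that]] by auto
  have "(\<integral>x. g x \<partial>lborel) = \<bar>a v \<bullet> e\<bar> / norm (a v) *
      (\<integral>y. indicator (facet v) y * (\<phi> (z y) - \<phi> y) \<partial>affine_lborel (affine hull (facet v)))"
  proof (rule integral_slices_facet[OF v _ g])
    show "a v \<bullet> e \<noteq> 0" using ae[OF v] by simp
    show "(\<lambda>y. indicator (facet v) y * (\<phi> (z y) - \<phi> y)) \<in> borel_measurable borel"
      by (intro meas continuous_intros contz cont\<phi>)
    fix y assume y: "coord v y = 0"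
    have co: "coord u (y + t *\<^sub>R e) = (if u = v then t else if u = w then coord w y - t else coord u y)"
      if "u \<in> C" for u t
      using ae[OF that] y by (simp add: coord_add)
    have mem: "y + t *\<^sub>R e \<in> convex hull C \<longleftrightarrow> y \<in> facet v \<and> t \<in> {0..coord w y}" for t
    proof -
      have "y + t *\<^sub>R e \<in> convex hull C \<longleftrightarrow>
          0 \<le> t \<and> t \<le> coord w y \<and> (\<forall>u\<in>C. u \<noteq> v \<longrightarrow> u \<noteq> w \<longrightarrow> 0 \<le> coord u y)"
        using v w vw by (auto simp: convex_hull_coord co split: if_splits)
      also have "\<dots> \<longleftrightarrow> y \<in> facet v \<and> t \<in> {0..coord w y}"
        using y w by (auto simp: facet_coord[OF v])
      finally show ?thesis .
    qed
    show "(\<integral>t. g (y + t *\<^sub>R e) \<partial>lborel) = indicator (facet v) y * (\<phi> (z y) - \<phi> y)"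
    proof (cases "y \<in> facet v")
      case False
      then have "(\<lambda>t. g (y + t *\<^sub>R e)) = (\<lambda>t. 0)" by (auto simp: g_def mem)
      then show ?thesis using False by simp
    next
      case True
      have "(\<lambda>t. g (y + t *\<^sub>R e)) = (\<lambda>t. indicator {0..coord w y} t *\<^sub>R \<phi>' (y + t *\<^sub>R e) e)"
        using True by (auto simp: g_def mem indicator_def)
      moreover have "(\<integral>t. indicator {0..coord w y} t *\<^sub>R \<phi>' (y + t *\<^sub>R e) e \<partial>lborel) =
          \<phi> (y + coord w y *\<^sub>R e) - \<phi> (y + 0 *\<^sub>R e)"
      proof (rule integral_FTC_Icc)
        show "0 \<le> coord w y" using True w by (auto simp: facet_coord[OF v])
        fix t
        have "((\<lambda>t. \<phi> (y + t *\<^sub>R e)) has_derivative (\<lambda>s. \<phi>' (y + t *\<^sub>R e) (s *\<^sub>R e))) (at t)"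
          by (rule has_derivative_compose[OF _ \<phi>]) (auto intro!: derivative_eq_intros)
        then have "((\<lambda>t. \<phi> (y + t *\<^sub>R e)) has_vector_derivative \<phi>' (y + t *\<^sub>R e) e) (at t)"
          using linear_cmul[OF has_derivative_linear[OF \<phi>]] by (simp add: has_vector_derivative_def)
        then show "((\<lambda>t. \<phi> (y + t *\<^sub>R e)) has_vector_derivative \<phi>' (y + t *\<^sub>R e) e) (at t within {0..coord w y})"
          by (rule has_vector_derivative_at_within)
      next
        show "continuous_on {0..coord w y} (\<lambda>t. \<phi>' (y + t *\<^sub>R e) e)"
          by (rule continuous_on_compose2[OF \<phi>'[folded e_def]]) (auto intro!: continuous_intros)
      qed
      ultimately show ?thesis using True by (simp add: z_def)
    qed
  qed
  also have "(\<integral>y. indicator (facet v) y * (\<phi> (z y) - \<phi> y) \<partial>affine_lborel (affine hull (facet v))) =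
      face_integral (facet v) (\<lambda>y. \<phi> (z y)) - face_integral (facet v) \<phi>"
    using set_integral_diff(2)[OF face_integrable[OF v contz] face_integrable[OF v continuous_on_subset[OF cont\<phi>]]]
    by (simp add: face_integral_def set_lebesgue_integral_def)
  finally show ?thesis
    using face_integral_transport[OF v w vw cont\<phi>] ae[OF v]
    by (simp add: g_def e_def z_def diff_divide_distrib)
qed

text \<open>The divergence theorem for the field \<open>\<phi> e\<close>. The right-hand side is linear in \<open>e\<close>, every direction is a
  combination of the edges at one vertex \<open>w\<close>, and for an edge \<open>v - w\<close> all normals but those of the
  facets opposite to \<open>v\<close> and \<open>w\<close> are orthogonal to it.\<close>

lemma integral_derivative:
  assumes \<phi>: "\<And>x. (\<phi> has_derivative \<phi>' x) (at x)"
    and \<phi>': "\<And>e. continuous_on UNIV (\<lambda>x. \<phi>' x e)"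
  shows "(\<integral>x. indicator (convex hull C) x * \<phi>' x e \<partial>lborel) =
    (\<Sum>F | F facet_of convex hull C. (outward_normal (convex hull C) F \<bullet> e) * face_integral F \<phi>)"
proof -
  define J where "J v = face_integral (facet v) \<phi> / norm (a v)" for v
  obtain w where w: "w \<in> C" by (rule other_vertex)
  \<comment> \<open>coefficients of \<open>e\<close> in the edges at \<open>w\<close>\<close>
  define b where "b v = coord v (w + e)" for v
  have e: "e = (\<Sum>v\<in>C. b v *\<^sub>R (v - w))"
    using coord_representation[of "w + e"]
    by (simp add: b_def scaleR_diff_right sum_subtractf scaleR_left.sum[symmetric])
  have K: "compact (convex hull C)"
    using fin by (intro compact_convex_hull finite_imp_compact) auto
  have int: "integrable lborel (\<lambda>x. indicator (convex hull C) x * \<phi>' x e')" for e'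
    using borel_integrable_compact[OF K continuous_on_subset[OF \<phi>']] by simp
  have "(\<integral>x. indicator (convex hull C) x * \<phi>' x e \<partial>lborel) =
      (\<integral>x. (\<Sum>v\<in>C. b v * (indicator (convex hull C) x * \<phi>' x (v - w))) \<partial>lborel)"
    by (subst e) (simp add: linear_sum[OF has_derivative_linear[OF \<phi>]]
        linear_cmul[OF has_derivative_linear[OF \<phi>]] sum_distrib_left mult.left_commute)
  also have "\<dots> = (\<Sum>v\<in>C. b v * (\<integral>x. indicator (convex hull C) x * \<phi>' x (v - w) \<partial>lborel))"
    using int by simp
  also have "\<dots> = (\<Sum>v\<in>C. b v * (J w - J v))"
  proof (intro sum.cong refl)
    fix v assume v: "v \<in> C"
    show "b v * (\<integral>x. indicator (convex hull C) x * \<phi>' x (v - w) \<partial>lborel) = b v * (J w - J v)"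
    proof (cases "v = w")
      case True
      then show ?thesis using linear_0[OF has_derivative_linear[OF \<phi>]] by simp
    next
      case False
      then show ?thesis using integral_edge_derivative[OF v w False \<phi> \<phi>'] by (simp add: J_def)
    qed
  qed
  also have "\<dots> = (\<Sum>v\<in>C. - (a v \<bullet> e) * J v)"
  proof -
    have ab: "a v \<bullet> e = b v - (if v = w then 1 else 0)" if "v \<in> C" for v
      using coord_vertex[OF that w] by (simp add: b_def coord_def inner_add_right)
    have "(\<Sum>v\<in>C. - (a v \<bullet> e) * J v) = (\<Sum>v\<in>C. (if v = w then J v else 0) - b v * J v)"
      by (intro sum.cong refl) (auto simp: ab algebra_simps)
    also have "\<dots> = J w - (\<Sum>v\<in>C. b v * J v)" using w fin by (simp add: sum_subtractf)
    also have "\<dots> = (\<Sum>v\<in>C. b v * (J w - J v))"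
      using coord_representation(1)[of "w + e"]
      by (simp add: b_def right_diff_distrib sum_subtractf sum_distrib_right[symmetric])
    finally show ?thesis by simp
  qed
  also have "\<dots> = (\<Sum>v\<in>C. (outward_normal (convex hull C) (facet v) \<bullet> e) * face_integral (facet v) \<phi>)"
    by (intro sum.cong refl) (simp add: outward_normal_facet J_def)
  also have "\<dots> = (\<Sum>F | F facet_of convex hull C. (outward_normal (convex hull C) F \<bullet> e) * face_integral F \<phi>)"
    by (rule sum.reindex_bij_betw[OF bij_betw_facet])
  finally show ?thesis .
qed

end

text \<open>The edges at a vertex of a simplex are linearly independent, so a linear functional can be
  prescribed on them.\<close>

lemma barycentric_exists:
  fixes C :: "'a::euclidean_space set"
  assumes C: "\<not> affine_dependent C" "card C = DIM('a) + 1"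
  obtains a c where "barycentric C a c"
proof -
  have "\<exists>a c. \<forall>w\<in>C. a \<bullet> w + c = (if v = w then 1 else 0)" if v: "v \<in> C" for v
  proof -
    have "\<not> C \<subseteq> {v}" using C(2) card_mono[of "{v}" C] DIM_positive[where 'a='a] by fastforce
    then obtain w0 where w0: "w0 \<in> C" "w0 \<noteq> v" by blast
    have "independent ((\<lambda>x. - w0 + x) ` (C - {w0}))"
      using C(1) affine_dependent_iff_dependent2[OF w0(1)] by simp
    then obtain l :: "'a \<Rightarrow> real" where l: "linear l"
        "\<forall>x\<in>(\<lambda>x. - w0 + x) ` (C - {w0}). l x = (if x = v - w0 then 1 else 0)"
      using linear_independent_extend[of _ "\<lambda>x. if x = v - w0 then 1 else 0"] by blast
    define a where "a = (\<Sum>b\<in>Basis. l b *\<^sub>R b)"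
    have la: "a \<bullet> x = l x" for x
    proof -
      have "l x = (\<Sum>b\<in>Basis. (x \<bullet> b) * l b)"
        using linear_sum[OF l(1), of "\<lambda>b. (x \<bullet> b) *\<^sub>R b" Basis] linear_cmul[OF l(1)]
        by (simp add: euclidean_representation)
      moreover have "a \<bullet> x = (\<Sum>b\<in>Basis. l b * (b \<bullet> x))" by (simp add: a_def inner_sum_left)
      ultimately show ?thesis by (simp add: inner_commute mult.commute)
    qed
    have "a \<bullet> w + - l w0 = (if v = w then 1 else 0)" if w: "w \<in> C" for w
    proof (cases "w = w0")
      case True
      then show ?thesis using w0 la by simp
    next
      case False
      then have "l (w - w0) = (if w - w0 = v - w0 then 1 else 0)"
        using l(2) w by (auto simp: image_iff)
      then show ?thesis using la by (auto simp: linear_diff[OF l(1)])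
    qed
    then show ?thesis by blast
  qed
  then obtain a c where "\<forall>v\<in>C. \<forall>w\<in>C. a v \<bullet> w + c v = (if v = w then 1 else 0)" by metis
  then have "barycentric C a c" using C by unfold_locales auto
  then show thesis by (rule that)
qed

section \<open>Polynomial fields\<close>

lemma real_polynomial_function_C1:
  fixes f :: "'a::euclidean_space \<Rightarrow> real"
  assumes "real_polynomial_function f"
  shows "\<exists>f'. (\<forall>x. (f has_derivative f' x) (at x)) \<and> (\<forall>e. continuous_on UNIV (\<lambda>x. f' x e))"
  using assms
proof (induction rule: real_polynomial_function.induct)
  case (linear f)
  then show ?case
    by (intro exI[of _ "\<lambda>_. f"]) (auto simp: bounded_linear_imp_has_derivative)
next
  case (const c)
  then show ?case by (intro exI[of _ "\<lambda>_ _. 0"]) auto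
next
  case (add f g)
  then obtain f' g' where
    "\<forall>x. (f has_derivative f' x) (at x)" "\<forall>e. continuous_on UNIV (\<lambda>x. f' x e)"
    "\<forall>x. (g has_derivative g' x) (at x)" "\<forall>e. continuous_on UNIV (\<lambda>x. g' x e)" by blast
  then show ?case
    by (intro exI[of _ "\<lambda>x e. f' x e + g' x e"]) (auto intro!: derivative_eq_intros continuous_intros)
next
  case (mult f g)
  then obtain f' g' where d:
    "\<forall>x. (f has_derivative f' x) (at x)" "\<forall>e. continuous_on UNIV (\<lambda>x. f' x e)"
    "\<forall>x. (g has_derivative g' x) (at x)" "\<forall>e. continuous_on UNIV (\<lambda>x. g' x e)" by blast
  have "continuous_on UNIV f" "continuous_on UNIV g"
    using mult.hyps by (auto intro: continuous_real_polymonial_function continuous_at_imp_continuous_on)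
  with d show ?case
    by (intro exI[of _ "\<lambda>x e. f x * g' x e + f' x e * g x"])
      (auto intro!: derivative_eq_intros continuous_intros)
qed

lemma polynomial_function_C1:
  fixes v :: "'a::euclidean_space \<Rightarrow> 'b::euclidean_space"
  assumes "polynomial_function v"
  obtains v' where "\<And>x. (v has_derivative v' x) (at x)" "\<And>e. continuous_on UNIV (\<lambda>x. v' x e)"
proof -
  have "\<forall>b\<in>Basis. \<exists>f'. (\<forall>x. ((\<lambda>x. v x \<bullet> b) has_derivative f' x) (at x)) \<and> (\<forall>e. continuous_on UNIV (\<lambda>x. f' x e))"
    using assms polynomial_function_iff_Basis_inner[of v] real_polynomial_function_C1 by blast
  then obtain D where D: "\<And>b x. b \<in> Basis \<Longrightarrow> ((\<lambda>x. v x \<bullet> b) has_derivative D b x) (at x)"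
      "\<And>b e. b \<in> Basis \<Longrightarrow> continuous_on UNIV (\<lambda>x. D b x e)"
    by metis
  have "(v has_derivative (\<lambda>e. \<Sum>b\<in>Basis. D b x e *\<^sub>R b)) (at x)" for x
  proof -
    have "((\<lambda>x. \<Sum>b\<in>Basis. (v x \<bullet> b) *\<^sub>R b) has_derivative (\<lambda>e. \<Sum>b\<in>Basis. D b x e *\<^sub>R b)) (at x)"
      by (intro has_derivative_sum has_derivative_scaleR_left D)
    then show ?thesis by (simp add: euclidean_representation)
  qed
  moreover have "continuous_on UNIV (\<lambda>x. \<Sum>b\<in>Basis. D b x e *\<^sub>R b)" for e
    by (intro continuous_intros D)
  ultimately show thesis by (rule that)
qed

text \<open>Restricted to a line through a point of \<open>U\<close>, the polynomial has infinitely many roots.\<close>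

lemma real_polynomial_function_zero:
  fixes f :: "'a::euclidean_space \<Rightarrow> real"
  assumes f: "real_polynomial_function f" and U: "open U" "U \<noteq> {}" "\<And>x. x \<in> U \<Longrightarrow> f x = 0"
  shows "f y = 0"
proof -
  obtain x where x: "x \<in> U" using U by auto
  define l where "l t = x + t *\<^sub>R (y - x)" for t :: real
  have "polynomial_function l"
    unfolding l_def by (intro polynomial_function_add polynomial_function_mult polynomial_function_const polynomial_function_id)
  then have "real_polynomial_function (f \<circ> l)"
    using f by (rule real_polynomial_function_compose)
  then obtain c n where c: "f \<circ> l = (\<lambda>t. \<Sum>i\<le>n. c i * t ^ i)"
    using real_polynomial_function_iff_sum by blast
  have "open (l -` U)"
    using U(1) unfolding l_def by (intro open_vimage) (auto intro!: continuous_intros)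
  moreover have "0 \<in> l -` U" using x by (simp add: l_def)
  ultimately have "infinite (l -` U)" using finite_imp_not_open by blast
  moreover have "l -` U \<subseteq> {t. (\<Sum>i\<le>n. c i * t ^ i) = 0}"
  proof
    fix t assume "t \<in> l -` U"
    then have "f (l t) = 0" using U(3) by simp
    then show "t \<in> {t. (\<Sum>i\<le>n. c i * t ^ i) = 0}" using fun_cong[OF c, of t] by simp
  qed
  ultimately have "infinite {t. (\<Sum>i\<le>n. c i * t ^ i) = 0}" by (metis finite_subset)
  then have "\<forall>i\<le>n. c i = 0" using polyfun_finite_roots[of c n] by auto
  then have "(f \<circ> l) 1 = 0" unfolding c by simp
  then show ?thesis by (simp add: l_def)
qed

lemma polynomial_function_eq_AE:
  fixes p q :: "'a::euclidean_space \<Rightarrow> 'b::euclidean_space"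
  assumes p: "polynomial_function p" and q: "polynomial_function q"
    and K: "interior K \<noteq> {}" and eq: "AE x\<in>K in lebesgue. p x = q x"
  shows "p = q"
proof
  fix y
  have cont: "continuous_on UNIV p" "continuous_on UNIV q"
    using p q by (auto intro: continuous_polymonial_function continuous_at_imp_continuous_on)
  have "open (interior K \<inter> {x. p x \<noteq> q x})"
    using cont by (intro open_Int open_interior open_Collect_neq)
  moreover have "negligible (interior K \<inter> {x. p x \<noteq> q x})"
  proof -
    obtain N where "\<And>x. x \<in> space lebesgue - N \<Longrightarrow> x \<in> K \<longrightarrow> p x = q x" "N \<in> null_sets lebesgue"
      using eq by (rule AE_E3) blast
    moreover from this have "interior K \<inter> {x. p x \<noteq> q x} \<subseteq> N"
      using interior_subset[of K] by auto
    ultimately show ?thesis by (meson negligible_iff_null_sets negligible_subset)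
  qed
  ultimately have eq: "p x = q x" if "x \<in> interior K" for x
    using open_not_negligible that by blast
  have "(p y - q y) \<bullet> b = 0" if b: "b \<in> Basis" for b
  proof -
    have "real_polynomial_function (\<lambda>x. (p x - q x) \<bullet> b)"
      using polynomial_function_diff[OF p q, unfolded polynomial_function_iff_Basis_inner] b by blast
    then show ?thesis
      by (rule real_polynomial_function_zero[OF _ open_interior K, where y = y]) (simp only: eq diff_self inner_zero_left)
  qed
  then have "p y - q y = 0"
    using euclidean_all_zero_iff[of "p y - q y"] by blast
  then show "p y = q y" by simp
qed

text \<open>Two polynomials that agree almost everywhere on a set with interior points are equal, so the
  definite description defining \<open>piece\<close> denotes the polynomial that exists by assumption.\<close>

lemma polynomial_function_piece:
  fixes v :: "real^'n \<Rightarrow> real^'n"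
  assumes v: "v \<in> broken_vector_space \<Omega> \<T> r" and K: "K \<in> \<T>" "interior K \<noteq> {}"
  shows "polynomial_function (piece v K)"
proof -
  obtain p where p: "\<And>i. (\<lambda>x. p x $ i) \<in> poly_space r" "AE x\<in>K in lebesgue. v x = p x"
    using v K(1) by (auto simp: broken_vector_space_def)
  have "real_polynomial_function (\<lambda>x. p x $ i)" for i
  proof -
    obtain c where c: "\<And>x. p x $ i = (\<Sum>\<alpha> | (\<Sum>i\<in>UNIV. \<alpha> i) \<le> r. c \<alpha> * (\<Prod>i\<in>UNIV. (x $ i) ^ \<alpha> i))"
      using p(1)[of i] by (auto simp: poly_space_def)
    have comp: "real_polynomial_function (\<lambda>x::real^'n. x $ i)" for i
      by (intro real_polynomial_function.intros(1) bounded_linear_vec_nth)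
    have mono: "real_polynomial_function (\<lambda>x::real^'n. c \<alpha> * (\<Prod>i\<in>UNIV. (x $ i) ^ \<alpha> i))" for \<alpha>
      by (rule real_polynomial_function.intros(4)[OF real_polynomial_function.intros(2)
            real_polynomial_function_prod[OF _ real_polynomial_function_power[OF comp]]]) simp
    have "real_polynomial_function (\<lambda>x. \<Sum>\<alpha> | (\<Sum>i\<in>UNIV. \<alpha> i) \<le> r. c \<alpha> * (\<Prod>i\<in>UNIV. (x $ i) ^ \<alpha> i))"
    proof (cases "finite {\<alpha>. (\<Sum>i\<in>(UNIV::'n set). \<alpha> i) \<le> r}")
      case True
      then show ?thesis by (rule real_polynomial_function_sum) (rule mono)
    next
      case False
      then show ?thesis by (simp add: real_polynomial_function.intros(2))
    qed
    then show ?thesis by (simp add: c)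
  qed
  then have "real_polynomial_function (\<lambda>x. p x \<bullet> b)" if "b \<in> Basis" for b
    using that by (auto simp: Basis_vec_def inner_axis)
  then have pp: "polynomial_function p"
    unfolding polynomial_function_iff_Basis_inner by blast
  have "piece v K = p"
    unfolding piece_def
  proof (rule the_equality)
    fix q assume "polynomial_function q \<and> (AE x\<in>K in lebesgue. v x = q x)"
    then have q: "polynomial_function q" "AE x\<in>K in lebesgue. v x = q x" by auto
    have "AE x\<in>K in lebesgue. q x = p x" using p(2) q(2) by eventually_elim auto
    then show "q = p" by (rule polynomial_function_eq_AE[OF q(1) pp K(2)])
  qed (use pp p in auto)
  with pp show ?thesis by simp
qed

section \<open>Simplicial meshes and integrals over their faces\<close>

definition full_simplex :: "'a::euclidean_space set \<Rightarrow> bool" where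
  "full_simplex K \<longleftrightarrow> int DIM('a) simplex K"

lemma full_simplexE:
  fixes K :: "'a::euclidean_space set"
  assumes "full_simplex K"
  obtains C a c where "barycentric C a c" "K = convex hull C"
proof -
  obtain C where C: "\<not> affine_dependent C" "int (card C) = int DIM('a) + 1" "K = convex hull C"
    using assms by (auto simp: full_simplex_def simplex_def)
  then have "card C = DIM('a) + 1" by linarith
  with C(1) obtain a c where "barycentric C a c" by (rule barycentric_exists)
  then show thesis using C(3) by (rule that)
qed

lemma full_simplex_facetE:
  fixes K :: "'a::euclidean_space set"
  assumes "full_simplex K" "F facet_of K"
  obtains C a c v where "barycentric C a c" "K = convex hull C" "v \<in> C" "F = convex hull (C - {v})"
proof -
  obtain C a c where C: "barycentric C a c" "K = convex hull C"
    using assms(1) by (rule full_simplexE)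
  then obtain v where "v \<in> C" "F = convex hull (C - {v})"
    using assms(2) barycentric.facet_of_iff by blast
  with C show thesis by (rule that)
qed

lemma outward_normal_hyperplane:
  assumes "full_simplex K" "F facet_of K"
  shows "norm (outward_normal K F) = 1" "\<exists>c. affine hull F = {x. outward_normal K F \<bullet> x = c}" "F \<noteq> {}"
proof -
  obtain C a c v where b: "barycentric C a c" and KF: "K = convex hull C" "v \<in> C" "F = convex hull (C - {v})"
    using full_simplex_facetE[OF assms] by blast
  interpret barycentric C a c by (rule b)
  show "norm (outward_normal K F) = 1"
    using gradient_nonzero[OF KF(2)] outward_normal_facet[OF KF(2)] by (simp add: KF)
  show "\<exists>c. affine hull F = {x. outward_normal K F \<bullet> x = c}"
    using hyperplane_facet[OF KF(2)] by (auto simp: KF(1,3))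
  show "F \<noteq> {}" using facet_nonempty by (simp add: KF)
qed

text \<open>At a relative interior point of a facet all barycentric coordinates but one are positive, and the
  remaining one increases when the facet is left against its outward normal.\<close>

lemma eventually_interior_below_facet:
  assumes K: "full_simplex K" "F facet_of K" and x: "x \<in> rel_interior F"
  shows "\<forall>\<^sub>F s in at_right 0. x - s *\<^sub>R outward_normal K F \<in> interior K"
proof -
  obtain C a c v where b: "barycentric C a c" and KF: "K = convex hull C" "v \<in> C" "F = convex hull (C - {v})"
    using full_simplex_facetE[OF K] by blast
  interpret barycentric C a c by (rule b)
  let ?n = "outward_normal K F"
  have n: "?n = - (1 / norm (a v)) *\<^sub>R a v"
    using outward_normal_facet[OF KF(2)] by (simp add: KF)
  have indep: "\<not> affine_dependent (C - {v})"
    using independent affine_independent_subset by blast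
  then obtain u where u: "\<forall>w\<in>C - {v}. 0 < u w" "sum u (C - {v}) = 1" "(\<Sum>w\<in>C - {v}. u w *\<^sub>R w) = x"
    using x rel_interior_convex_hull_explicit[OF indep] KF(3) by blast
  define u' where "u' w = (if w = v then 0 else u w)" for w
  have "sum u' (C - {v}) = sum u (C - {v})" "(\<Sum>w\<in>C - {v}. u' w *\<^sub>R w) = (\<Sum>w\<in>C - {v}. u w *\<^sub>R w)"
    by (intro sum.cong; auto simp: u'_def)+
  then have u': "sum u' C = 1" "(\<Sum>w\<in>C. u' w *\<^sub>R w) = x"
    using u by (simp_all add: sum.remove[OF fin KF(2)] u'_def)
  have co: "coord w x = u' w" if "w \<in> C" for w
    using coord_combination[OF u'(1) that] by (simp add: u'(2))
  have shift: "coord w (x - s *\<^sub>R ?n) = u' w - s * (a w \<bullet> ?n)" if "w \<in> C" for w s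
    using coord_add[of w x "-s" ?n] co[OF that] by simp
  have "\<forall>\<^sub>F s in at_right 0. \<forall>w\<in>C. 0 < coord w (x - s *\<^sub>R ?n)"
  proof (rule eventually_ball_finite[OF fin], rule ballI)
    fix w assume w: "w \<in> C"
    show "\<forall>\<^sub>F s in at_right 0. 0 < coord w (x - s *\<^sub>R ?n)"
    proof (cases "w = v")
      case True
      have "0 < coord w (x - s *\<^sub>R ?n)" if "0 < s" for s
      proof -
        have "a v \<bullet> ?n = - norm (a v)"
          using gradient_nonzero[OF KF(2)] by (simp add: n flip: power2_norm_eq_inner) (simp add: power2_eq_square)
        then show ?thesis
          unfolding shift[OF w] using that True gradient_nonzero[OF KF(2)] by (simp add: u'_def)
      qed
      then show ?thesis using eventually_at_right_less[of 0] by (rule eventually_mono[rotated])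
    next
      case False
      then have "0 < u' w" using u(1) w by (simp add: u'_def)
      moreover have "((\<lambda>s. u' w - s * (a w \<bullet> ?n)) \<longlongrightarrow> u' w - 0 * (a w \<bullet> ?n)) (at_right 0)"
        by (intro tendsto_intros)
      ultimately show ?thesis
        unfolding shift[OF w] by (intro order_tendstoD(1)[where y = "u' w"]) simp_all
    qed
  qed
  then show ?thesis
    by eventually_elim (auto simp: KF(1) intro: interior_coord)
qed

lemma unit_normals_of_hyperplane:
  fixes n m :: "'a::euclidean_space"
  assumes n: "norm n = 1" "norm m = 1" and eq: "{x. n \<bullet> x = c} = {x. m \<bullet> x = d}"
  shows "m = n \<or> m = - n"
proof -
  have nn: "n \<bullet> n = 1" "m \<bullet> m = 1" using n by (simp_all add: norm_eq_1)
  define z where "z = m - (n \<bullet> m) *\<^sub>R n"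
  have "n \<bullet> (c *\<^sub>R n) = c" "n \<bullet> (c *\<^sub>R n + z) = c"
    by (simp_all add: nn z_def inner_add_right inner_diff_right)
  moreover have "n \<bullet> x = c \<longleftrightarrow> m \<bullet> x = d" for x using eq by (simp add: set_eq_iff)
  ultimately have "m \<bullet> (c *\<^sub>R n) = d" "m \<bullet> (c *\<^sub>R n + z) = d" by metis+
  then have "m \<bullet> z = 0" by (simp add: inner_add_right)
  then have mn: "(n \<bullet> m) * (n \<bullet> m) = 1"
    by (simp add: z_def inner_diff_right nn inner_commute)
  have "z \<bullet> z = 0"
    using mn by (simp add: z_def inner_diff_right inner_diff_left nn inner_commute)
  then have "m = (n \<bullet> m) *\<^sub>R n" by (simp add: z_def)
  moreover have "n \<bullet> m = 1 \<or> n \<bullet> m = -1" using mn by (simp add: square_eq_1_iff)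
  ultimately show ?thesis by (metis scaleR_minus1_left scaleR_one)
qed

locale simplicial_mesh =
  fixes \<T> :: "'a::euclidean_space set set"
  assumes triangulation: "triangulation \<T>"
    and full: "K \<in> \<T> \<Longrightarrow> full_simplex K"
begin

lemma finite_mesh: "finite \<T>"
  using triangulation by (simp add: triangulation_def)

lemma interiors_disjoint:
  assumes "K \<in> \<T>" "K' \<in> \<T>" "interior K \<inter> interior K' \<noteq> {}"
  shows "K = K'"
proof -
  have "K \<inter> K' face_of K" "K' \<inter> K face_of K'"
    using triangulation assms by (auto simp: triangulation_def)
  moreover have "(K \<inter> K') \<inter> interior K \<noteq> {}" "(K' \<inter> K) \<inter> interior K' \<noteq> {}"
    using assms(3) interior_subset[of K] interior_subset[of K'] by blast+
  ultimately have "K \<inter> K' = K" "K' \<inter> K = K'"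
    using face_of_disjoint_interior by blast+
  then show ?thesis by blast
qed

text \<open>If the normals agreed, both simplices would contain the points slightly below a relative interior
  point of the common facet in their interiors, and two members of a triangulation with overlapping
  interiors coincide.\<close>

lemma opposite_normals:
  assumes K: "K \<in> \<T>" "F facet_of K" and K': "K' \<in> \<T>" "F facet_of K'" and ne: "K \<noteq> K'"
  shows "outward_normal K' F = - outward_normal K F"
proof -
  note h = outward_normal_hyperplane[OF full K(2), OF K(1)]
  note h' = outward_normal_hyperplane[OF full K'(2), OF K'(1)]
  have "outward_normal K' F \<noteq> outward_normal K F"
  proof
    assume eq: "outward_normal K' F = outward_normal K F"
    have "convex F"
      using full_simplex_facetE[OF full K(2), OF K(1)] convex_convex_hull by metis
    then obtain x where x: "x \<in> rel_interior F"
      using h(3) rel_interior_eq_empty by blast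
    have "\<forall>\<^sub>F s in at_right (0::real). x - s *\<^sub>R outward_normal K F \<in> interior K \<inter> interior K'"
      using eventually_interior_below_facet[OF full K(2) x, OF K(1)]
        eventually_interior_below_facet[OF full K'(2) x, OF K'(1)]
      by eventually_elim (simp add: eq)
    then have "interior K \<inter> interior K' \<noteq> {}"
      using eventually_happens'[OF trivial_limit_at_right_real] by blast
    then show False using interiors_disjoint K K' ne by blast
  qed
  moreover obtain c c' where
    "affine hull F = {x. outward_normal K F \<bullet> x = c}" "affine hull F = {x. outward_normal K' F \<bullet> x = c'}"
    using h(2) h'(2) by blast
  ultimately show ?thesis
    using unit_normals_of_hyperplane[OF h(1) h'(1)] by metis
qed

text \<open>Among three elements with a common facet two would have the same normal, since each normal is one
  of the two unit normals of a hyperplane.\<close>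

lemma neighbour_unique:
  assumes "K \<in> \<T>" "F facet_of K" "K' \<in> \<T>" "F facet_of K'" "K'' \<in> \<T>" "F facet_of K''" "K \<noteq> K'" "K \<noteq> K''"
  shows "K' = K''"
proof (rule ccontr)
  let ?n = "outward_normal K F"
  assume "K' \<noteq> K''"
  then have "outward_normal K'' F = - outward_normal K' F" "outward_normal K' F = - ?n" "outward_normal K'' F = - ?n"
    using opposite_normals assms by blast+
  then have "?n = - ?n" by simp
  then have "2 *\<^sub>R ?n = 0" by (simp add: scaleR_2 eq_neg_iff_add_eq_0)
  then have "?n = 0" by simp
  then show False using outward_normal_hyperplane(1)[OF full assms(2), OF assms(1)] by simp
qed

lemma finite_facets: "K \<in> \<T> \<Longrightarrow> finite {F. F facet_of K}"
  using full by (auto simp: full_simplex_def intro!: finite_polytope_facets simplex_imp_polytope)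

lemma finite_faces: "finite (faces \<T>)"
proof -
  have "faces \<T> = (\<Union>K\<in>\<T>. {F. F facet_of K})" by (auto simp: faces_def)
  then show ?thesis using finite_mesh finite_facets by simp
qed

lemma interior_faces_subset: "interior_faces \<T> \<subseteq> faces \<T>"
  by (auto simp: interior_faces_def faces_def)

context
  fixes P assumes P: "orientation \<T> P"
begin

lemma plus_element: "F \<in> faces \<T> \<Longrightarrow> P F \<in> \<T>" "F \<in> faces \<T> \<Longrightarrow> F facet_of P F"
  using P by (auto simp: orientation_def)

lemma minus_element:
  assumes F: "F \<in> interior_faces \<T>"
  shows "minus_element \<T> P F \<in> \<T>" "F facet_of minus_element \<T> P F" "minus_element \<T> P F \<noteq> P F"
proof -
  have FF: "F \<in> faces \<T>" using F interior_faces_subset by blast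
  obtain K K' where "K \<in> \<T>" "K' \<in> \<T>" "K \<noteq> K'" "F facet_of K" "F facet_of K'"
    using F by (auto simp: interior_faces_def)
  then obtain L where L: "L \<in> \<T> \<and> F facet_of L \<and> L \<noteq> P F" by metis
  then have "\<exists>!L. L \<in> \<T> \<and> F facet_of L \<and> L \<noteq> P F"
    using neighbour_unique[OF plus_element[OF FF]] by metis
  from theI'[OF this] show "minus_element \<T> P F \<in> \<T>" "F facet_of minus_element \<T> P F"
    "minus_element \<T> P F \<noteq> P F" by (auto simp: minus_element_def)
qed

lemma elements_of_interior_face:
  assumes F: "F \<in> interior_faces \<T>"
  shows "{K\<in>\<T>. F facet_of K} = {P F, minus_element \<T> P F}"
proof -
  have FF: "F \<in> faces \<T>" using F interior_faces_subset by blast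
  show ?thesis
    using neighbour_unique[OF plus_element[OF FF]] plus_element[OF FF] minus_element[OF F] by blast
qed

lemma elements_of_boundary_face:
  assumes F: "F \<in> boundary_faces \<T>"
  shows "{K\<in>\<T>. F facet_of K} = {P F}"
  using F plus_element[of F] by (auto simp: boundary_faces_def interior_faces_def)

lemma sum_interior_facets:
  fixes X :: "'a set \<Rightarrow> 'a set \<Rightarrow> real"
  shows "(\<Sum>K\<in>\<T>. \<Sum>F | F facet_of K \<and> F \<in> interior_faces \<T>. X K F) =
    (\<Sum>F\<in>interior_faces \<T>. X (P F) F + X (minus_element \<T> P F) F)"
proof -
  have fin: "finite (interior_faces \<T>)" using finite_faces interior_faces_subset finite_subset by blast
  have "(\<Sum>K\<in>\<T>. \<Sum>F | F facet_of K \<and> F \<in> interior_faces \<T>. X K F) =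
      (\<Sum>K\<in>\<T>. \<Sum>F | F \<in> interior_faces \<T> \<and> F facet_of K. X K F)"
    by (simp add: conj_commute)
  also have "\<dots> = (\<Sum>F\<in>interior_faces \<T>. \<Sum>K | K \<in> \<T> \<and> F facet_of K. X K F)"
    by (rule sum.swap_restrict[OF finite_mesh fin])
  also have "\<dots> = (\<Sum>F\<in>interior_faces \<T>. X (P F) F + X (minus_element \<T> P F) F)"
  proof (intro sum.cong refl)
    fix F assume F: "F \<in> interior_faces \<T>"
    show "(\<Sum>K | K \<in> \<T> \<and> F facet_of K. X K F) = X (P F) F + X (minus_element \<T> P F) F"
      unfolding elements_of_interior_face[OF F] using minus_element(3)[OF F] by simp
  qed
  finally show ?thesis .
qed

lemma sum_facets:
  fixes X :: "'a set \<Rightarrow> 'a set \<Rightarrow> real"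
  shows "(\<Sum>K\<in>\<T>. \<Sum>F | F facet_of K. X K F) =
    (\<Sum>F\<in>interior_faces \<T>. X (P F) F + X (minus_element \<T> P F) F) + (\<Sum>F\<in>boundary_faces \<T>. X (P F) F)"
proof -
  have fin: "finite (boundary_faces \<T>)" using finite_faces by (simp add: boundary_faces_def)
  have split: "(\<Sum>F | F facet_of K. X K F) = (\<Sum>F | F facet_of K \<and> F \<in> interior_faces \<T>. X K F) +
      (\<Sum>F | F \<in> boundary_faces \<T> \<and> F facet_of K. X K F)" if K: "K \<in> \<T>" for K
  proof -
    have "{F. F facet_of K} = {F. F facet_of K \<and> F \<in> interior_faces \<T>} \<union> {F. F \<in> boundary_faces \<T> \<and> F facet_of K}"
      using K by (auto simp: boundary_faces_def faces_def)
    then show ?thesis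
      by (metis (no_types, lifting) K finite_facets finite_Un sum.union_disjoint
        disjoint_iff mem_Collect_eq boundary_faces_def DiffE)
  qed
  have "(\<Sum>K\<in>\<T>. \<Sum>F | F \<in> boundary_faces \<T> \<and> F facet_of K. X K F) =
      (\<Sum>F\<in>boundary_faces \<T>. \<Sum>K | K \<in> \<T> \<and> F facet_of K. X K F)"
    by (rule sum.swap_restrict[OF finite_mesh fin])
  also have "\<dots> = (\<Sum>F\<in>boundary_faces \<T>. X (P F) F)"
    by (intro sum.cong refl) (simp add: elements_of_boundary_face)
  finally show ?thesis
    by (simp add: split sum.distrib sum_interior_facets)
qed

end

end

lemma face_integral_nonneg: "(\<And>x. 0 \<le> f x) \<Longrightarrow> 0 \<le> face_integral F f"
  by (simp add: face_integral_def set_lebesgue_integral_def)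

lemma set_integrable_facet:
  assumes "full_simplex K" "F facet_of K" "continuous_on UNIV f"
  shows "set_integrable (affine_lborel (affine hull F)) F (f :: _ \<Rightarrow> real)"
  using full_simplex_facetE[OF assms(1,2)] barycentric.face_integrable continuous_on_subset[OF assms(3)]
  by (metis top_greatest)

lemma face_integral_add:
  assumes "full_simplex K" "F facet_of K" "continuous_on UNIV f" "continuous_on UNIV g"
  shows "face_integral F (\<lambda>x. f x + g x) = face_integral F f + face_integral F g"
  unfolding face_integral_def
  using set_integral_add(2)[OF set_integrable_facet[OF assms(1-3)] set_integrable_facet[OF assms(1,2,4)]]
  by simp

lemma face_integral_cmult: "face_integral F (\<lambda>x. c * f x) = c * face_integral F f"
  by (simp add: face_integral_def)

lemma face_integral_sum:
  assumes "full_simplex K" "F facet_of K" "\<And>i. i \<in> I \<Longrightarrow> continuous_on UNIV (f i)"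
  shows "face_integral F (\<lambda>x. \<Sum>i\<in>I. f i x) = (\<Sum>i\<in>I. face_integral F (f i))"
  using assms(3)
proof (induction I rule: infinite_finite_induct)
  case (insert i I)
  then show ?case
    by (simp add: face_integral_add[OF assms(1,2)] continuous_on_sum)
qed (simp_all add: face_integral_def)

lemma integral_lebesgue_on_compact:
  fixes g :: "'a::euclidean_space \<Rightarrow> real"
  assumes K: "compact K" and g: "continuous_on UNIV g"
  shows "(\<integral>x. g x \<partial>lebesgue_on K) = (\<integral>x. indicator K x * g x \<partial>lborel)"
    "integrable (lebesgue_on K) g"
proof -
  have Ks: "K \<in> sets borel" using K by (simp add: borel_compact)
  have m: "(\<lambda>x. indicator K x * g x) \<in> borel_measurable lborel"
    using Ks borel_measurable_continuous_onI[OF g] by measurable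
  have "(\<integral>x. g x \<partial>lebesgue_on K) = (\<integral>x. indicator K x * g x \<partial>lebesgue)"
    using Ks by (subst integral_restrict_space) auto
  also have "\<dots> = (\<integral>x. indicator K x * g x \<partial>lborel)"
    by (rule integral_completion[OF m])
  finally show "(\<integral>x. g x \<partial>lebesgue_on K) = (\<integral>x. indicator K x * g x \<partial>lborel)" .
  have "integrable lborel (\<lambda>x. indicator K x * g x)"
    using borel_integrable_compact[OF K continuous_on_subset[OF g]] by simp
  then have "integrable lebesgue (\<lambda>x. indicator K x * g x)"
    by (simp add: integrable_completion[OF m])
  then show "integrable (lebesgue_on K) g"
    using Ks by (subst integrable_restrict_space) auto
qed

section \<open>Dissipativity of the convective form\<close>

lemma outer_mult_vec: "outer a b *v n = (b \<bullet> n) *\<^sub>R a"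
  by (vector outer_def matrix_vector_mult_def inner_vec_def) (simp add: sum_distrib_left mult_ac)

text \<open>Up to the sign, the two volume terms of the convective form with equal arguments are the integral of
  the divergence of \<open>\<bar>v\<bar>\<^sup>2 v / 2\<close>: the \<open>j\<close>-th summand below is the derivative of \<open>\<phi> j = \<bar>v\<bar>\<^sup>2 v\<^sub>j / 2\<close> in the \<open>j\<close>-th
  coordinate direction, and the divergence theorem applies to each.\<close>

lemma integral_divergence:
  fixes v :: "real^'n \<Rightarrow> real^'n"
  assumes K: "full_simplex K" and v: "polynomial_function v"
  defines "G \<equiv> \<lambda>x. jacobian v (at x)"
  shows "(\<integral>x. outer (v x) (v x) \<bullet> G x \<partial>lebesgue_on K) + 1/2 * (\<integral>x. (trace (G x) *\<^sub>R v x) \<bullet> v x \<partial>lebesgue_on K) =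
    1/2 * (\<Sum>F | F facet_of K. face_integral F (\<lambda>x. (v x \<bullet> v x) * (v x \<bullet> outward_normal K F)))"
proof -
  obtain v' where v': "\<And>x. (v has_derivative v' x) (at x)" "\<And>e. continuous_on UNIV (\<lambda>x. v' x e)"
    using polynomial_function_C1[OF v] by blast
  obtain C a c where "barycentric C a c" and KC: "K = convex hull C"
    using full_simplexE[OF K] by blast
  then interpret barycentric C a c by simp
  have K': "compact K" using fin unfolding KC by (intro compact_convex_hull finite_imp_compact) auto
  have contv: "continuous_on UNIV v"
    by (intro continuous_at_imp_continuous_on ballI has_derivative_continuous[OF v'(1)])
  let ?e = "\<lambda>j. axis j (1::real) :: real^'n"
  have G: "G x $ i $ j = v' x (?e j) $ i" for x i j
    using frechet_derivative_at[OF v'(1), of x] by (simp add: G_def jacobian_def matrix_def)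
  have contG: "continuous_on UNIV (\<lambda>x. G x $ i $ j)" for i j
    unfolding G by (intro continuous_intros v')
  define \<phi> where "\<phi> j x = 1/2 * (v x \<bullet> v x) * (v x $ j)" for j x
  define \<phi>' where "\<phi>' j x e = (v x \<bullet> v' x e) * (v x $ j) + 1/2 * (v x \<bullet> v x) * (v' x e $ j)" for j x e
  have d\<phi>: "(\<phi> j has_derivative \<phi>' j x) (at x)" for j x
  proof -
    have "((\<lambda>x. v x $ j) has_derivative (\<lambda>e. v' x e $ j)) (at x)"
      by (rule bounded_linear.has_derivative[OF bounded_linear_vec_nth v'(1)])
    from has_derivative_mult[OF has_derivative_mult_right[OF has_derivative_inner[OF v'(1) v'(1)], of "1/2"] this]
    have "((\<lambda>x. 1/2 * (v x \<bullet> v x) * (v x $ j)) has_derivative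
        (\<lambda>e. 1/2 * (v x \<bullet> v x) * (v' x e $ j) + 1/2 * (v x \<bullet> v' x e + v' x e \<bullet> v x) * (v x $ j))) (at x)" .
    then show ?thesis
      by (simp add: \<phi>_def[abs_def] \<phi>'_def[abs_def] inner_commute[of "v' x _"] algebra_simps)
  qed
  have c\<phi>': "continuous_on UNIV (\<lambda>x. \<phi>' j x e)" for j e
    unfolding \<phi>'_def by (intro continuous_intros contv v')
  have c\<phi>: "continuous_on UNIV (\<phi> j)" for j
    unfolding \<phi>_def[abs_def] by (intro continuous_intros contv)
  have pointwise: "outer (v x) (v x) \<bullet> G x + 1/2 * ((trace (G x) *\<^sub>R v x) \<bullet> v x) = (\<Sum>j\<in>UNIV. \<phi>' j x (?e j))" for x
  proof -
    have "outer (v x) (v x) \<bullet> G x = (\<Sum>i\<in>UNIV. \<Sum>j\<in>UNIV. v x $ i * v x $ j * G x $ i $ j)"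
      by (simp add: inner_vec_def outer_def)
    also have "\<dots> = (\<Sum>j\<in>UNIV. \<Sum>i\<in>UNIV. v x $ i * v x $ j * G x $ i $ j)" by (rule sum.swap)
    also have "\<dots> = (\<Sum>j\<in>UNIV. (v x \<bullet> v' x (?e j)) * v x $ j)"
      by (simp add: G inner_vec_def sum_distrib_left sum_distrib_right mult_ac)
    finally show ?thesis
      by (simp add: \<phi>'_def sum.distrib trace_def G sum_distrib_left sum_distrib_right mult_ac)
  qed
  have cO: "continuous_on UNIV (\<lambda>x. outer (v x) (v x) \<bullet> G x)"
    unfolding inner_vec_def outer_def by (simp, intro continuous_intros contv contG)
  have cT: "continuous_on UNIV (\<lambda>x. (trace (G x) *\<^sub>R v x) \<bullet> v x)"
    unfolding trace_def by (intro continuous_intros contv contG)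
  have int\<phi>: "integrable lborel (\<lambda>x. indicator K x * \<phi>' j x (?e j))" for j
    using borel_integrable_compact[OF K' continuous_on_subset[OF c\<phi>']] by simp
  have "(\<integral>x. outer (v x) (v x) \<bullet> G x \<partial>lebesgue_on K) + 1/2 * (\<integral>x. (trace (G x) *\<^sub>R v x) \<bullet> v x \<partial>lebesgue_on K) =
      (\<integral>x. outer (v x) (v x) \<bullet> G x + 1/2 * ((trace (G x) *\<^sub>R v x) \<bullet> v x) \<partial>lebesgue_on K)"
    using integral_lebesgue_on_compact(2)[OF K' cO] integral_lebesgue_on_compact(2)[OF K' cT] by simp
  also have "\<dots> = (\<integral>x. (\<Sum>j\<in>UNIV. \<phi>' j x (?e j)) \<partial>lebesgue_on K)"
    unfolding pointwise ..
  also have "\<dots> = (\<integral>x. indicator K x * (\<Sum>j\<in>UNIV. \<phi>' j x (?e j)) \<partial>lborel)"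
    by (rule integral_lebesgue_on_compact(1)[OF K']) (intro continuous_intros c\<phi>')
  also have "\<dots> = (\<Sum>j\<in>UNIV. \<integral>x. indicator K x * \<phi>' j x (?e j) \<partial>lborel)"
    unfolding sum_distrib_left by (rule Bochner_Integration.integral_sum) (rule int\<phi>)
  also have "\<dots> = (\<Sum>j\<in>UNIV. \<Sum>F | F facet_of K. (outward_normal K F \<bullet> ?e j) * face_integral F (\<phi> j))"
    unfolding KC by (intro sum.cong refl integral_derivative d\<phi> c\<phi>')
  also have "\<dots> = (\<Sum>F | F facet_of K. \<Sum>j\<in>UNIV. (outward_normal K F \<bullet> ?e j) * face_integral F (\<phi> j))"
    by (rule sum.swap)
  also have "\<dots> = (\<Sum>F | F facet_of K. 1/2 * face_integral F (\<lambda>x. (v x \<bullet> v x) * (v x \<bullet> outward_normal K F)))"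
  proof (intro sum.cong refl)
    fix F assume "F \<in> {F. F facet_of K}"
    then have F: "F facet_of K" by simp
    have "(\<Sum>j\<in>UNIV. (outward_normal K F \<bullet> ?e j) * face_integral F (\<phi> j)) =
        face_integral F (\<lambda>x. \<Sum>j\<in>UNIV. (outward_normal K F \<bullet> ?e j) * \<phi> j x)"
      by (subst face_integral_sum[OF K F]) (auto simp: face_integral_cmult intro!: continuous_intros c\<phi>)
    also have "(\<lambda>x. \<Sum>j\<in>UNIV. (outward_normal K F \<bullet> ?e j) * \<phi> j x) =
        (\<lambda>x. 1/2 * ((v x \<bullet> v x) * (v x \<bullet> outward_normal K F)))"
    proof
      fix x
      have "(\<Sum>j\<in>UNIV. (outward_normal K F \<bullet> ?e j) * \<phi> j x) =
          (\<Sum>j\<in>UNIV. (1/2 * (v x \<bullet> v x)) * (v x $ j * outward_normal K F $ j))"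
        by (intro sum.cong refl) (simp add: \<phi>_def inner_axis)
      also have "\<dots> = 1/2 * (v x \<bullet> v x) * (v x \<bullet> outward_normal K F)"
        unfolding sum_distrib_left[symmetric] by (simp add: inner_vec_def[of "v x" "outward_normal K F"])
      finally show "(\<Sum>j\<in>UNIV. (outward_normal K F \<bullet> ?e j) * \<phi> j x) =
          1/2 * ((v x \<bullet> v x) * (v x \<bullet> outward_normal K F))" by simp
    qed
    finally show "(\<Sum>j\<in>UNIV. (outward_normal K F \<bullet> ?e j) * face_integral F (\<phi> j)) =
        1/2 * face_integral F (\<lambda>x. (v x \<bullet> v x) * (v x \<bullet> outward_normal K F))"
      by (simp only: face_integral_cmult)
  qed
  finally show ?thesis by (simp only: sum_distrib_left)
qed

text \<open>The algebra behind the cancellation on an interior face with traces \<open>p\<close>, \<open>m\<close> and normal \<open>n\<close>. It is the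
  product rule for jumps: the jump of \<open>\<bar>v\<bar>\<^sup>2 v \<bullet> n\<close> is the average of \<open>v \<bullet> n\<close> times the jump of \<open>\<bar>v\<bar>\<^sup>2\<close> plus the
  average of \<open>\<bar>v\<bar>\<^sup>2\<close> times the jump of \<open>v \<bullet> n\<close>, and the jump of \<open>\<bar>v\<bar>\<^sup>2\<close> is twice the average of \<open>v\<close> times its
  jump.\<close>

lemma interior_flux_identity:
  fixes p m n :: "'a::real_inner"
  shows "((1/2) *\<^sub>R (p + m) \<bullet> n) * ((1/2) *\<^sub>R (p + m) \<bullet> p) + - ((1/2) *\<^sub>R (p + m) \<bullet> n) * ((1/2) *\<^sub>R (p + m) \<bullet> m)
      + 1/2 * (1/2 * (p \<bullet> p + m \<bullet> m) * (p \<bullet> n) + - 1/2 * (p \<bullet> p + m \<bullet> m) * (m \<bullet> n))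
      + (- 1/2) * ((p \<bullet> p) * (p \<bullet> n) + - (m \<bullet> m) * (m \<bullet> n)) = 0"
  by (simp add: inner_add_left inner_commute[of m p] field_simps)

context
  fixes \<T> :: "(real^'n) set set" and P and \<zeta> :: "(real^'n) set \<Rightarrow> real"
    and v :: "real^'n \<Rightarrow> real^'n"
  assumes mesh: "simplicial_mesh \<T>" and P: "orientation \<T> P"
    and poly: "\<And>K. K \<in> \<T> \<Longrightarrow> polynomial_function (piece v K)"
begin

interpretation simplicial_mesh \<T> by (rule mesh)

lemma continuous_piece: "K \<in> \<T> \<Longrightarrow> continuous_on S (piece v K)"
  using poly[of K] by (auto intro: continuous_polymonial_function continuous_at_imp_continuous_on)

text \<open>What the facet \<open>F\<close>, seen from the element \<open>K\<close>, contributes to the convective form with three equal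
  arguments: the penalty, the flux, and the boundary term that the divergence theorem produces
  from the volume terms.\<close>

definition facet_flux :: "(real^'n) set \<Rightarrow> (real^'n) set \<Rightarrow> real" where
  "facet_flux K F =
    face_integral F (\<lambda>x. (((\<zeta> F * \<bar>avg \<T> P (piece v) F x \<bullet> outward_normal K F\<bar>) *\<^sub>R
        jump_n \<T> P (piece v) F x) *v outward_normal K F) \<bullet> piece v K x)
    + face_integral F (\<lambda>x. (outer (avg \<T> P (piece v) F x) (avg \<T> P (piece v) F x) *v outward_normal K F) \<bullet> piece v K x)
    - 1/2 * face_integral F (\<lambda>x. (piece v K x \<bullet> piece v K x) * (piece v K x \<bullet> outward_normal K F))"

text \<open>Half of this is the contribution of the last term of the convective form, which lives on interior
  faces only.\<close>

definition interior_flux :: "(real^'n) set \<Rightarrow> (real^'n) set \<Rightarrow> real" where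
  "interior_flux K F = face_integral F (\<lambda>x. piece v K x \<bullet>
      (avg \<T> P (\<lambda>K' y. piece v K' y \<bullet> piece v K' y) F x *\<^sub>R outward_normal K F))"

text \<open>The divergence theorem turns the volume terms into sums over element boundaries, and these sums are
  regrouped by faces.\<close>

lemma c_form_eq_fluxes:
  "c_form \<T> P \<zeta> v v v =
    (\<Sum>F\<in>interior_faces \<T>. facet_flux (P F) F + facet_flux (minus_element \<T> P F) F
      + 1/2 * (interior_flux (P F) F + interior_flux (minus_element \<T> P F) F))
    + (\<Sum>F\<in>boundary_faces \<T>. facet_flux (P F) F)"
proof -
  have elements: "inner_elements \<T> (\<lambda>K x. outer (piece v K x) (piece v K x)) (broken_grad v)
      + 1/2 * inner_elements \<T> (\<lambda>K x. broken_div v K x *\<^sub>R piece v K x) (piece v)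
    = (\<Sum>K\<in>\<T>. \<Sum>F | F facet_of K. 1/2 * face_integral F (\<lambda>x. (piece v K x \<bullet> piece v K x) * (piece v K x \<bullet> outward_normal K F)))"
    unfolding inner_elements_def sum_distrib_left sum.distrib[symmetric] broken_div_def broken_grad_def
  proof (intro sum.cong refl)
    fix K assume K: "K \<in> \<T>"
    show "(\<integral>x. outer (piece v K x) (piece v K x) \<bullet> jacobian (piece v K) (at x) \<partial>lebesgue_on K)
      + 1/2 * (\<integral>x. (trace (jacobian (piece v K) (at x)) *\<^sub>R piece v K x) \<bullet> piece v K x \<partial>lebesgue_on K)
      = (\<Sum>F | F facet_of K. 1/2 * face_integral F (\<lambda>x. (piece v K x \<bullet> piece v K x) * (piece v K x \<bullet> outward_normal K F)))"
      using integral_divergence[OF full[OF K] poly[OF K]] by (simp add: sum_distrib_left)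
  qed
  have "c_form \<T> P \<zeta> v v v = (\<Sum>K\<in>\<T>. \<Sum>F | F facet_of K. facet_flux K F)
      + 1/2 * (\<Sum>K\<in>\<T>. \<Sum>F | F facet_of K \<and> F \<in> interior_faces \<T>. interior_flux K F)"
    using elements
    unfolding c_form_def inner_boundaries_def inner_interior_boundaries_def facet_flux_def interior_flux_def
    by (simp only: sum.distrib sum_subtractf)
  also have "\<dots> = (\<Sum>F\<in>interior_faces \<T>. facet_flux (P F) F + facet_flux (minus_element \<T> P F) F
      + 1/2 * (interior_flux (P F) F + interior_flux (minus_element \<T> P F) F))
    + (\<Sum>F\<in>boundary_faces \<T>. facet_flux (P F) F)"
    by (simp only: sum_facets[OF P] sum_interior_facets[OF P] sum.distrib sum_distrib_left distrib_left add_ac)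
  finally show ?thesis .
qed

text \<open>The contributions from the two sides add up to the penalty \<open>\<zeta> \<bar>avg v \<bullet> n\<bar> \<bar>jump v\<bar>\<^sup>2\<close>; everything else cancels.\<close>

lemma interior_face_contribution:
  assumes F: "F \<in> interior_faces \<T>" and \<zeta>: "0 \<le> \<zeta> F"
  shows "0 \<le> facet_flux (P F) F + facet_flux (minus_element \<T> P F) F
      + 1/2 * (interior_flux (P F) F + interior_flux (minus_element \<T> P F) F)"
proof -
  have FF: "F \<in> faces \<T>" using F interior_faces_subset by blast
  define M where "M = minus_element \<T> P F"
  define n where "n = outward_normal (P F) F"
  define p where "p = piece v (P F)"
  define m where "m = piece v M"
  note Pl = plus_element[OF P FF] and Mi = minus_element[OF P F, folded M_def]
  have nM: "outward_normal M F = - n"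
    unfolding n_def using opposite_normals[OF Pl Mi(1,2)] Mi(3) by metis
  have nn: "n \<bullet> n = 1"
    using outward_normal_hyperplane(1)[OF full[OF Pl(1)] Pl(2)] by (simp add: n_def norm_eq_1)
  have avg: "avg \<T> P (piece v) F x = (1/2) *\<^sub>R (p x + m x)" for x
    using F by (simp add: avg_def p_def m_def M_def)
  have avg2: "avg \<T> P (\<lambda>K' y. piece v K' y \<bullet> piece v K' y) F x = 1/2 * (p x \<bullet> p x + m x \<bullet> m x)" for x
    using F by (simp add: avg_def p_def m_def M_def)
  have jump: "jump_n \<T> P (piece v) F x *v n = p x - m x" for x
    using F by (simp add: jump_n_def jump_def face_normal_def p_def m_def M_def n_def[symmetric]
        matrix_vector_mult_diff_rdistrib outer_mult_vec nn)
  have jumpM: "jump_n \<T> P (piece v) F x *v (- n) = - (p x - m x)" for x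
    using jump[of x] matrix_vector_mult_scaleR[of "jump_n \<T> P (piece v) F x" "-1" n] by simp
  have cont [continuous_intros]: "continuous_on S p" "continuous_on S m" for S
    unfolding p_def m_def using continuous_piece Pl(1) Mi(1) by blast+
  let ?A = "\<lambda>x. (1/2) *\<^sub>R (p x + m x)"
  define z where "z x = \<zeta> F * \<bar>?A x \<bullet> n\<bar>" for x
  define f1 where "f1 x = z x * ((p x - m x) \<bullet> p x)" for x
  define f2 where "f2 x = z x * (- (p x - m x) \<bullet> m x)" for x
  define g1 where "g1 x = (?A x \<bullet> n) * (?A x \<bullet> p x)" for x
  define g2 where "g2 x = - (?A x \<bullet> n) * (?A x \<bullet> m x)" for x
  define h1 where "h1 x = (p x \<bullet> p x) * (p x \<bullet> n)" for x
  define h2 where "h2 x = - (m x \<bullet> m x) * (m x \<bullet> n)" for x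
  define k1 where "k1 x = 1/2 * (p x \<bullet> p x + m x \<bullet> m x) * (p x \<bullet> n)" for x
  define k2 where "k2 x = - 1/2 * (p x \<bullet> p x + m x \<bullet> m x) * (m x \<bullet> n)" for x
  have c: "continuous_on UNIV f1" "continuous_on UNIV f2" "continuous_on UNIV g1" "continuous_on UNIV g2"
    "continuous_on UNIV h1" "continuous_on UNIV h2" "continuous_on UNIV k1" "continuous_on UNIV k2"
    unfolding f1_def[abs_def] f2_def[abs_def] g1_def[abs_def] g2_def[abs_def] h1_def[abs_def] h2_def[abs_def]
      k1_def[abs_def] k2_def[abs_def] z_def[abs_def]
    by (intro continuous_intros)+
  have flux1: "facet_flux (P F) F = face_integral F f1 + face_integral F g1 - 1/2 * face_integral F h1"
    unfolding facet_flux_def n_def[symmetric] p_def[symmetric]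
    by (simp add: avg scaleR_matrix_vector_assoc[symmetric] jump outer_mult_vec
        f1_def[abs_def] g1_def[abs_def] h1_def[abs_def] z_def)
  have flux2: "facet_flux M F = face_integral F f2 + face_integral F g2 - 1/2 * face_integral F h2"
    unfolding facet_flux_def nM m_def[symmetric]
    by (simp add: avg scaleR_matrix_vector_assoc[symmetric] jumpM outer_mult_vec
        f2_def[abs_def] g2_def[abs_def] h2_def[abs_def] z_def)
  have flux3: "interior_flux (P F) F = face_integral F k1"
    unfolding interior_flux_def n_def[symmetric] p_def[symmetric]
    by (simp add: avg2 k1_def[abs_def])
  have flux4: "interior_flux M F = face_integral F k2"
    unfolding interior_flux_def nM m_def[symmetric]
    by (simp add: avg2 k2_def[abs_def])
  note add = face_integral_add[OF full[OF Pl(1)] Pl(2)]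
  have "facet_flux (P F) F + facet_flux M F + 1/2 * (interior_flux (P F) F + interior_flux M F) =
      face_integral F (\<lambda>x. (((f1 x + f2 x) + (g1 x + g2 x)) + 1/2 * (k1 x + k2 x)) + (- 1/2) * (h1 x + h2 x))"
    using c by (simp only: add face_integral_cmult continuous_on_add continuous_on_mult continuous_on_const
        flux1 flux2 flux3 flux4) (simp add: algebra_simps)
  also have "\<dots> = face_integral F (\<lambda>x. z x * ((p x - m x) \<bullet> (p x - m x)))"
  proof -
    have "f1 x + f2 x + (g1 x + g2 x) + 1/2 * (k1 x + k2 x) + (- 1/2) * (h1 x + h2 x) =
        z x * ((p x - m x) \<bullet> (p x - m x))" for x
    proof -
      have "f1 x + f2 x = z x * ((p x - m x) \<bullet> (p x - m x))"
        by (simp add: f1_def f2_def inner_diff_right algebra_simps)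
      moreover have "(g1 x + g2 x) + 1/2 * (k1 x + k2 x) + (- 1/2) * (h1 x + h2 x) = 0"
        unfolding g1_def g2_def k1_def k2_def h1_def h2_def by (rule interior_flux_identity)
      ultimately show ?thesis by linarith
    qed
    then show ?thesis by simp
  qed
  also have "0 \<le> \<dots>"
    by (rule face_integral_nonneg) (simp add: z_def \<zeta>)
  finally show ?thesis by (simp add: M_def)
qed

text \<open>On the boundary half of the convective flux \<open>(v \<bullet> n) \<bar>v\<bar>\<^sup>2\<close> survives. It may be negative where fluid
  enters, and the penalty dominates it as soon as its parameter is at least one half.\<close>

lemma boundary_face_contribution:
  assumes F: "F \<in> boundary_faces \<T>" and \<zeta>: "1/2 \<le> \<zeta> F"
  shows "0 \<le> facet_flux (P F) F"
proof -
  have FF: "F \<in> faces \<T>" and Fi: "F \<notin> interior_faces \<T>" using F by (auto simp: boundary_faces_def)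
  define n where "n = outward_normal (P F) F"
  define p where "p = piece v (P F)"
  note Pl = plus_element[OF P FF]
  have nn: "n \<bullet> n = 1"
    using outward_normal_hyperplane(1)[OF full[OF Pl(1)] Pl(2)] by (simp add: n_def norm_eq_1)
  have avg: "avg \<T> P (piece v) F x = p x" for x
    using Fi by (simp add: avg_def p_def)
  have jump: "jump_n \<T> P (piece v) F x *v n = p x" for x
    using Fi by (simp add: jump_n_def jump_def face_normal_def p_def n_def[symmetric] outer_mult_vec nn)
  have cont [continuous_intros]: "continuous_on S p" for S
    unfolding p_def using continuous_piece Pl(1) by blast
  define f where "f x = \<zeta> F * \<bar>p x \<bullet> n\<bar> * (p x \<bullet> p x)" for x
  define g where "g x = (p x \<bullet> n) * (p x \<bullet> p x)" for x
  have c: "continuous_on UNIV f" "continuous_on UNIV g"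
    unfolding f_def[abs_def] g_def[abs_def] by (intro continuous_intros)+
  have "facet_flux (P F) F = face_integral F f + face_integral F g - 1/2 * face_integral F g"
    unfolding facet_flux_def n_def[symmetric] p_def[symmetric]
    by (simp add: avg scaleR_matrix_vector_assoc[symmetric] jump outer_mult_vec
        f_def[abs_def] g_def[abs_def] mult.commute)
  also have "\<dots> = face_integral F (\<lambda>x. f x + 1/2 * g x)"
    using c by (simp only: face_integral_add[OF full[OF Pl(1)] Pl(2)] face_integral_cmult
        continuous_on_mult continuous_on_const)
  also have "0 \<le> \<dots>"
  proof (rule face_integral_nonneg)
    fix x
    have "1/2 * \<bar>p x \<bullet> n\<bar> \<le> \<zeta> F * \<bar>p x \<bullet> n\<bar>" using \<zeta> by (rule mult_right_mono) simp
    then have "0 \<le> \<zeta> F * \<bar>p x \<bullet> n\<bar> + 1/2 * (p x \<bullet> n)" by linarith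
    then have "0 \<le> (\<zeta> F * \<bar>p x \<bullet> n\<bar> + 1/2 * (p x \<bullet> n)) * (p x \<bullet> p x)" by simp
    then show "0 \<le> f x + 1/2 * g x" by (simp add: f_def g_def algebra_simps)
  qed
  finally show ?thesis .
qed

lemma convection_nonneg:
  assumes "\<And>F. F \<in> faces \<T> \<Longrightarrow> 0 \<le> \<zeta> F" "\<And>F. F \<in> boundary_faces \<T> \<Longrightarrow> 1/2 \<le> \<zeta> F"
  shows "0 \<le> c_form \<T> P \<zeta> v v v"
  unfolding c_form_eq_fluxes
  using assms interior_faces_subset
  by (intro add_nonneg_nonneg sum_nonneg interior_face_contribution boundary_face_contribution) auto

end

lemma conforming_mesh_simplicial: "conforming_mesh \<Omega> \<T> \<Longrightarrow> simplicial_mesh \<T>"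
  by unfold_locales (auto simp: conforming_mesh_def full_simplex_def)

lemma full_simplex_interior:
  fixes K :: "'a::euclidean_space set"
  assumes "full_simplex K"
  shows "interior K \<noteq> {}"
proof -
  obtain C a c where "barycentric C a c" and KC: "K = convex hull C"
    using full_simplexE[OF assms] by blast
  then interpret barycentric C a c by simp
  have pos: "0 < real (card C)" using card by simp
  have "0 < coord v (\<Sum>v\<in>C. (1 / real (card C)) *\<^sub>R v)" if "v \<in> C" for v
    using coord_combination[of "\<lambda>_. 1 / real (card C)" v] that pos by simp
  then show ?thesis using interior_coord KC by blast
qed

section \<open>Stability of the scheme\<close>

lemma viscous_form_nonneg:
  assumes large: "sufficiently_large mesh P V \<tau> \<eta>\<^sub>0" and v: "v \<in> V h"
    and mesh: "simplicial_mesh (mesh h)"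
    and eta: "\<And>F. F \<in> faces (mesh h) \<Longrightarrow> 0 \<le> \<eta> F" "\<And>F. F \<in> faces (mesh h) \<Longrightarrow> \<eta>\<^sub>0 \<le> \<eta> F"
  shows "0 \<le> a_form (mesh h) (P h) \<tau> \<eta> v v"
proof -
  interpret simplicial_mesh "mesh h" by (rule mesh)
  let ?j = "jump (mesh h) (P h) (piece v)"
  obtain C where C: "0 < C" and coercive: "C * (inner_elements (mesh h) (tau_h \<tau> v) (tau_h \<tau> v) +
      inner_faces (faces (mesh h)) (\<lambda>F x. (\<eta> F / diameter F) *\<^sub>R ?j F x) ?j)
      \<le> a_form (mesh h) (P h) \<tau> \<eta> v v"
    using large v eta unfolding sufficiently_large_def by blast
  have "0 \<le> inner_elements (mesh h) (tau_h \<tau> v) (tau_h \<tau> v)"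
    unfolding inner_elements_def by (intro sum_nonneg Bochner_Integration.integral_nonneg) simp
  moreover have "0 \<le> inner_faces (faces (mesh h)) (\<lambda>F x. (\<eta> F / diameter F) *\<^sub>R ?j F x) ?j"
    unfolding inner_faces_def
  proof (intro sum_nonneg face_integral_nonneg)
    fix F x assume F: "F \<in> faces (mesh h)"
    then obtain K where K: "K \<in> mesh h" "F facet_of K" by (auto simp: faces_def)
    have "bounded F"
      using full[OF K(1)] K(2) facet_of_imp_subset bounded_subset compact_imp_bounded compact_simplex
      by (metis full_simplex_def)
    then have "0 \<le> diameter F" by (rule diameter_ge_0)
    then show "0 \<le> ((\<eta> F / diameter F) *\<^sub>R ?j F x) \<bullet> ?j F x" using eta(1)[OF F] by simp
  qed
  ultimately have "0 \<le> C * (inner_elements (mesh h) (tau_h \<tau> v) (tau_h \<tau> v) +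
      inner_faces (faces (mesh h)) (\<lambda>F x. (\<eta> F / diameter F) *\<^sub>R ?j F x) ?j)"
    using C by simp
  then show ?thesis using coercive by linarith
qed

theorem theorem1:
  fixes \<Omega> :: "(real^'n) set"
    and mesh :: "'h \<Rightarrow> (real^'n) set set"
    and P :: "'h \<Rightarrow> (real^'n) set \<Rightarrow> (real^'n) set"
    and V :: "'h \<Rightarrow> (real^'n \<Rightarrow> real^'n) set"
    and Q :: "'h \<Rightarrow> (real^'n \<Rightarrow> real) set"
    and r k :: nat
    and \<tau> :: "real^'n^'n \<Rightarrow> real^'n^'n"
    and \<eta>\<^sub>0 \<nu> T :: real
    and h :: 'h
    and \<eta> \<zeta> :: "(real^'n) set \<Rightarrow> real"
    and d :: "(real^'n \<Rightarrow> real^'n) \<Rightarrow> (real^'n \<Rightarrow> real^'n) \<Rightarrow> real"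
    and f :: "real \<Rightarrow> real^'n \<Rightarrow> real^'n"
    and X :: "(real^'n \<Rightarrow> real^'n) set"
    and I :: "(real^'n \<Rightarrow> real^'n) \<Rightarrow> (real^'n \<Rightarrow> real^'n)"
    and u\<^sub>0 :: "real^'n \<Rightarrow> real^'n"
    and u u' :: "real \<Rightarrow> real^'n \<Rightarrow> real^'n"
    and p :: "real \<Rightarrow> real^'n \<Rightarrow> real"
  assumes dim: "CARD('n) \<in> {2, 3}"
    and domain: "bounded_lipschitz_domain \<Omega>"
    and mesh: "\<And>h. conforming_mesh \<Omega> (mesh h)"
    and shape_regular: "shape_regular_family mesh"
    and orientation: "\<And>h. orientation (mesh h) (P h)"
    and velocity_space: "\<And>h. function_subspace (V h)"
      "\<And>h. V h \<subseteq> broken_vector_space \<Omega> (mesh h) r"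
    and pressure_space: "\<And>h. function_subspace (Q h)"
      "\<And>h. Q h \<subseteq> broken_pressure_space \<Omega> (mesh h) k"
    and viscosity: "\<nu> > 0"
    and final_time: "T > 0"
    and tensor: "\<tau> \<in> viscous_tensors"
    and large: "sufficiently_large mesh P V \<tau> \<eta>\<^sub>0"
    and eta: "\<And>F. F \<in> faces (mesh h) \<Longrightarrow> \<eta> F \<ge> 0"
      "\<And>F. F \<in> faces (mesh h) \<Longrightarrow> \<eta> F \<ge> \<eta>\<^sub>0"
    and zeta: "\<And>F. F \<in> faces (mesh h) \<Longrightarrow> \<zeta> F \<ge> 0"
      "\<And>F. F \<in> boundary_faces (mesh h) \<Longrightarrow> \<zeta> F \<ge> 1/2"
    and d_linear:
      "\<And>v w z. v \<in> V h \<Longrightarrow> w \<in> V h \<Longrightarrow> z \<in> V h \<Longrightarrow> d v (\<lambda>x. w x + z x) = d v w + d v z"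
      "\<And>v w c. v \<in> V h \<Longrightarrow> w \<in> V h \<Longrightarrow> d v (\<lambda>x. c *\<^sub>R w x) = c * d v w"
    and d_semidefinite: "\<And>v. v \<in> V h \<Longrightarrow> d v v \<ge> 0"
    and d_consistent: "\<And>u\<^sub>e p\<^sub>e t v. navier_stokes_solution \<Omega> T \<nu> \<tau> f u\<^sub>0 u\<^sub>e p\<^sub>e \<Longrightarrow>
      t \<in> {0<..T} \<Longrightarrow> v \<in> V h \<Longrightarrow> d (u\<^sub>e t) v = 0"
    and force_L2: "AE s in lebesgue_on {0..T}. f s \<in> L2_space \<Omega>"
    and force_L1: "\<And>t. t \<in> {0..T} \<Longrightarrow> integrable (lebesgue_on {0..t}) (\<lambda>s. L2_norm \<Omega> (f s))"
    and interpolation: "I \<in> X \<rightarrow> V h" "u\<^sub>0 \<in> X"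
    and u_mem: "\<And>t. t \<in> {0..T} \<Longrightarrow> u t \<in> V h"
    and p_mem: "\<And>t. t \<in> {0<..T} \<Longrightarrow> p t \<in> Q h"
    and u_continuous: "L2_continuous_on u \<Omega> {0..T}"
    and u_derivative: "\<And>t. t \<in> {0<..T} \<Longrightarrow> has_L2_derivative u (u' t) \<Omega> {0..T} t"
    and momentum: "\<And>t v. t \<in> {0<..T} \<Longrightarrow> v \<in> V h \<Longrightarrow>
      L2_inner \<Omega> (u' t) v + c_form (mesh h) (P h) \<zeta> (u t) (u t) v
        + \<nu> * a_form (mesh h) (P h) \<tau> \<eta> (u t) v + d (u t) v - b_form (mesh h) (P h) v (p t)
      = L2_inner \<Omega> (f t) v"
    and continuity: "\<And>t q. t \<in> {0<..T} \<Longrightarrow> q \<in> Q h \<Longrightarrow> b_form (mesh h) (P h) (u t) q = 0"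
    and initial: "AE x\<in>\<Omega> in lebesgue. u 0 x = I u\<^sub>0 x"
  shows "\<forall>t\<in>{0..T}. L2_norm \<Omega> (u t) \<le>
    L2_norm \<Omega> (u 0) + (\<integral>s. L2_norm \<Omega> (f s) \<partial>lebesgue_on {0..t})"
proof
  fix t assume t: "t \<in> {0..T}"
  have simplicial: "simplicial_mesh (mesh h)" using mesh by (rule conforming_mesh_simplicial)
  have uL2: "u s \<in> L2_space \<Omega>" if "s \<in> {0..T}" for s
    using u_mem[OF that] velocity_space(2)[of h] by (auto simp: broken_vector_space_def)
  have dissipation: "L2_inner \<Omega> (u' s) (u s) \<le> L2_inner \<Omega> (f s) (u s)" if s: "s \<in> {0<..T}" for s
  proof -
    have us: "u s \<in> V h" using u_mem s by simp
    have "0 \<le> c_form (mesh h) (P h) \<zeta> (u s) (u s) (u s)"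
    proof (rule convection_nonneg[OF simplicial orientation])
      fix K assume K: "K \<in> mesh h"
      then have "interior K \<noteq> {}"
        using simplicial_mesh.full[OF simplicial] full_simplex_interior by blast
      then show "polynomial_function (piece (u s) K)"
        using polynomial_function_piece[OF _ K] velocity_space(2)[of h] us by blast
    qed (use zeta in auto)
    moreover have "0 \<le> \<nu> * a_form (mesh h) (P h) \<tau> \<eta> (u s) (u s)"
      using viscosity viscous_form_nonneg[OF large us simplicial eta] by simp
    moreover have "b_form (mesh h) (P h) (u s) (p s) = 0"
      using continuity[OF s p_mem[OF s]] .
    ultimately show ?thesis
      using momentum[OF s us] d_semidefinite[OF us] by linarith
  qed
  show "L2_norm \<Omega> (u t) \<le> L2_norm \<Omega> (u 0) + (\<integral>s. L2_norm \<Omega> (f s) \<partial>lebesgue_on {0..t})"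
    by (rule energy_estimate[OF uL2 u_continuous u_derivative force_L2 force_L1[OF t] dissipation t])
qed

end
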